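(* Let $\Lambda=\{\lambda_n\}_{n\ge0}$ and $\mathcal M=\{\mu_n\}_{n\ge0}$ be sequences in $\mathbb D$ both satisfying the Carleson condition, such that $\lim_{n\to\infty}B_{\mathcal M}(\lambda_n)=0$. Suppose that $\widetilde{\mathcal K}_{\Lambda,B_{\mathcal M}}$ is a Riesz basis in $K_{B_{\mathcal M}}$. Then $\lim_{n\to\infty}B_\Lambda(\mu_n)=0$ and $\widetilde{\mathcal K}_{\mathcal M,B_\Lambda}$ is a Riesz basis in $K_{B_\Lambda}$.
   Context: Carleson condition for $\{z_n\}$: $\inf_n\prod_{m\ne n}\left|\frac{z_m-z_n}{1-\bar z_mz_n}\right|>0$. $B_\Lambda$, $B_{\mathcal M}$ are the Blaschke products with zero sets $\Lambda$, $\mathcal M$. For inner $\theta$: $K_\theta=H^2\ominus\theta H^2$, $k_\theta(\lambda,z)=\frac{1-\overline{\theta(\lambda)}\theta(z)}{1-\bar\lambda z}$, $\widetilde{\mathcal K}_{\Lambda,\theta}=\{k_\theta(\lambda,\cdot)/\|k_\theta(\lambda,\cdot)\|_2\}_{\lambda\in\Lambda}$. A Riesz basis of a Hilbert space $H$ is a complete family $\{x_n\}$ with $c\sum|a_n|^2\le\|\sum a_nx_n\|^2\le C\sum|a_n|^2$ for some $c,C>0$. *)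

theory Defs
  imports "HOL-Analysis.Analysis"
begin

definition taylor_coeff :: "(complex \<Rightarrow> complex) \<Rightarrow> nat \<Rightarrow> complex" where
  "taylor_coeff f n = (deriv ^^ n) f 0 / of_nat (fact n)"

definition H2 :: "(complex \<Rightarrow> complex) set" where
  "H2 = {f. f holomorphic_on ball 0 1 \<and> summable (\<lambda>n. (cmod (taylor_coeff f n))\<^sup>2)}"

definition h2_norm :: "(complex \<Rightarrow> complex) \<Rightarrow> real" where
  "h2_norm f = sqrt (\<Sum>n. (cmod (taylor_coeff f n))\<^sup>2)"

definition h2_inner :: "(complex \<Rightarrow> complex) \<Rightarrow> (complex \<Rightarrow> complex) \<Rightarrow> complex" where
  "h2_inner f g = (\<Sum>n. taylor_coeff f n * cnj (taylor_coeff g n))"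

definition model_space :: "(complex \<Rightarrow> complex) \<Rightarrow> (complex \<Rightarrow> complex) set" where
  "model_space \<theta> = {f \<in> H2. \<forall>g\<in>H2. h2_inner f (\<lambda>z. \<theta> z * g z) = 0}"

definition model_kernel :: "(complex \<Rightarrow> complex) \<Rightarrow> complex \<Rightarrow> complex \<Rightarrow> complex" where
  "model_kernel \<theta> w z = (1 - cnj (\<theta> w) * \<theta> z) / (1 - cnj w * z)"

definition normalized_kernel :: "(complex \<Rightarrow> complex) \<Rightarrow> complex \<Rightarrow> complex \<Rightarrow> complex" where
  "normalized_kernel \<theta> w = (\<lambda>z. model_kernel \<theta> w z / of_real (h2_norm (model_kernel \<theta> w)))"

definition riesz_basis :: "(complex \<Rightarrow> complex) set \<Rightarrow> (nat \<Rightarrow> complex \<Rightarrow> complex) \<Rightarrow> bool" where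
  "riesz_basis H x \<longleftrightarrow>
     (\<forall>n. x n \<in> H) \<and>
     (\<forall>f\<in>H. \<forall>\<epsilon>>0. \<exists>N a. h2_norm (\<lambda>z. f z - (\<Sum>n<N. a n * x n z)) < \<epsilon>) \<and>
     (\<exists>c C. c > 0 \<and> C > 0 \<and>
        (\<forall>N (a :: nat \<Rightarrow> complex).
            c * (\<Sum>n<N. (cmod (a n))\<^sup>2) \<le> (h2_norm (\<lambda>z. \<Sum>n<N. a n * x n z))\<^sup>2 \<and>
            (h2_norm (\<lambda>z. \<Sum>n<N. a n * x n z))\<^sup>2 \<le> C * (\<Sum>n<N. (cmod (a n))\<^sup>2)))"

definition pseudo_hyp :: "complex \<Rightarrow> complex \<Rightarrow> real" where
  "pseudo_hyp w z = cmod ((w - z) / (1 - cnj w * z))"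

text \<open>inf_n prod_{m /= n} |...| > 0; the factors are at most 1, so the infinite product over
  m /= n is the infimum of its partial products.\<close>
definition carleson :: "(nat \<Rightarrow> complex) \<Rightarrow> bool" where
  "carleson z \<longleftrightarrow> (\<exists>\<delta>>0. \<forall>n N. (\<Prod>m\<in>{..<N} - {n}. pseudo_hyp (z m) (z n)) \<ge> \<delta>)"

definition blaschke_factor :: "complex \<Rightarrow> complex \<Rightarrow> complex" where
  "blaschke_factor a z = (if a = 0 then z else (of_real (cmod a) / a) * (a - z) / (1 - cnj a * z))"

definition blaschke :: "(nat \<Rightarrow> complex) \<Rightarrow> complex \<Rightarrow> complex" where
  "blaschke a z = lim (\<lambda>N. \<Prod>n<N. blaschke_factor (a n) z)"

end

theory Submission
  imports Defs "HOL-Complex_Analysis.Complex_Analysis"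
begin

text \<open>
  Write $A$ and $B$ for the Blaschke products of \<open>lam\<close> and \<open>mu\<close>. P. Jones' interpolating functions
  show that the normalized Szego kernels of a Carleson sequence are unconditional, and choosing signs
  by the parallelogram law turns this into two-sided Riesz bounds; moreover these kernels span
  $K_A$, respectively $K_B$. Since \<open>model_kernel B w\<close> is the projection of the Szego kernel at $w$ to
  $K_B$, the hypothesis says that the compression $P_B|K_A$ is bounded below with dense range.
  Its adjoint is $P_A|K_B$, which therefore has the same properties, and it maps the Szego kernels
  at \<open>mu\<close> to the kernels of $K_A$ at \<open>mu\<close>.

  For the limit, suppose $|A(\mu_m)| \ge d$ for infinitely many $m$. For every finite set $Q$ of
  such $m$ the product $B_Q$ is bounded below on \<open>lam\<close> uniformly in $Q$, so $B / B_Q$ is small on all but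
  $n_0$ points of \<open>lam\<close>. If $Q$ has more than $n_0$ elements, some nonzero $h \in K_{B_Q}$ vanishes
  at these points, and $(B / B_Q) h \in K_B$ violates the lower frame bound of the kernels at \<open>lam\<close>.
\<close>

section \<open>The Hardy space\<close>

text \<open>No boundary values or integrals occur: everything is read off Taylor coefficients at 0.
  Projections onto model spaces are not built in general either; they are exhibited on finite
  combinations of Szego kernels, where they are finite combinations of model kernels. Hence the
  duality argument runs on finite sums with an error that is sent to 0, and completeness on the dual
  side comes from an iteration: for f in K_A, Pythagoras and the lower bound put P_B f within q
  ||f|| of f, where q = \<open>sqrt (1 - \<kappa>)\<close> < 1; P_A brings it no further from f, and
  repeating this on the remainder shrinks the error geometrically. Projected unit kernels and
  normalised kernels differ by the factors sqrt(1 - |B(lam n)|^2), which stay away from 0 since |B|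
  < 1 and B(lam n) tends to 0; the dual factors do so by the transferred lower bound. In the limit
  argument, the uniform bound for B_Q on \<open>lam\<close> is the Carleson embedding of
  \<open>mu\<close> tested on Szego kernels at the points of \<open>lam\<close>, and the
  contradiction is reached through the Carleson embedding of \<open>lam\<close> applied to
  h.\<close>

lemma taylor_coeff_cong:
  assumes "\<And>z. z \<in> ball 0 1 \<Longrightarrow> f z = g z"
  shows "taylor_coeff f n = taylor_coeff g n"
proof -
  have "eventually (\<lambda>z. z \<in> ball (0::complex) 1) (nhds 0)"
    by (rule eventually_nhds_in_open) auto
  then have "eventually (\<lambda>z. f z = g z) (nhds 0)"
    by eventually_elim (use assms in auto)
  then show ?thesis
    unfolding taylor_coeff_def using higher_deriv_cong_ev[of f g 0 0 n] by simp
qed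

lemma taylor_coeff_sums:
  assumes "f holomorphic_on ball 0 1" "z \<in> ball 0 1"
  shows "(\<lambda>n. taylor_coeff f n * z ^ n) sums f z"
  using holomorphic_power_series[OF assms] by (simp add: taylor_coeff_def)

lemma taylor_coeff_eqI:
  assumes "\<And>z. z \<in> ball 0 1 \<Longrightarrow> (\<lambda>n. a n * z ^ n) sums f z"
  shows "taylor_coeff f n = a n"
proof -
  have "eventually (\<lambda>z. z \<in> ball (0::complex) 1) (nhds 0)"
    by (rule eventually_nhds_in_open) auto
  then have "eventually (\<lambda>u. (\<lambda>n. fps_nth (Abs_fps a) n * u ^ n) sums f u) (nhds 0)"
    by eventually_elim (use assms in auto)
  then have "f has_fps_expansion Abs_fps a"
    by (rule has_fps_expansionI)
  from fps_nth_fps_expansion[OF this, of n] show ?thesis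
    by (simp add: taylor_coeff_def)
qed

lemma holomorphic_on_ball_if_sums:
  assumes "\<And>z. z \<in> ball 0 1 \<Longrightarrow> (\<lambda>n. a n * z ^ n) sums f z"
  shows "f holomorphic_on ball 0 1"
  using power_series_holomorphic[of 0 1 a f] assms by simp

lemma taylor_coeff_add:
  assumes "f holomorphic_on ball 0 1" "g holomorphic_on ball 0 1"
  shows "taylor_coeff (\<lambda>z. f z + g z) n = taylor_coeff f n + taylor_coeff g n"
proof (rule taylor_coeff_eqI)
  fix z :: complex assume z: "z \<in> ball 0 1"
  show "(\<lambda>n. (taylor_coeff f n + taylor_coeff g n) * z ^ n) sums (f z + g z)"
    using sums_add[OF assms[THEN taylor_coeff_sums, OF z]] by (simp only: distrib_right)
qed

lemma taylor_coeff_cmult: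
  assumes "f holomorphic_on ball 0 1"
  shows "taylor_coeff (\<lambda>z. c * f z) n = c * taylor_coeff f n"
proof (rule taylor_coeff_eqI)
  fix z :: complex assume z: "z \<in> ball 0 1"
  show "(\<lambda>n. (c * taylor_coeff f n) * z ^ n) sums (c * f z)"
    using sums_mult[OF taylor_coeff_sums[OF assms z], of c] by (simp only: mult.assoc)
qed

lemma H2_holomorphic: "f \<in> H2 \<Longrightarrow> f holomorphic_on ball 0 1"
  by (simp add: H2_def)

lemma H2_summable: "f \<in> H2 \<Longrightarrow> summable (\<lambda>n. (cmod (taylor_coeff f n))\<^sup>2)"
  by (simp add: H2_def)

lemma H2_cong:
  assumes "f \<in> H2" "\<And>z. z \<in> ball 0 1 \<Longrightarrow> f z = g z"
  shows "g \<in> H2"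
proof -
  have "g holomorphic_on ball 0 1"
    using holomorphic_transform[OF H2_holomorphic[OF assms(1)]] assms(2) by blast
  moreover have "taylor_coeff g = taylor_coeff f"
    using taylor_coeff_cong[of g f] assms(2) by auto
  ultimately show ?thesis using assms(1) by (simp add: H2_def)
qed

lemma h2_inner_cong:
  assumes "\<And>z. z \<in> ball 0 1 \<Longrightarrow> f z = f' z" "\<And>z. z \<in> ball 0 1 \<Longrightarrow> g z = g' z"
  shows "h2_inner f g = h2_inner f' g'"
  unfolding h2_inner_def
  using taylor_coeff_cong[of f f'] taylor_coeff_cong[of g g'] assms by simp

lemma h2_norm_cong:
  assumes "\<And>z. z \<in> ball 0 1 \<Longrightarrow> f z = f' z"
  shows "h2_norm f = h2_norm f'"
  unfolding h2_norm_def using taylor_coeff_cong[of f f'] assms by simp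

lemma summable_norm_mult_square_summable:
  fixes a b :: "nat \<Rightarrow> complex"
  assumes "summable (\<lambda>n. (cmod (a n))\<^sup>2)" "summable (\<lambda>n. (cmod (b n))\<^sup>2)"
  shows "summable (\<lambda>n. cmod (a n) * cmod (b n))"
proof (rule summable_comparison_test')
  show "summable (\<lambda>n. (cmod (a n))\<^sup>2 + (cmod (b n))\<^sup>2)"
    using assms by (rule summable_add)
  show "norm (cmod (a n) * cmod (b n)) \<le> (cmod (a n))\<^sup>2 + (cmod (b n))\<^sup>2" if "n \<ge> 0" for n
  proof -
    have "0 \<le> cmod (a n) * cmod (b n)" by simp
    then show ?thesis
      using sum_squares_bound[of "cmod (a n)" "cmod (b n)"] unfolding real_norm_def by linarith
  qed
qed

lemma h2_inner_summable:
  assumes "f \<in> H2" "g \<in> H2"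
  shows "summable (\<lambda>n. taylor_coeff f n * cnj (taylor_coeff g n))"
  by (rule summable_norm_cancel)
     (use summable_norm_mult_square_summable[OF assms[THEN H2_summable]] in \<open>simp add: norm_mult\<close>)

lemma H2_add:
  assumes "f \<in> H2" "g \<in> H2"
  shows "(\<lambda>z. f z + g z) \<in> H2"
proof -
  have "summable (\<lambda>n. (cmod (taylor_coeff f n + taylor_coeff g n))\<^sup>2)"
  proof (rule summable_comparison_test')
    show "summable (\<lambda>n. 2 * (cmod (taylor_coeff f n))\<^sup>2 + 2 * (cmod (taylor_coeff g n))\<^sup>2)"
      by (intro summable_add summable_mult H2_summable assms)
    fix n :: nat
    have "(cmod (taylor_coeff f n + taylor_coeff g n))\<^sup>2
      \<le> (cmod (taylor_coeff f n) + cmod (taylor_coeff g n))\<^sup>2"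
      by (intro power_mono norm_triangle_ineq) auto
    also have "\<dots> \<le> 2 * (cmod (taylor_coeff f n))\<^sup>2 + 2 * (cmod (taylor_coeff g n))\<^sup>2"
      using sum_squares_bound[of "cmod (taylor_coeff f n)" "cmod (taylor_coeff g n)"]
      by (simp add: power2_sum)
    finally show "norm ((cmod (taylor_coeff f n + taylor_coeff g n))\<^sup>2)
      \<le> 2 * (cmod (taylor_coeff f n))\<^sup>2 + 2 * (cmod (taylor_coeff g n))\<^sup>2" by simp
  qed
  then show ?thesis
    using assms by (auto simp: H2_def taylor_coeff_add intro!: holomorphic_intros)
qed

lemma H2_cmult:
  assumes "f \<in> H2"
  shows "(\<lambda>z. c * f z) \<in> H2"
  using assms
  by (auto simp: H2_def taylor_coeff_cmult norm_mult power_mult_distrib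
      intro!: holomorphic_intros summable_mult)

lemma H2_diff:
  assumes "f \<in> H2" "g \<in> H2"
  shows "(\<lambda>z. f z - g z) \<in> H2"
  using H2_add[OF assms(1) H2_cmult[OF assms(2), of "-1"]] by simp

lemma taylor_coeff_zero: "taylor_coeff (\<lambda>z. 0) n = 0"
  by (rule taylor_coeff_eqI[where a = "\<lambda>_. 0"]) simp

lemma H2_zero: "(\<lambda>z. 0) \<in> H2"
  by (simp add: H2_def taylor_coeff_zero)

lemma H2_sum:
  assumes "\<And>i. i \<in> I \<Longrightarrow> f i \<in> H2"
  shows "(\<lambda>z. \<Sum>i\<in>I. c i * f i z) \<in> H2"
  using assms by (induction I rule: infinite_finite_induct) (auto intro!: H2_add H2_cmult H2_zero)

lemma h2_inner_add_left:
  assumes "f \<in> H2" "g \<in> H2" "h \<in> H2"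
  shows "h2_inner (\<lambda>z. f z + g z) h = h2_inner f h + h2_inner g h"
  unfolding h2_inner_def
  using suminf_add[OF h2_inner_summable[OF assms(1,3)] h2_inner_summable[OF assms(2,3)]]
  by (simp add: taylor_coeff_add assms[THEN H2_holomorphic] algebra_simps)

lemma h2_inner_cmult_left:
  assumes "f \<in> H2" "h \<in> H2"
  shows "h2_inner (\<lambda>z. c * f z) h = c * h2_inner f h"
  unfolding h2_inner_def
  using suminf_mult[OF h2_inner_summable[OF assms], of c]
  by (simp add: taylor_coeff_cmult assms[THEN H2_holomorphic] algebra_simps)

lemma h2_inner_commute:
  assumes "f \<in> H2" "g \<in> H2"
  shows "h2_inner g f = cnj (h2_inner f g)"
proof -
  have "(\<lambda>n. cnj (taylor_coeff f n * cnj (taylor_coeff g n))) sums cnj (h2_inner f g)"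
    unfolding h2_inner_def by (subst sums_cnj) (rule summable_sums[OF h2_inner_summable[OF assms]])
  then show ?thesis
    unfolding h2_inner_def by (simp add: sums_iff mult.commute)
qed

lemma h2_inner_add_right:
  assumes "f \<in> H2" "g \<in> H2" "h \<in> H2"
  shows "h2_inner h (\<lambda>z. f z + g z) = h2_inner h f + h2_inner h g"
  using h2_inner_add_left[OF assms]
    h2_inner_commute[OF H2_add[OF assms(1,2)] assms(3)]
    h2_inner_commute[OF assms(1,3)] h2_inner_commute[OF assms(2,3)] by simp

lemma h2_inner_cmult_right:
  assumes "f \<in> H2" "h \<in> H2"
  shows "h2_inner h (\<lambda>z. c * f z) = cnj c * h2_inner h f"
  using h2_inner_cmult_left[OF assms, of c]
    h2_inner_commute[OF H2_cmult[OF assms(1)] assms(2), of c] h2_inner_commute[OF assms] by simp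

lemma h2_inner_diff_left:
  assumes "f \<in> H2" "g \<in> H2" "h \<in> H2"
  shows "h2_inner (\<lambda>z. f z - g z) h = h2_inner f h - h2_inner g h"
  using h2_inner_add_left[OF assms(1) H2_cmult[OF assms(2), of "-1"] assms(3)]
    h2_inner_cmult_left[OF assms(2,3), of "-1"] by simp

lemma h2_inner_diff_right:
  assumes "f \<in> H2" "g \<in> H2" "h \<in> H2"
  shows "h2_inner h (\<lambda>z. f z - g z) = h2_inner h f - h2_inner h g"
  using h2_inner_diff_left[OF assms]
    h2_inner_commute[OF H2_diff[OF assms(1,2)] assms(3)]
    h2_inner_commute[OF assms(1,3)] h2_inner_commute[OF assms(2,3)] by simp

lemma h2_inner_zero_left: "h2_inner (\<lambda>z. 0) h = 0"
  by (simp add: h2_inner_def taylor_coeff_zero)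

lemma h2_inner_sum_left:
  assumes "\<And>i. i \<in> I \<Longrightarrow> f i \<in> H2" "h \<in> H2"
  shows "h2_inner (\<lambda>z. \<Sum>i\<in>I. c i * f i z) h = (\<Sum>i\<in>I. c i * h2_inner (f i) h)"
  using assms
proof (induction I rule: infinite_finite_induct)
  case (insert i I)
  have "h2_inner (\<lambda>z. c i * f i z + (\<Sum>i\<in>I. c i * f i z)) h
    = c i * h2_inner (f i) h + h2_inner (\<lambda>z. \<Sum>i\<in>I. c i * f i z) h"
    using insert.prems
    by (subst h2_inner_add_left) (auto intro!: H2_sum H2_cmult simp: h2_inner_cmult_left)
  then show ?case using insert by simp
qed (auto simp: h2_inner_zero_left)

lemma h2_inner_sum_right:
  assumes "\<And>i. i \<in> I \<Longrightarrow> f i \<in> H2" "h \<in> H2"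
  shows "h2_inner h (\<lambda>z. \<Sum>i\<in>I. c i * f i z) = (\<Sum>i\<in>I. cnj (c i) * h2_inner h (f i))"
proof -
  have F: "(\<lambda>z. \<Sum>i\<in>I. c i * f i z) \<in> H2" using assms by (intro H2_sum)
  have "h2_inner h (\<lambda>z. \<Sum>i\<in>I. c i * f i z) = cnj (\<Sum>i\<in>I. c i * h2_inner (f i) h)"
    unfolding h2_inner_commute[OF F assms(2)] using h2_inner_sum_left[of I f h c] assms by simp
  also have "\<dots> = (\<Sum>i\<in>I. cnj (c i) * h2_inner h (f i))"
    unfolding cnj_sum by (rule sum.cong) (use h2_inner_commute[OF assms(1,2)] in auto)
  finally show ?thesis .
qed

lemma h2_norm_nonneg: "f \<in> H2 \<Longrightarrow> h2_norm f \<ge> 0"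
  unfolding h2_norm_def by (auto intro!: suminf_nonneg H2_summable)

lemma h2_norm_power2:
  assumes "f \<in> H2"
  shows "(h2_norm f)\<^sup>2 = (\<Sum>n. (cmod (taylor_coeff f n))\<^sup>2)"
  unfolding h2_norm_def using assms by (simp add: suminf_nonneg H2_summable)

lemma h2_inner_self:
  assumes "f \<in> H2"
  shows "h2_inner f f = of_real ((h2_norm f)\<^sup>2)"
  unfolding h2_norm_power2[OF assms] h2_inner_def
  by (simp add: suminf_of_real[OF H2_summable[OF assms]] complex_norm_square del: of_real_power)

lemma h2_norm_cmult:
  assumes "f \<in> H2"
  shows "h2_norm (\<lambda>z. c * f z) = cmod c * h2_norm f"
proof -
  have "(\<Sum>n. (cmod (taylor_coeff (\<lambda>z. c * f z) n))\<^sup>2)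
    = (cmod c)\<^sup>2 * (\<Sum>n. (cmod (taylor_coeff f n))\<^sup>2)"
    by (subst suminf_mult[symmetric])
       (use assms in \<open>auto simp: taylor_coeff_cmult[OF H2_holomorphic] norm_mult power_mult_distrib H2_summable\<close>)
  then show ?thesis by (simp add: h2_norm_def real_sqrt_mult)
qed

lemma h2_norm_zero: "h2_norm (\<lambda>z. 0) = 0"
  by (simp add: h2_norm_def taylor_coeff_zero)

lemma h2_Cauchy_Schwarz:
  assumes "f \<in> H2" "g \<in> H2"
  shows "cmod (h2_inner f g) \<le> h2_norm f * h2_norm g"
proof -
  let ?a = "taylor_coeff f" and ?b = "taylor_coeff g"
  have "(\<lambda>N. \<Sum>n<N. ?a n * cnj (?b n)) \<longlonglongrightarrow> h2_inner f g"
    unfolding h2_inner_def by (rule summable_LIMSEQ[OF h2_inner_summable[OF assms]])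
  then have lim: "(\<lambda>N. cmod (\<Sum>n<N. ?a n * cnj (?b n))) \<longlonglongrightarrow> cmod (h2_inner f g)"
    by (rule tendsto_norm)
  have L2: "L2_set (\<lambda>n. cmod (taylor_coeff h n)) {..<N} \<le> h2_norm h" if "h \<in> H2" for h N
    unfolding L2_set_def h2_norm_def real_sqrt_le_iff
    by (rule sum_le_suminf[OF H2_summable[OF that]]) auto
  have "cmod (\<Sum>n<N. ?a n * cnj (?b n)) \<le> h2_norm f * h2_norm g" for N
  proof -
    have "cmod (\<Sum>n<N. ?a n * cnj (?b n)) \<le> (\<Sum>n<N. \<bar>cmod (?a n)\<bar> * \<bar>cmod (?b n)\<bar>)"
      by (rule order.trans[OF norm_sum]) (simp add: norm_mult)
    also have "\<dots> \<le> L2_set (\<lambda>n. cmod (?a n)) {..<N} * L2_set (\<lambda>n. cmod (?b n)) {..<N}"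
      by (rule L2_set_mult_ineq)
    also have "\<dots> \<le> h2_norm f * h2_norm g"
      by (intro mult_mono L2 assms h2_norm_nonneg L2_set_nonneg)
    finally show ?thesis .
  qed
  then show ?thesis by (intro LIMSEQ_le_const2[OF lim]) auto
qed

lemma h2_norm_add_power2:
  assumes "f \<in> H2" "g \<in> H2"
  shows "(h2_norm (\<lambda>z. f z + g z))\<^sup>2 = (h2_norm f)\<^sup>2 + (h2_norm g)\<^sup>2 + 2 * Re (h2_inner f g)"
proof -
  have "complex_of_real ((h2_norm (\<lambda>z. f z + g z))\<^sup>2)
    = h2_inner f f + h2_inner g g + (h2_inner f g + cnj (h2_inner f g))"
    using assms by (simp add: h2_inner_self[symmetric] H2_add h2_inner_add_left h2_inner_add_right
        h2_inner_commute[OF assms] del: of_real_power)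
  then have "Re (complex_of_real ((h2_norm (\<lambda>z. f z + g z))\<^sup>2))
    = Re (h2_inner f f) + Re (h2_inner g g) + 2 * Re (h2_inner f g)"
    by (simp only: plus_complex.sel cnj.sel)
  then show ?thesis using assms by (simp add: h2_inner_self del: of_real_power)
qed

lemma h2_norm_diff_power2:
  assumes "f \<in> H2" "g \<in> H2"
  shows "(h2_norm (\<lambda>z. f z - g z))\<^sup>2 = (h2_norm f)\<^sup>2 + (h2_norm g)\<^sup>2 - 2 * Re (h2_inner f g)"
  using h2_norm_add_power2[OF assms(1) H2_cmult[OF assms(2), of "-1"]]
    h2_inner_cmult_right[OF assms(2,1), of "-1"] h2_norm_cmult[OF assms(2), of "-1"] by simp

lemma h2_norm_triangle:
  assumes "f \<in> H2" "g \<in> H2"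
  shows "h2_norm (\<lambda>z. f z + g z) \<le> h2_norm f + h2_norm g"
proof (rule power2_le_imp_le)
  have "Re (h2_inner f g) \<le> h2_norm f * h2_norm g"
    using h2_Cauchy_Schwarz[OF assms] complex_Re_le_cmod order.trans by blast
  then show "(h2_norm (\<lambda>z. f z + g z))\<^sup>2 \<le> (h2_norm f + h2_norm g)\<^sup>2"
    by (simp add: h2_norm_add_power2[OF assms] power2_sum)
  show "0 \<le> h2_norm f + h2_norm g"
    using assms by (simp add: h2_norm_nonneg)
qed

lemma h2_norm_diff_commute:
  assumes "f \<in> H2" "g \<in> H2"
  shows "h2_norm (\<lambda>z. f z - g z) = h2_norm (\<lambda>z. g z - f z)"
  using h2_norm_cmult[OF H2_diff[OF assms], of "-1"] by simp

lemma h2_norm_diff_triangle: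
  assumes "f \<in> H2" "g \<in> H2" "h \<in> H2"
  shows "h2_norm (\<lambda>z. f z - h z) \<le> h2_norm (\<lambda>z. f z - g z) + h2_norm (\<lambda>z. g z - h z)"
  using h2_norm_triangle[OF H2_diff[OF assms(1,2)] H2_diff[OF assms(2,3)]] by simp

lemma h2_norm_le_diff:
  assumes "f \<in> H2" "g \<in> H2"
  shows "h2_norm f \<le> h2_norm g + h2_norm (\<lambda>z. f z - g z)"
  using h2_norm_triangle[OF assms(2) H2_diff[OF assms]] by simp

lemma H2I_sums:
  assumes "\<And>z. z \<in> ball 0 1 \<Longrightarrow> (\<lambda>n. a n * z ^ n) sums f z"
    and "summable (\<lambda>n. (cmod (a n))\<^sup>2)"
  shows "f \<in> H2"
  using holomorphic_on_ball_if_sums[OF assms(1)] taylor_coeff_eqI[OF assms(1)] assms(2)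
  by (simp add: H2_def)

lemma summable_norm_cnj_power:
  assumes "w \<in> ball 0 1"
  shows "summable (\<lambda>n. (cmod (cnj w ^ n))\<^sup>2)"
proof -
  have "(cmod (cnj w ^ n))\<^sup>2 = ((cmod w)\<^sup>2) ^ n" for n
    by (simp add: norm_power mult.commute flip: power_mult)
  then show ?thesis using assms by (simp add: abs_square_less_1)
qed

lemma power_series_summable_if_square_summable:
  fixes z :: complex
  assumes "summable (\<lambda>n. (cmod (a n))\<^sup>2)" "z \<in> ball 0 1"
  shows "summable (\<lambda>n. a n * z ^ n)"
proof (rule summable_norm_cancel)
  have "summable (\<lambda>n. (cmod (z ^ n))\<^sup>2)"
    using summable_norm_cnj_power[OF assms(2)] by (simp add: norm_power)
  from summable_norm_mult_square_summable[OF assms(1) this]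
  show "summable (\<lambda>n. norm (a n * z ^ n))" by (simp add: norm_mult)
qed

section \<open>Szego kernels as reproducing kernels of H^2\<close>

definition szego :: "complex \<Rightarrow> complex \<Rightarrow> complex" where
  "szego w z = 1 / (1 - cnj w * z)"

lemma cmod_cnj_mult_less_1:
  assumes "w \<in> ball 0 1" "z \<in> ball 0 1"
  shows "cmod (cnj w * z) < 1"
  using assms mult_strict_mono'[of "cmod w" 1 "cmod z" 1] by (simp add: norm_mult)

lemma one_minus_cnj_mult_nonzero:
  assumes "w \<in> ball 0 1" "z \<in> ball 0 1"
  shows "1 - cnj w * z \<noteq> 0"
  using cmod_cnj_mult_less_1[OF assms] by (metis norm_one order_less_irrefl right_minus_eq)

lemma szego_sums:
  assumes "w \<in> ball 0 1" "z \<in> ball 0 1"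
  shows "(\<lambda>n. cnj w ^ n * z ^ n) sums szego w z"
  using geometric_sums[OF cmod_cnj_mult_less_1[OF assms]] by (simp add: szego_def power_mult_distrib)

lemma taylor_coeff_szego:
  assumes "w \<in> ball 0 1"
  shows "taylor_coeff (szego w) n = cnj w ^ n"
  by (rule taylor_coeff_eqI) (use szego_sums[OF assms] in auto)

lemma one_minus_cmod_power2_pos:
  assumes "w \<in> ball 0 1"
  shows "1 - (cmod w)\<^sup>2 > 0"
  using assms by (simp add: abs_square_less_1)

lemma H2_szego:
  assumes "w \<in> ball 0 1"
  shows "szego w \<in> H2"
proof (rule H2I_sums[OF szego_sums[OF assms]])
  show "summable (\<lambda>n. (cmod (cnj w ^ n))\<^sup>2)"
    by (rule summable_norm_cnj_power[OF assms])
qed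

lemma h2_inner_szego:
  assumes "f \<in> H2" "w \<in> ball 0 1"
  shows "h2_inner f (szego w) = f w"
  using taylor_coeff_sums[OF H2_holomorphic[OF assms(1)] assms(2)]
  by (simp add: h2_inner_def taylor_coeff_szego[OF assms(2)] sums_iff)

lemma h2_norm_szego:
  assumes "w \<in> ball 0 1"
  shows "(h2_norm (szego w))\<^sup>2 = 1 / (1 - (cmod w)\<^sup>2)"
proof -
  have "complex_of_real ((h2_norm (szego w))\<^sup>2) = complex_of_real (1 / (1 - (cmod w)\<^sup>2))"
    unfolding h2_inner_self[OF H2_szego[OF assms], symmetric]
    by (subst h2_inner_szego[OF H2_szego[OF assms] assms])
       (simp add: szego_def complex_norm_square mult.commute del: of_real_power)
  then show ?thesis by (simp only: of_real_eq_iff)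
qed

lemma H2_point_bound:
  assumes "f \<in> H2" "w \<in> ball 0 1"
  shows "(cmod (f w))\<^sup>2 \<le> (h2_norm f)\<^sup>2 / (1 - (cmod w)\<^sup>2)"
proof -
  have "cmod (f w) \<le> h2_norm f * h2_norm (szego w)"
    using h2_Cauchy_Schwarz[OF assms(1) H2_szego[OF assms(2)]] h2_inner_szego[OF assms] by simp
  then have "(cmod (f w))\<^sup>2 \<le> (h2_norm f * h2_norm (szego w))\<^sup>2"
    by (intro power_mono) auto
  then show ?thesis by (simp add: power_mult_distrib h2_norm_szego[OF assms(2)])
qed

section \<open>Bounded multipliers\<close>

lemma root_of_unity_orthogonality:
  fixes \<omega> :: complex
  assumes "M > 0" "\<omega> ^ M = 1" "cmod \<omega> = 1" "inj_on (\<lambda>k. \<omega> ^ k) {..<M}" "k < M" "l < M"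
  shows "(\<Sum>j<M. (\<omega> ^ j) ^ k * cnj ((\<omega> ^ j) ^ l)) = (if k = l then of_nat M else 0)"
proof -
  define q where "q = \<omega> ^ k * cnj (\<omega> ^ l)"
  have u: "\<omega> ^ n * cnj (\<omega> ^ n) = 1" for n
    using assms(3) by (simp add: complex_norm_square[symmetric] norm_power del: complex_cnj_power)
  have "(\<Sum>j<M. (\<omega> ^ j) ^ k * cnj ((\<omega> ^ j) ^ l)) = (\<Sum>j<M. q ^ j)"
    unfolding q_def by (intro sum.cong refl)
      (simp add: power_mult_distrib mult.commute flip: power_mult)
  also have "\<dots> = (if k = l then of_nat M else 0)"
  proof (cases "k = l")
    case True
    then show ?thesis using u[of l] by (simp add: q_def)
  next
    case False
    have "q \<noteq> 1"
    proof
      assume "q = 1"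
      then have "\<omega> ^ k * (\<omega> ^ l * cnj (\<omega> ^ l)) = \<omega> ^ l"
        unfolding q_def by (metis mult.left_commute mult.right_neutral)
      then have "\<omega> ^ k = \<omega> ^ l" unfolding u[of l] by simp
      then show False using assms(4-6) False by (auto dest: inj_onD)
    qed
    moreover have "q ^ M = 1"
    proof -
      have "q ^ M = (\<omega> ^ M) ^ k * cnj ((\<omega> ^ M) ^ l)"
        unfolding q_def by (simp add: power_mult_distrib mult.commute flip: power_mult)
      then show ?thesis by (simp add: assms(2))
    qed
    ultimately show ?thesis using False by (simp add: geometric_sum)
  qed
  finally show ?thesis .
qed

lemma primitive_root_of_unity_exists:
  assumes "M > 0"
  obtains \<omega> :: complex where "\<omega> ^ M = 1" "cmod \<omega> = 1" "inj_on (\<lambda>k. \<omega> ^ k) {..<M}"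
proof
  define \<omega> where "\<omega> = exp (2 * of_real pi * \<i> * of_nat 1 / of_nat M)"
  have pow: "\<omega> ^ k = exp (2 * of_real pi * \<i> * of_nat k / of_nat M)" for k
    unfolding \<omega>_def exp_of_nat_mult[symmetric] by (simp add: mult_ac)
  show "\<omega> ^ M = 1" using assms by (simp add: pow exp_eq_1)
  show "cmod \<omega> = 1" by (simp add: \<omega>_def)
  show "inj_on (\<lambda>k. \<omega> ^ k) {..<M}"
    using complex_root_unity_eq[of M] assms by (auto simp: inj_on_def pow)
qed

text \<open>Finite substitute for the mean of |p|^2 over the circle of radius r: for a polynomial of
  degree below M, sampling at M equidistant points is exact.\<close>

lemma discrete_Parseval:
  fixes \<omega> :: complex and r :: real
  assumes "M > 0" "\<omega> ^ M = 1" "cmod \<omega> = 1" "inj_on (\<lambda>k. \<omega> ^ k) {..<M}"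
  shows "(\<Sum>j<M. (cmod (\<Sum>k<M. c k * (of_real r * \<omega> ^ j) ^ k))\<^sup>2)
    = M * (\<Sum>k<M. (cmod (c k))\<^sup>2 * r ^ (2 * k))"
proof -
  let ?d = "\<lambda>k. c k * of_real r ^ k"
  have "complex_of_real (\<Sum>j<M. (cmod (\<Sum>k<M. c k * (of_real r * \<omega> ^ j) ^ k))\<^sup>2)
    = (\<Sum>j<M. \<Sum>k<M. \<Sum>l<M. ?d k * cnj (?d l) * ((\<omega> ^ j) ^ k * cnj ((\<omega> ^ j) ^ l)))"
    unfolding of_real_sum complex_norm_square cnj_sum sum_product
    by (intro sum.cong refl) (simp add: power_mult_distrib mult_ac)
  also have "\<dots> = (\<Sum>k<M. \<Sum>l<M. \<Sum>j<M. ?d k * cnj (?d l) * ((\<omega> ^ j) ^ k * cnj ((\<omega> ^ j) ^ l)))"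
    by (subst sum.swap, rule sum.cong[OF refl], rule sum.swap)
  also have "\<dots> = (\<Sum>k<M. \<Sum>l<M. ?d k * cnj (?d l) * (if k = l then of_nat M else 0))"
    unfolding sum_distrib_left[symmetric]
    by (intro sum.cong refl arg_cong2[where f = "(*)"] root_of_unity_orthogonality assms) auto
  also have "\<dots> = (\<Sum>k<M. ?d k * cnj (?d k) * of_nat M)"
    by (intro sum.cong refl) (simp add: if_distrib[of "\<lambda>x. _ * x"] cong: if_cong)
  also have "\<dots> = complex_of_real (M * (\<Sum>k<M. (cmod (c k))\<^sup>2 * r ^ (2 * k)))"
    unfolding of_real_mult of_real_sum sum_distrib_left complex_norm_square
    by (intro sum.cong refl) (simp add: mult_ac power_mult power2_eq_square power_mult_distrib)
  finally show ?thesis by (simp only: of_real_eq_iff)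
qed

lemma summable_taylor_coeff_norm:
  assumes "f holomorphic_on ball 0 1" "0 \<le> r" "r < 1"
  shows "summable (\<lambda>n. cmod (taylor_coeff f n) * r ^ n)"
proof -
  define s where "s = (r + 1) / 2"
  have s: "r < s" "s < 1" using assms by (auto simp: s_def)
  have "summable (\<lambda>n. taylor_coeff f n * of_real s ^ n)"
    using taylor_coeff_sums[OF assms(1), of "of_real s"] s assms(2) by (auto simp: sums_iff)
  then have "summable (\<lambda>n. norm (taylor_coeff f n * of_real r ^ n))"
    by (rule powser_insidea) (use s assms in auto)
  then show ?thesis using assms(2) by (simp add: norm_mult norm_power)
qed

text \<open>The right-hand side involves only the radius, so the Taylor polynomials approximate f
  uniformly on the circle |z| = r; all sample points can be treated at once.\<close>

lemma taylor_remainder_bound: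
  assumes "f holomorphic_on ball 0 1" "cmod z = r" "r < 1"
  shows "cmod (f z - (\<Sum>k<L. taylor_coeff f k * z ^ k))
    \<le> (\<Sum>k. cmod (taylor_coeff f k) * r ^ k) - (\<Sum>k<L. cmod (taylor_coeff f k) * r ^ k)"
proof -
  have r0: "0 \<le> r" using assms(2) by auto
  have z: "z \<in> ball 0 1" using assms by simp
  note sm = summable_taylor_coeff_norm[OF assms(1) r0 assms(3)]
  have sz: "(\<lambda>n. taylor_coeff f n * z ^ n) sums f z" by (rule taylor_coeff_sums[OF assms(1) z])
  have sn: "summable (\<lambda>k. norm (taylor_coeff f (k + L) * z ^ (k + L)))"
    using summable_ignore_initial_segment[OF sm, of L] by (simp add: norm_mult norm_power assms(2))
  have "f z - (\<Sum>k<L. taylor_coeff f k * z ^ k) = (\<Sum>k. taylor_coeff f (k + L) * z ^ (k + L))"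
    using suminf_split_initial_segment[of "\<lambda>n. taylor_coeff f n * z ^ n" L] sz by (simp add: sums_iff)
  also have "cmod \<dots> \<le> (\<Sum>k. norm (taylor_coeff f (k + L) * z ^ (k + L)))"
    by (rule summable_norm[OF sn])
  also have "\<dots> = (\<Sum>k. cmod (taylor_coeff f (k + L)) * r ^ (k + L))"
    by (simp add: norm_mult norm_power assms(2))
  also have "\<dots> = (\<Sum>k. cmod (taylor_coeff f k) * r ^ k) - (\<Sum>k<L. cmod (taylor_coeff f k) * r ^ k)"
    using suminf_split_initial_segment[OF sm, of L] by simp
  finally show ?thesis .
qed

text \<open>The pointwise inequality |phi f| <= C |f| is sampled at L points of the circle of radius
  r. Exact sampling holds only for polynomials, so f and phi f are replaced by their Taylor
  polynomials of length L; the resulting error tends to 0 as L grows while K and r stay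
  fixed.\<close>

lemma bounded_multiplier_partial:
  assumes f: "f \<in> H2" and hol: "\<phi> holomorphic_on ball 0 1"
    and bd: "\<And>z. z \<in> ball 0 1 \<Longrightarrow> cmod (\<phi> z) \<le> C" and r: "0 \<le> r" "r < 1"
  shows "(\<Sum>k<K. (cmod (taylor_coeff (\<lambda>z. \<phi> z * f z) k))\<^sup>2 * r ^ (2 * k)) \<le> C\<^sup>2 * (h2_norm f)\<^sup>2"
proof -
  let ?g = "\<lambda>z. \<phi> z * f z"
  let ?c = "taylor_coeff ?g" and ?a = "taylor_coeff f"
  have hf: "f holomorphic_on ball 0 1" by (rule H2_holomorphic[OF f])
  have hg: "?g holomorphic_on ball 0 1" by (intro holomorphic_intros hol hf)
  have C0: "0 \<le> C" using order.trans[OF norm_ge_zero bd[of 0]] by simp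
  define Tf where "Tf L = (\<Sum>k. cmod (?a k) * r ^ k) - (\<Sum>k<L. cmod (?a k) * r ^ k)" for L
  define Tg where "Tg L = (\<Sum>k. cmod (?c k) * r ^ k) - (\<Sum>k<L. cmod (?c k) * r ^ k)" for L
  define S where "S = (\<Sum>k. cmod (?a k) * r ^ k)"
  \<comment> \<open>Total price of passing to Taylor polynomials: the remainder of phi f itself,
    plus C times the remainder of f.\<close>
  define E where "E L = Tg L + C * Tf L" for L
  note sf = summable_taylor_coeff_norm[OF hf r] and sg = summable_taylor_coeff_norm[OF hg r]
  have Tf0: "Tf \<longlonglongrightarrow> 0" unfolding Tf_def
    using tendsto_diff[OF tendsto_const summable_LIMSEQ[OF sf], of "\<Sum>k. cmod (?a k) * r ^ k"] by simp
  have Tg0: "Tg \<longlonglongrightarrow> 0" unfolding Tg_def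
    using tendsto_diff[OF tendsto_const summable_LIMSEQ[OF sg], of "\<Sum>k. cmod (?c k) * r ^ k"] by simp
  have E0: "E \<longlonglongrightarrow> 0" unfolding E_def
    using tendsto_add[OF Tg0 tendsto_mult[OF tendsto_const Tf0], of C] by simp
  have Tfn: "0 \<le> Tf L" for L unfolding Tf_def using sum_le_suminf[OF sf, of "{..<L}"] r by simp
  have Tgn: "0 \<le> Tg L" for L unfolding Tg_def using sum_le_suminf[OF sg, of "{..<L}"] r by simp
  have En: "0 \<le> E L" for L unfolding E_def using Tfn Tgn C0 by simp
  have S0: "0 \<le> S" unfolding S_def using r by (intro suminf_nonneg[OF sf]) simp
  have key: "(\<Sum>k<K. (cmod (?c k))\<^sup>2 * r ^ (2 * k)) \<le> C\<^sup>2 * (h2_norm f)\<^sup>2 + (2 * C * S * E L + (E L)\<^sup>2)"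
    if L: "L \<ge> K" "L > 0" for L
  proof -
    obtain \<omega> :: complex where \<omega>: "\<omega> ^ L = 1" "cmod \<omega> = 1" "inj_on (\<lambda>k. \<omega> ^ k) {..<L}"
      using primitive_root_of_unity_exists[OF L(2)] .
    let ?z = "\<lambda>j. of_real r * \<omega> ^ j"
    let ?p = "\<lambda>j. \<Sum>k<L. ?a k * ?z j ^ k" and ?q = "\<lambda>j. \<Sum>k<L. ?c k * ?z j ^ k"
    have pt: "(cmod (?q j))\<^sup>2 \<le> C\<^sup>2 * (cmod (?p j))\<^sup>2 + (2 * C * S * E L + (E L)\<^sup>2)" for j
    proof -
      have zr: "cmod (?z j) = r" using r \<omega>(2) by (simp add: norm_mult norm_power)
      then have zb: "?z j \<in> ball 0 1" using r by simp
      have fp: "cmod (f (?z j) - ?p j) \<le> Tf L" unfolding Tf_def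
        by (rule taylor_remainder_bound[OF hf zr r(2)])
      have gq: "cmod (?g (?z j) - ?q j) \<le> Tg L" unfolding Tg_def
        by (rule taylor_remainder_bound[OF hg zr r(2)])
      have q1: "cmod (?q j) \<le> cmod (?g (?z j)) + Tg L"
        using gq norm_triangle_ineq3[of "?g (?z j)" "?q j"] by linarith
      have q2: "cmod (?g (?z j)) \<le> C * cmod (f (?z j))"
        unfolding norm_mult by (intro mult_right_mono bd zb) auto
      have "cmod (f (?z j)) \<le> cmod (?p j) + Tf L"
        using fp norm_triangle_ineq3[of "f (?z j)" "?p j"] by linarith
      from mult_left_mono[OF this C0]
      have q3: "C * cmod (f (?z j)) \<le> C * cmod (?p j) + C * Tf L" unfolding distrib_left .
      have "cmod (?q j) \<le> C * cmod (?p j) + E L"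
        unfolding E_def using q1 q2 q3 by linarith
      then have "(cmod (?q j))\<^sup>2 \<le> (C * cmod (?p j) + E L)\<^sup>2" by (intro power_mono) auto
      also have "\<dots> = C\<^sup>2 * (cmod (?p j))\<^sup>2 + (2 * C * cmod (?p j) * E L + (E L)\<^sup>2)"
        by (simp add: power2_sum power_mult_distrib)
      finally have q4: "(cmod (?q j))\<^sup>2
        \<le> C\<^sup>2 * (cmod (?p j))\<^sup>2 + (2 * C * cmod (?p j) * E L + (E L)\<^sup>2)" .
      have "cmod (?p j) \<le> S"
      proof -
        have "cmod (?p j) \<le> (\<Sum>k<L. cmod (?a k) * r ^ k)"
          by (rule order.trans[OF norm_sum]) (simp only: norm_mult norm_power zr[unfolded norm_mult norm_power] order.refl)
        also have "\<dots> \<le> S" unfolding S_def using sum_le_suminf[OF sf, of "{..<L}"] r by simp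
        finally show ?thesis .
      qed
      then have "2 * C * cmod (?p j) * E L \<le> 2 * C * S * E L"
        using C0 En[of L] by (intro mult_left_mono mult_right_mono) auto
      with q4 show ?thesis by linarith
    qed
    have "L * (\<Sum>k<L. (cmod (?c k))\<^sup>2 * r ^ (2 * k)) = (\<Sum>j<L. (cmod (?q j))\<^sup>2)"
      by (rule discrete_Parseval[OF L(2) \<omega>, symmetric])
    also have "\<dots> \<le> (\<Sum>j<L. C\<^sup>2 * (cmod (?p j))\<^sup>2 + (2 * C * S * E L + (E L)\<^sup>2))"
      by (rule sum_mono) (rule pt)
    also have "\<dots> = C\<^sup>2 * (\<Sum>j<L. (cmod (?p j))\<^sup>2) + L * (2 * C * S * E L + (E L)\<^sup>2)"
      by (simp add: sum.distrib sum_distrib_left)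
    also have "(\<Sum>j<L. (cmod (?p j))\<^sup>2) = L * (\<Sum>k<L. (cmod (?a k))\<^sup>2 * r ^ (2 * k))"
      by (rule discrete_Parseval[OF L(2) \<omega>])
    finally have "L * (\<Sum>k<L. (cmod (?c k))\<^sup>2 * r ^ (2 * k))
      \<le> L * (C\<^sup>2 * (\<Sum>k<L. (cmod (?a k))\<^sup>2 * r ^ (2 * k)) + (2 * C * S * E L + (E L)\<^sup>2))"
      by (simp add: algebra_simps)
    then have "(\<Sum>k<L. (cmod (?c k))\<^sup>2 * r ^ (2 * k))
      \<le> C\<^sup>2 * (\<Sum>k<L. (cmod (?a k))\<^sup>2 * r ^ (2 * k)) + (2 * C * S * E L + (E L)\<^sup>2)"
      using L(2) by (simp add: mult_le_cancel_left)
    also have "(\<Sum>k<L. (cmod (?a k))\<^sup>2 * r ^ (2 * k)) \<le> (\<Sum>k<L. (cmod (?a k))\<^sup>2)"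
      using r by (intro sum_mono mult_right_le_one_le) (auto simp: power_le_one)
    also have "\<dots> \<le> (h2_norm f)\<^sup>2"
      unfolding h2_norm_power2[OF f] by (rule sum_le_suminf[OF H2_summable[OF f]]) auto
    finally have "(\<Sum>k<L. (cmod (?c k))\<^sup>2 * r ^ (2 * k))
      \<le> C\<^sup>2 * (h2_norm f)\<^sup>2 + (2 * C * S * E L + (E L)\<^sup>2)" by (simp add: mult_left_mono)
    moreover have "(\<Sum>k<K. (cmod (?c k))\<^sup>2 * r ^ (2 * k)) \<le> (\<Sum>k<L. (cmod (?c k))\<^sup>2 * r ^ (2 * k))"
      using L r by (intro sum_mono2) auto
    ultimately show ?thesis by linarith
  qed
  have "(\<lambda>L. C\<^sup>2 * (h2_norm f)\<^sup>2 + (2 * C * S * E L + (E L)\<^sup>2))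
    \<longlonglongrightarrow> C\<^sup>2 * (h2_norm f)\<^sup>2 + (2 * C * S * 0 + 0\<^sup>2)"
    by (intro tendsto_intros E0)
  then have "(\<lambda>L. C\<^sup>2 * (h2_norm f)\<^sup>2 + (2 * C * S * E L + (E L)\<^sup>2)) \<longlonglongrightarrow> C\<^sup>2 * (h2_norm f)\<^sup>2"
    by simp
  then show ?thesis
    by (rule LIMSEQ_le_const) (use key in \<open>auto intro!: exI[of _ "Suc K"]\<close>)
qed

lemma bounded_multiplier:
  assumes f: "f \<in> H2" and hol: "\<phi> holomorphic_on ball 0 1"
    and bd: "\<And>z. z \<in> ball 0 1 \<Longrightarrow> cmod (\<phi> z) \<le> C"
  shows "(\<lambda>z. \<phi> z * f z) \<in> H2" "h2_norm (\<lambda>z. \<phi> z * f z) \<le> C * h2_norm f"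
proof -
  let ?g = "\<lambda>z. \<phi> z * f z"
  let ?c = "taylor_coeff ?g"
  have C0: "0 \<le> C" using order.trans[OF norm_ge_zero bd[of 0]] by simp
  have part: "(\<Sum>k<K. (cmod (?c k))\<^sup>2) \<le> C\<^sup>2 * (h2_norm f)\<^sup>2" for K
  proof -
    \<comment> \<open>Radii increasing to 1. Only finitely many coefficients are involved, so the
      limit passes through the sum before K is released.\<close>
    define r where "r n = 1 - inverse (real (Suc n))" for n
    have r: "0 \<le> r n" "r n < 1" for n by (auto simp: r_def inverse_le_1_iff)
    have "r \<longlonglongrightarrow> 1 - 0" unfolding r_def by (intro tendsto_diff tendsto_const LIMSEQ_inverse_real_of_nat)
    then have "(\<lambda>n. \<Sum>k<K. (cmod (?c k))\<^sup>2 * r n ^ (2 * k)) \<longlonglongrightarrow> (\<Sum>k<K. (cmod (?c k))\<^sup>2 * 1 ^ (2 * k))"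
      by (intro tendsto_intros) simp
    then have "(\<lambda>n. \<Sum>k<K. (cmod (?c k))\<^sup>2 * r n ^ (2 * k)) \<longlonglongrightarrow> (\<Sum>k<K. (cmod (?c k))\<^sup>2)" by simp
    then show ?thesis
      by (rule LIMSEQ_le_const2) (use bounded_multiplier_partial[OF f hol bd r] in auto)
  qed
  have sm: "summable (\<lambda>k. (cmod (?c k))\<^sup>2)"
    by (rule summableI_nonneg_bounded[OF _ part]) auto
  then show g: "?g \<in> H2"
    using hol H2_holomorphic[OF f] by (auto simp: H2_def intro!: holomorphic_intros)
  have "(h2_norm ?g)\<^sup>2 \<le> (C * h2_norm f)\<^sup>2"
    unfolding h2_norm_power2[OF g] power_mult_distrib by (rule suminf_le_const[OF sm part])
  then show "h2_norm ?g \<le> C * h2_norm f"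
    by (rule power2_le_imp_le) (use C0 h2_norm_nonneg[OF f] in auto)
qed

section \<open>Inner functions and Blaschke products\<close>

lemma taylor_coeff_shift:
  assumes "f holomorphic_on ball 0 1"
  shows "taylor_coeff (\<lambda>z. z * f z) n = (case n of 0 \<Rightarrow> 0 | Suc m \<Rightarrow> taylor_coeff f m)"
proof (rule taylor_coeff_eqI)
  fix z :: complex assume z: "z \<in> ball 0 1"
  have "(\<lambda>n. z * (taylor_coeff f n * z ^ n)) sums (z * f z)"
    by (intro sums_mult taylor_coeff_sums assms z)
  then have "(\<lambda>n. (case Suc n of 0 \<Rightarrow> 0 | Suc m \<Rightarrow> taylor_coeff f m) * z ^ Suc n) sums (z * f z)"
    by (simp add: mult_ac)
  then show "(\<lambda>n. (case n of 0 \<Rightarrow> 0 | Suc m \<Rightarrow> taylor_coeff f m) * z ^ n) sums (z * f z)"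
    by (subst (asm) sums_Suc_iff) simp
qed

lemma H2_shift:
  assumes "f \<in> H2"
  shows "(\<lambda>z. z * f z) \<in> H2"
  by (rule bounded_multiplier(1)[OF assms, of _ 1]) (auto intro!: holomorphic_intros)

lemma h2_norm_shift:
  assumes "f \<in> H2"
  shows "h2_norm (\<lambda>z. z * f z) = h2_norm f"
proof -
  have "(\<Sum>n. (cmod (taylor_coeff (\<lambda>z. z * f z) n))\<^sup>2) = (\<Sum>n. (cmod (taylor_coeff f n))\<^sup>2)"
    using suminf_split_head[OF H2_summable[OF H2_shift[OF assms]]]
    by (simp add: taylor_coeff_shift[OF H2_holomorphic[OF assms]])
  then show ?thesis by (simp add: h2_norm_def)
qed

lemma blaschke_factor_unimodular:
  obtains u where "cmod u = 1" "\<And>z. blaschke_factor a z = u * ((a - z) / (1 - cnj a * z))"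
proof (cases "a = 0")
  case True
  \<comment> \<open>At a = 0 the factor is z whereas the quotient is -z, hence the constant
    -1.\<close>
  show ?thesis by (rule that[of "-1"]) (auto simp: True blaschke_factor_def)
next
  case False
  show ?thesis by (rule that[of "of_real (cmod a) / a"]) (use False in \<open>auto simp: blaschke_factor_def norm_divide\<close>)
qed

lemma cmod_blaschke_factor: "cmod (blaschke_factor a z) = pseudo_hyp a z"
proof -
  obtain u where "cmod u = 1" "\<And>z. blaschke_factor a z = u * ((a - z) / (1 - cnj a * z))"
    using blaschke_factor_unimodular[of a] by blast
  then show ?thesis by (simp add: pseudo_hyp_def norm_mult norm_divide)
qed

lemma blaschke_factor_0: "blaschke_factor a 0 = of_real (cmod a)"
  by (simp add: blaschke_factor_def)

lemma blaschke_factor_self: "blaschke_factor a a = 0"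
  by (simp add: blaschke_factor_def)

lemma blaschke_factor_holomorphic:
  assumes "a \<in> ball 0 1"
  shows "blaschke_factor a holomorphic_on ball 0 1"
proof (rule blaschke_factor_unimodular[of a])
  fix u assume "\<And>z. blaschke_factor a z = u * ((a - z) / (1 - cnj a * z))"
  then have "blaschke_factor a = (\<lambda>z. u * ((a - z) / (1 - cnj a * z)))" by auto
  then show ?thesis
    using one_minus_cnj_mult_nonzero[OF assms] by (auto intro!: holomorphic_intros)
qed

text \<open>The Schwarz-Pick identity. Its right-hand side is (1 - |a|^2)(1 - |z|^2)|szego a z|^2,
  which links products of pseudohyperbolic distances to sums of squared kernel values.\<close>

lemma one_minus_pseudo_hyp_power2:
  assumes "a \<in> ball 0 1" "z \<in> ball 0 1"
  shows "1 - (pseudo_hyp a z)\<^sup>2 = (1 - (cmod a)\<^sup>2) * (1 - (cmod z)\<^sup>2) / (cmod (1 - cnj a * z))\<^sup>2"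
proof -
  have nz: "(cmod (1 - cnj a * z))\<^sup>2 \<noteq> 0" using one_minus_cnj_mult_nonzero[OF assms] by simp
  have "complex_of_real ((cmod (1 - cnj a * z))\<^sup>2 - (cmod (a - z))\<^sup>2)
    = complex_of_real ((1 - (cmod a)\<^sup>2) * (1 - (cmod z)\<^sup>2))"
    unfolding of_real_diff of_real_mult complex_norm_square of_real_1 by (simp add: algebra_simps)
  then have "(cmod (1 - cnj a * z))\<^sup>2 - (cmod (a - z))\<^sup>2 = (1 - (cmod a)\<^sup>2) * (1 - (cmod z)\<^sup>2)"
    by (simp only: of_real_eq_iff)
  then show ?thesis using nz
    by (simp add: pseudo_hyp_def norm_divide power_divide field_simps)
qed

lemma pseudo_hyp_nonneg: "0 \<le> pseudo_hyp a z"
  by (simp add: pseudo_hyp_def)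

lemma pseudo_hyp_less_1:
  assumes "a \<in> ball 0 1" "z \<in> ball 0 1"
  shows "pseudo_hyp a z < 1"
proof -
  have "1 - (pseudo_hyp a z)\<^sup>2 > 0"
    unfolding one_minus_pseudo_hyp_power2[OF assms]
    using one_minus_cmod_power2_pos[OF assms(1)] one_minus_cmod_power2_pos[OF assms(2)]
      one_minus_cnj_mult_nonzero[OF assms] by (intro divide_pos_pos mult_pos_pos) auto
  then show ?thesis using pseudo_hyp_nonneg[of a z] by (simp add: abs_square_less_1)
qed

lemma cmod_blaschke_factor_le_1:
  assumes "a \<in> ball 0 1" "z \<in> ball 0 1"
  shows "cmod (blaschke_factor a z) \<le> 1"
  using pseudo_hyp_less_1[OF assms] by (simp add: cmod_blaschke_factor)

lemma szego_bound:
  assumes "a \<in> ball 0 1" "z \<in> ball 0 1"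
  shows "cmod (szego a z) \<le> 1 / (1 - cmod a)"
proof -
  have "cmod (cnj a * z) \<le> cmod a * 1"
    unfolding norm_mult complex_mod_cnj using assms by (intro mult_left_mono) auto
  then have "1 - cmod a \<le> cmod (1 - cnj a * z)"
    using norm_triangle_ineq2[of 1 "cnj a * z"] by simp
  moreover have "1 - cmod a > 0" using assms by simp
  ultimately show ?thesis by (simp add: szego_def norm_divide frac_le)
qed

lemma szego_holomorphic: "a \<in> ball 0 1 \<Longrightarrow> szego a holomorphic_on ball 0 1"
  using H2_szego H2_holomorphic by blast

text \<open>Unimodularity of the boundary values is replaced by the equivalent isometry of multiplication on $H^2$.\<close>

definition inner_function :: "(complex \<Rightarrow> complex) \<Rightarrow> bool" where
  "inner_function \<theta> \<longleftrightarrow> \<theta> holomorphic_on ball 0 1 \<and> (\<forall>z\<in>ball 0 1. cmod (\<theta> z) \<le> 1) \<and>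
     (\<forall>f\<in>H2. h2_norm (\<lambda>z. \<theta> z * f z) = h2_norm f)"

lemma inner_function_H2:
  assumes "inner_function \<theta>" "f \<in> H2"
  shows "(\<lambda>z. \<theta> z * f z) \<in> H2"
  using bounded_multiplier(1)[OF assms(2), of \<theta> 1] assms(1) by (auto simp: inner_function_def)

lemma inner_function_norm:
  assumes "inner_function \<theta>" "f \<in> H2"
  shows "h2_norm (\<lambda>z. \<theta> z * f z) = h2_norm f"
  using assms by (simp add: inner_function_def)

lemma inner_function_inner:
  assumes "inner_function \<theta>" "f \<in> H2" "g \<in> H2"
  shows "h2_inner (\<lambda>z. \<theta> z * f z) (\<lambda>z. \<theta> z * g z) = h2_inner f g"
proof -
  have re: "Re (h2_inner (\<lambda>z. \<theta> z * f z) (\<lambda>z. \<theta> z * g z)) = Re (h2_inner f g)" if "f \<in> H2" for f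
  proof -
    note I = inner_function_H2[OF assms(1)]
    have "h2_norm (\<lambda>z. \<theta> z * f z + \<theta> z * g z) = h2_norm (\<lambda>z. f z + g z)"
      using inner_function_norm[OF assms(1) H2_add[OF that assms(3)]] by (simp add: distrib_left)
    then show ?thesis
      using h2_norm_add_power2[OF that assms(3)] h2_norm_add_power2[OF I[OF that] I[OF assms(3)]]
      by (simp add: inner_function_norm[OF assms(1)] that assms(3))
  qed
  \<comment> \<open>Polarisation: norms of sums determine only real parts, and replacing f by i f
    turns the imaginary part into a real one.\<close>
  have "h2_inner (\<lambda>z. \<theta> z * (\<i> * f z)) (\<lambda>z. \<theta> z * g z)
    = \<i> * h2_inner (\<lambda>z. \<theta> z * f z) (\<lambda>z. \<theta> z * g z)"
    using h2_inner_cmult_left[OF inner_function_H2[OF assms(1,2)] inner_function_H2[OF assms(1,3)], of \<i>]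
    by (simp add: mult.left_commute)
  then have "Im (h2_inner (\<lambda>z. \<theta> z * f z) (\<lambda>z. \<theta> z * g z)) = Im (h2_inner f g)"
    using re[OF H2_cmult[OF assms(2)], of \<i>] h2_inner_cmult_left[OF assms(2,3), of \<i>] by simp
  with re[OF assms(2)] show ?thesis by (simp add: complex_eq_iff)
qed

lemma inner_function_mult:
  assumes "inner_function \<theta>" "inner_function \<phi>"
  shows "inner_function (\<lambda>z. \<theta> z * \<phi> z)"
  unfolding inner_function_def
proof (intro conjI ballI)
  show "(\<lambda>z. \<theta> z * \<phi> z) holomorphic_on ball 0 1"
    using assms by (auto simp: inner_function_def intro!: holomorphic_intros)
  show "cmod (\<theta> z * \<phi> z) \<le> 1" if "z \<in> ball 0 1" for z
    using assms that unfolding norm_mult by (auto simp: inner_function_def intro!: mult_le_one)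
  show "h2_norm (\<lambda>z. \<theta> z * \<phi> z * f z) = h2_norm f" if "f \<in> H2" for f
    using inner_function_norm[OF assms(1) inner_function_H2[OF assms(2) that]]
      inner_function_norm[OF assms(2) that] by (simp add: mult.assoc)
qed

lemma inner_function_1: "inner_function (\<lambda>z. 1)"
  by (simp add: inner_function_def)

lemma inner_function_prod:
  assumes "\<And>i. i \<in> I \<Longrightarrow> inner_function (\<theta> i)"
  shows "inner_function (\<lambda>z. \<Prod>i\<in>I. \<theta> i z)"
  using assms by (induction I rule: infinite_finite_induct)
    (auto simp: inner_function_1 intro!: inner_function_mult)

text \<open>With $g = f / (1 - \overline{a} z)$, the norms of $(a - z) g$ and $(1 - \overline{a} z) g$ agree
  because the shift is isometric.\<close>

lemma inner_function_blaschke_factor: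
  assumes "a \<in> ball 0 1"
  shows "inner_function (blaschke_factor a)"
  unfolding inner_function_def
proof (intro conjI ballI)
  show "blaschke_factor a holomorphic_on ball 0 1" by (rule blaschke_factor_holomorphic[OF assms])
  show "cmod (blaschke_factor a z) \<le> 1" if "z \<in> ball 0 1" for z
    by (rule cmod_blaschke_factor_le_1[OF assms that])
  fix f assume f: "f \<in> H2"
  define g where "g z = szego a z * f z" for z
  have g: "g \<in> H2" unfolding g_def
    by (rule bounded_multiplier(1)[OF f szego_holomorphic[OF assms] szego_bound[OF assms]])
  let ?s = "\<lambda>z. z * g z"
  have s: "?s \<in> H2" by (rule H2_shift[OF g])
  obtain u where u: "cmod u = 1" "\<And>z. blaschke_factor a z = u * ((a - z) / (1 - cnj a * z))"
    using blaschke_factor_unimodular[of a] by blast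
  have "h2_norm (\<lambda>z. blaschke_factor a z * f z) = h2_norm (\<lambda>z. u * (a * g z - ?s z))"
    by (rule h2_norm_cong) (simp add: u(2) g_def szego_def divide_inverse algebra_simps)
  also have "\<dots> = h2_norm (\<lambda>z. a * g z - ?s z)"
    by (subst h2_norm_cmult) (auto simp: u(1) intro!: H2_diff H2_cmult g s)
  also have "\<dots> = h2_norm (\<lambda>z. g z - cnj a * ?s z)"
  proof (rule power2_eq_imp_eq)
    show "(h2_norm (\<lambda>z. a * g z - ?s z))\<^sup>2 = (h2_norm (\<lambda>z. g z - cnj a * ?s z))\<^sup>2"
      unfolding h2_norm_diff_power2[OF H2_cmult[OF g] s] h2_norm_diff_power2[OF g H2_cmult[OF s]]
      by (simp add: h2_norm_cmult[OF g] h2_norm_cmult[OF s] h2_norm_shift[OF g]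
          h2_inner_cmult_left[OF g s] h2_inner_cmult_right[OF s g])
  qed (auto intro!: h2_norm_nonneg H2_diff H2_cmult g s)
  also have "\<dots> = h2_norm f"
  proof (rule h2_norm_cong)
    fix z :: complex assume z: "z \<in> ball 0 1"
    have "g z - cnj a * ?s z = (1 - cnj a * z) * szego a z * f z"
      by (simp add: g_def algebra_simps)
    then show "g z - cnj a * ?s z = f z"
      using one_minus_cnj_mult_nonzero[OF assms z] by (simp add: szego_def)
  qed
  finally show "h2_norm (\<lambda>z. blaschke_factor a z * f z) = h2_norm f" .
qed

section \<open>Completeness of H^2 and approximation by polynomials\<close>

lemma H2_partial_sum_le:
  assumes "f \<in> H2"
  shows "(\<Sum>k<K. (cmod (taylor_coeff f k))\<^sup>2) \<le> (h2_norm f)\<^sup>2"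
  unfolding h2_norm_power2[OF assms] by (rule sum_le_suminf[OF H2_summable[OF assms]]) auto

lemma taylor_coeff_diff:
  assumes "f \<in> H2" "g \<in> H2"
  shows "taylor_coeff (\<lambda>z. f z - g z) n = taylor_coeff f n - taylor_coeff g n"
  using taylor_coeff_add[OF H2_holomorphic[OF assms(1)] H2_holomorphic[OF H2_cmult[OF assms(2)]], of "-1" n]
    taylor_coeff_cmult[OF H2_holomorphic[OF assms(2)], of "-1" n] by simp

text \<open>Each coefficient sequence is Cauchy. A bound on finitely many coefficients survives the
  passage to their limits, and only afterwards is the number of coefficients increased, as in
  Fatou's lemma.\<close>

lemma H2_complete:
  assumes F: "\<And>n. F n \<in> H2"
    and cauchy: "\<And>e. e > 0 \<Longrightarrow> \<exists>N. \<forall>m\<ge>N. \<forall>n\<ge>N. h2_norm (\<lambda>z. F m z - F n z) < e"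
  obtains f where "f \<in> H2" "(\<lambda>n. h2_norm (\<lambda>z. F n z - f z)) \<longlonglongrightarrow> 0"
proof -
  let ?c = "\<lambda>n. taylor_coeff (F n)"
  have part: "(\<Sum>k<K. (cmod (?c m k - ?c n k))\<^sup>2) \<le> (h2_norm (\<lambda>z. F m z - F n z))\<^sup>2" for m n K
    using H2_partial_sum_le[OF H2_diff[OF F F], of m n K] by (simp add: taylor_coeff_diff[OF F F])
  have coeff: "cmod (?c m k - ?c n k) \<le> h2_norm (\<lambda>z. F m z - F n z)" for m n k
  proof (rule power2_le_imp_le)
    have "(cmod (?c m k - ?c n k))\<^sup>2 \<le> (\<Sum>k<Suc k. (cmod (?c m k - ?c n k))\<^sup>2)"
      by (rule member_le_sum) auto
    then show "(cmod (?c m k - ?c n k))\<^sup>2 \<le> (h2_norm (\<lambda>z. F m z - F n z))\<^sup>2"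
      by (rule order.trans[OF _ part])
  qed (intro h2_norm_nonneg H2_diff F)
  have "Cauchy (\<lambda>n. ?c n k)" for k
  proof (rule metric_CauchyI)
    fix e :: real assume "e > 0"
    then obtain N where "\<forall>m\<ge>N. \<forall>n\<ge>N. h2_norm (\<lambda>z. F m z - F n z) < e" using cauchy by blast
    then have "dist (?c m k) (?c n k) < e" if "m \<ge> N" "n \<ge> N" for m n
      unfolding dist_norm using order.strict_trans1[OF coeff[of m k n]] that by simp
    then show "\<exists>M. \<forall>m\<ge>M. \<forall>n\<ge>M. dist (?c m k) (?c n k) < e" by blast
  qed
  then have "\<exists>l. (\<lambda>n. ?c n k) \<longlonglongrightarrow> l" for k
    unfolding convergent_def[symmetric] by (rule Cauchy_convergent)
  then have "\<forall>k. \<exists>l. (\<lambda>n. ?c n k) \<longlonglongrightarrow> l" by blast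
  from choice[OF this] obtain a where a: "\<And>k. (\<lambda>n. ?c n k) \<longlonglongrightarrow> a k" by blast
  have bound: "(\<Sum>k<K. (cmod (a k - ?c n k))\<^sup>2) \<le> e\<^sup>2"
    if N: "\<forall>m\<ge>N. \<forall>n\<ge>N. h2_norm (\<lambda>z. F m z - F n z) < e" and n: "n \<ge> N" for K N n e
  proof (rule LIMSEQ_le_const2)
    show "(\<lambda>m. \<Sum>k<K. (cmod (?c m k - ?c n k))\<^sup>2) \<longlonglongrightarrow> (\<Sum>k<K. (cmod (a k - ?c n k))\<^sup>2)"
      by (intro tendsto_intros a)
    have "(\<Sum>k<K. (cmod (?c m k - ?c n k))\<^sup>2) \<le> e\<^sup>2" if m: "m \<ge> N" for m
    proof -
      have "h2_norm (\<lambda>z. F m z - F n z) \<le> e" by (rule less_imp_le[OF N[rule_format, OF m n]])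
      then have "(h2_norm (\<lambda>z. F m z - F n z))\<^sup>2 \<le> e\<^sup>2"
        by (rule power_mono[OF _ h2_norm_nonneg[OF H2_diff[OF F F]]])
      with part show ?thesis by (rule order.trans)
    qed
    then show "\<exists>N. \<forall>m\<ge>N. (\<Sum>k<K. (cmod (?c m k - ?c n k))\<^sup>2) \<le> e\<^sup>2" by blast
  qed
  obtain N1 where N1: "\<forall>m\<ge>N1. \<forall>n\<ge>N1. h2_norm (\<lambda>z. F m z - F n z) < 1" using cauchy[of 1] by auto
  have sq: "summable (\<lambda>k. (cmod (a k - ?c N1 k))\<^sup>2)"
    by (rule summableI_nonneg_bounded[OF _ bound[OF N1 order.refl]]) auto
  \<comment> \<open>Square summability is known for the difference between the limiting coefficients
    and those of \<open>F N1\<close>, not yet for the limit itself. The limit is therefore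
    \<open>F N1\<close> plus this correction.\<close>
  define D where "D z = (\<Sum>k. (a k - ?c N1 k) * z ^ k)" for z
  have Ds: "(\<lambda>k. (a k - ?c N1 k) * z ^ k) sums D z" if "z \<in> ball 0 1" for z
    unfolding D_def by (rule summable_sums[OF power_series_summable_if_square_summable[OF sq that]])
  have D: "D \<in> H2" by (rule H2I_sums[OF Ds sq])
  let ?f = "\<lambda>z. F N1 z + D z"
  have f: "?f \<in> H2" by (intro H2_add F D)
  have tf: "taylor_coeff ?f k = a k" for k
    using taylor_coeff_add[OF H2_holomorphic[OF F] H2_holomorphic[OF D], of N1 k]
      taylor_coeff_eqI[OF Ds, of k] by simp
  show ?thesis
  proof (rule that[OF f], rule LIMSEQ_I)
    fix r :: real assume r: "r > 0"
    then obtain N where N: "\<forall>m\<ge>N. \<forall>n\<ge>N. h2_norm (\<lambda>z. F m z - F n z) < r / 2"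
      using cauchy[of "r / 2"] by auto
    have "h2_norm (\<lambda>z. F n z - ?f z) < r" if n: "n \<ge> N" for n
    proof -
      have eq: "(cmod (taylor_coeff (\<lambda>z. F n z - ?f z) k))\<^sup>2 = (cmod (a k - ?c n k))\<^sup>2" for k
        by (simp only: taylor_coeff_diff[OF F f] tf norm_minus_commute[of "?c n k" "a k"])
      have "summable (\<lambda>k. (cmod (a k - ?c n k))\<^sup>2)"
        using H2_summable[OF H2_diff[OF F f], of n] by (simp only: eq)
      then have "(\<Sum>k. (cmod (a k - ?c n k))\<^sup>2) \<le> (r / 2)\<^sup>2"
        by (rule suminf_le_const) (rule bound[OF N n])
      then have "(h2_norm (\<lambda>z. F n z - ?f z))\<^sup>2 \<le> (r / 2)\<^sup>2"
        unfolding h2_norm_power2[OF H2_diff[OF F f]] eq .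
      then have "h2_norm (\<lambda>z. F n z - ?f z) \<le> r / 2" by (rule power2_le_imp_le) (use r in simp)
      also have "\<dots> < r" using r by simp
      finally show ?thesis .
    qed
    then show "\<exists>no. \<forall>n\<ge>no. norm (h2_norm (\<lambda>z. F n z - ?f z) - 0) < r"
      unfolding diff_zero real_norm_def abs_of_nonneg[OF h2_norm_nonneg[OF H2_diff[OF F f]]] by blast
  qed
qed

lemma polynomial_approx:
  assumes "f \<in> H2" "e > 0"
  obtains K where "h2_norm (\<lambda>z. f z - (\<Sum>k<K. taylor_coeff f k * z ^ k)) < e"
    "(\<lambda>z. \<Sum>k<K. taylor_coeff f k * z ^ k) \<in> H2"
proof -
  let ?a = "taylor_coeff f"
  obtain K where K: "norm (\<Sum>i. (cmod (?a (i + K)))\<^sup>2) < e\<^sup>2"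
    using suminf_exist_split[OF _ H2_summable[OF assms(1)], of "e\<^sup>2"] assms(2) by auto
  let ?p = "\<lambda>z. \<Sum>k<K. ?a k * z ^ k"
  have ps: "(\<lambda>k. (if k < K then ?a k else 0) * z ^ k) sums ?p z" for z
    using sums_finite[of "{..<K}" "\<lambda>k. (if k < K then ?a k else 0) * z ^ k"] by simp
  have p: "?p \<in> H2"
  proof (rule H2I_sums[OF ps])
    show "summable (\<lambda>n. (cmod (if n < K then ?a n else 0))\<^sup>2)"
      by (rule summable_finite[of "{..<K}"]) auto
  qed
  have tp: "taylor_coeff ?p k = (if k < K then ?a k else 0)" for k
    by (rule taylor_coeff_eqI[OF ps])
  let ?d = "\<lambda>z. f z - ?p z"
  have "(h2_norm ?d)\<^sup>2 = (\<Sum>k. (cmod (taylor_coeff ?d k))\<^sup>2)"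
    by (rule h2_norm_power2[OF H2_diff[OF assms(1) p]])
  also have "\<dots> = (\<Sum>k. (cmod (taylor_coeff ?d (k + K)))\<^sup>2) + (\<Sum>k<K. (cmod (taylor_coeff ?d k))\<^sup>2)"
    by (rule suminf_split_initial_segment[OF H2_summable[OF H2_diff[OF assms(1) p]]])
  also have "\<dots> = (\<Sum>k. (cmod (?a (k + K)))\<^sup>2)"
    by (simp add: taylor_coeff_diff[OF assms(1) p] tp)
  also have "\<dots> < e\<^sup>2" using K by simp
  finally have "h2_norm ?d < e" using assms(2) by (rule power2_less_imp_less[OF _ less_imp_le])
  then show ?thesis using p by (rule that)
qed

section \<open>Convergence and inner property of infinite Blaschke products\<close>

lemma one_minus_prod_le:
  fixes x :: "'a \<Rightarrow> real"
  assumes "\<And>i. i \<in> I \<Longrightarrow> 0 \<le> x i \<and> x i \<le> 1"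
  shows "1 - (\<Prod>i\<in>I. x i) \<le> (\<Sum>i\<in>I. 1 - x i)"
  using assms
proof (induction I rule: infinite_finite_induct)
  case (insert i I)
  have p: "0 \<le> (\<Prod>i\<in>I. x i)" "(\<Prod>i\<in>I. x i) \<le> 1"
    using insert.prems by (auto intro!: prod_nonneg prod_le_1)
  have "1 - x i * (\<Prod>i\<in>I. x i) = (1 - x i) + x i * (1 - (\<Prod>i\<in>I. x i))" by (simp add: algebra_simps)
  also have "x i * (1 - (\<Prod>i\<in>I. x i)) \<le> 1 - (\<Prod>i\<in>I. x i)"
    using insert.prems p by (intro mult_left_le_one_le) auto
  also have "\<dots> \<le> (\<Sum>i\<in>I. 1 - x i)" using insert by simp
  finally show ?case using insert.hyps by simp
qed auto

definition blaschke_sequence :: "(nat \<Rightarrow> complex) \<Rightarrow> bool" where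
  "blaschke_sequence a \<longleftrightarrow> (\<forall>n. a n \<in> ball 0 1) \<and> summable (\<lambda>n. 1 - cmod (a n))"

lemma H2_1: "(\<lambda>z. 1) \<in> H2" and h2_norm_1: "h2_norm (\<lambda>z. 1) = 1"
  and h2_inner_1: "f \<in> H2 \<Longrightarrow> h2_inner f (\<lambda>z. 1) = f 0"
proof -
  have eq: "szego 0 = (\<lambda>z. 1)" by (auto simp: szego_def)
  show one: "(\<lambda>z. 1) \<in> H2" using H2_szego[of 0] by (simp add: eq)
  show "f \<in> H2 \<Longrightarrow> h2_inner f (\<lambda>z. 1) = f 0" using h2_inner_szego[of f 0] by (simp add: eq)
  have "(h2_norm (\<lambda>z. 1))\<^sup>2 = 1" using h2_norm_szego[of 0] by (simp add: eq)
  then show "h2_norm (\<lambda>z. 1) = 1"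
    using h2_norm_nonneg[OF one] by (simp add: power2_eq_1_iff)
qed

lemma inner_function_in_H2:
  assumes "inner_function \<theta>"
  shows "\<theta> \<in> H2" "h2_norm \<theta> = 1"
  using inner_function_H2[OF assms H2_1] inner_function_norm[OF assms H2_1] by (simp_all add: h2_norm_1)

lemma inner_function_partial_product:
  assumes "\<And>n. a n \<in> ball 0 1"
  shows "inner_function (\<lambda>z. \<Prod>n\<in>I. blaschke_factor (a n) z)"
  by (intro inner_function_prod inner_function_blaschke_factor assms)

text \<open>Multiplication by the shorter product is isometric, so the inner product of the two
  products is the value at 0 of the block between them. The normalisation of the factors makes this
  value the product of the moduli |a_n|, and both norms are 1.\<close>

lemma partial_product_diff:
  fixes a :: "nat \<Rightarrow> complex"
  assumes a: "\<And>n. a n \<in> ball 0 1" and NM: "N \<le> M"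
  shows "(h2_norm (\<lambda>z. (\<Prod>n<M. blaschke_factor (a n) z) - (\<Prod>n<N. blaschke_factor (a n) z)))\<^sup>2
    \<le> 2 * (\<Sum>n\<in>{N..<M}. 1 - cmod (a n))"
proof -
  let ?P = "\<lambda>I z. \<Prod>n\<in>I. blaschke_factor (a n) z"
  note I = inner_function_partial_product[of a, OF a]
  have split: "?P {..<M} = (\<lambda>z. ?P {..<N} z * ?P {N..<M} z)"
  proof
    fix z
    have eq: "{..<M} = {..<N} \<union> {N..<M}" using NM by auto
    show "?P {..<M} z = ?P {..<N} z * ?P {N..<M} z"
      unfolding eq by (rule prod.union_disjoint) auto
  qed
  have "h2_inner (?P {..<M}) (?P {..<N}) = h2_inner (\<lambda>z. ?P {..<N} z * ?P {N..<M} z) (\<lambda>z. ?P {..<N} z * 1)"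
    unfolding split by simp
  also have "\<dots> = ?P {N..<M} 0"
    unfolding inner_function_inner[OF I inner_function_in_H2(1)[OF I] H2_1]
    by (rule h2_inner_1[OF inner_function_in_H2(1)[OF I]])
  also have "\<dots> = of_real (\<Prod>n\<in>{N..<M}. cmod (a n))"
    by (simp add: blaschke_factor_0)
  finally have "(h2_norm (\<lambda>z. ?P {..<M} z - ?P {..<N} z))\<^sup>2 = 2 * (1 - (\<Prod>n\<in>{N..<M}. cmod (a n)))"
    using h2_norm_diff_power2[OF inner_function_in_H2(1)[OF I] inner_function_in_H2(1)[OF I], of "{..<M}" "{..<N}"]
    by (simp add: inner_function_in_H2(2)[OF I] flip: of_real_prod)
  also have "1 - (\<Prod>n\<in>{N..<M}. cmod (a n)) \<le> (\<Sum>n\<in>{N..<M}. 1 - cmod (a n))"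
    by (rule one_minus_prod_le) (use a in \<open>auto simp: less_imp_le\<close>)
  finally show ?thesis by simp
qed

text \<open>The Blaschke condition makes the partial products Cauchy in norm. Point evaluations are
  bounded, so the norm limit is also the pointwise limit and hence agrees on the disc with the
  \<open>lim\<close> in the definition of \<open>blaschke\<close>.\<close>

lemma blaschke_limit:
  assumes "blaschke_sequence a"
  shows "blaschke a \<in> H2"
    and "(\<lambda>N. h2_norm (\<lambda>z. (\<Prod>n<N. blaschke_factor (a n) z) - blaschke a z)) \<longlonglongrightarrow> 0"
    and "z \<in> ball 0 1 \<Longrightarrow> (\<lambda>N. \<Prod>n<N. blaschke_factor (a n) z) \<longlonglongrightarrow> blaschke a z"
proof -
  have a: "\<And>n. a n \<in> ball 0 1" and sm: "summable (\<lambda>n. 1 - cmod (a n))"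
    using assms by (auto simp: blaschke_sequence_def)
  let ?P = "\<lambda>N z. \<Prod>n<N. blaschke_factor (a n) z"
  have P: "?P N \<in> H2" for N
    by (rule inner_function_in_H2(1)[OF inner_function_partial_product[of a, OF a]])
  have "\<exists>N. \<forall>m\<ge>N. \<forall>n\<ge>N. h2_norm (\<lambda>z. ?P m z - ?P n z) < e" if e: "e > 0" for e
  proof -
    from sm[unfolded summable_Cauchy, rule_format, of "e\<^sup>2 / 2"] e
    obtain N where N: "\<And>m n. m \<ge> N \<Longrightarrow> norm (\<Sum>k\<in>{m..<n}. 1 - cmod (a k)) < e\<^sup>2 / 2" by auto
    have le: "h2_norm (\<lambda>z. ?P m z - ?P n z) < e" if "N \<le> n" "n \<le> m" for m n
    proof (rule power2_less_imp_less)
      have "(h2_norm (\<lambda>z. ?P m z - ?P n z))\<^sup>2 \<le> 2 * (\<Sum>k\<in>{n..<m}. 1 - cmod (a k))"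
        by (rule partial_product_diff[OF a that(2)])
      also have "\<dots> < e\<^sup>2" using N[OF that(1), of m] by simp
      finally show "(h2_norm (\<lambda>z. ?P m z - ?P n z))\<^sup>2 < e\<^sup>2" .
    qed (use e in simp)
    have "h2_norm (\<lambda>z. ?P m z - ?P n z) < e" if "N \<le> n" "N \<le> m" for m n
    proof (cases "n \<le> m")
      case True
      then show ?thesis by (rule le[OF that(1)])
    next
      case False
      then show ?thesis
        unfolding h2_norm_diff_commute[OF P P, of m n] by (intro le[OF that(2)]) simp
    qed
    then show ?thesis by blast
  qed
  from H2_complete[of ?P, OF P this] obtain f
    where f: "f \<in> H2" and lim: "(\<lambda>n. h2_norm (\<lambda>z. ?P n z - f z)) \<longlonglongrightarrow> 0" .
  have pw: "(\<lambda>N. ?P N z) \<longlonglongrightarrow> f z" if z: "z \<in> ball 0 1" for z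
  proof (rule Lim_null[THEN iffD2], rule tendsto_norm_zero_cancel, rule Lim_null_comparison)
    have "(\<lambda>n. sqrt ((h2_norm (\<lambda>z. ?P n z - f z))\<^sup>2 / (1 - (cmod z)\<^sup>2))) \<longlonglongrightarrow> sqrt (0\<^sup>2 / (1 - (cmod z)\<^sup>2))"
      using one_minus_cmod_power2_pos[OF z] by (intro tendsto_intros lim) auto
    then show "(\<lambda>n. sqrt ((h2_norm (\<lambda>z. ?P n z - f z))\<^sup>2 / (1 - (cmod z)\<^sup>2))) \<longlonglongrightarrow> 0" by simp
    show "eventually (\<lambda>n. norm (cmod (?P n z - f z)) \<le> sqrt ((h2_norm (\<lambda>z. ?P n z - f z))\<^sup>2 / (1 - (cmod z)\<^sup>2))) sequentially"
      using H2_point_bound[OF H2_diff[OF P f] z] by (intro always_eventually allI real_le_rsqrt) simp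
  qed
  have eq: "blaschke a z = f z" if "z \<in> ball 0 1" for z
    unfolding blaschke_def by (rule limI[OF pw[OF that]])
  show "blaschke a \<in> H2" by (rule H2_cong[OF f]) (simp add: eq)
  have "h2_norm (\<lambda>z. ?P n z - blaschke a z) = h2_norm (\<lambda>z. ?P n z - f z)" for n
    by (rule h2_norm_cong) (simp add: eq)
  with lim show "(\<lambda>N. h2_norm (\<lambda>z. ?P N z - blaschke a z)) \<longlonglongrightarrow> 0" by simp
  show "z \<in> ball 0 1 \<Longrightarrow> (\<lambda>N. ?P N z) \<longlonglongrightarrow> blaschke a z" using pw eq by simp
qed

lemma cmod_blaschke_le_factors:
  assumes "blaschke_sequence a" "z \<in> ball 0 1" "finite I"
  shows "cmod (blaschke a z) \<le> (\<Prod>n\<in>I. pseudo_hyp (a n) z)"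
proof -
  have a: "a n \<in> ball 0 1" for n using assms(1) by (simp add: blaschke_sequence_def)
  have "(\<lambda>N. cmod (\<Prod>n<N. blaschke_factor (a n) z)) \<longlonglongrightarrow> cmod (blaschke a z)"
    by (intro tendsto_norm blaschke_limit(3) assms)
  moreover obtain N0 where N0: "I \<subseteq> {..<N0}"
    using finite_nat_bounded[OF assms(3)] by blast
  have "cmod (\<Prod>n<N. blaschke_factor (a n) z) \<le> (\<Prod>n\<in>I. pseudo_hyp (a n) z)" if "N \<ge> N0" for N
  proof -
    have "I \<subseteq> {..<N}" using N0 that by auto
    then have "(\<Prod>n<N. pseudo_hyp (a n) z) = (\<Prod>n\<in>I. pseudo_hyp (a n) z) * (\<Prod>n\<in>{..<N}-I. pseudo_hyp (a n) z)"
      by (subst prod.subset_diff[of I]) auto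
    also have "\<dots> \<le> (\<Prod>n\<in>I. pseudo_hyp (a n) z) * 1"
      by (intro mult_left_mono prod_le_1 prod_nonneg conjI)
         (auto simp: pseudo_hyp_nonneg intro: less_imp_le[OF pseudo_hyp_less_1] a assms)
    finally show ?thesis unfolding prod_norm[symmetric] cmod_blaschke_factor by simp
  qed
  ultimately show ?thesis by (intro LIMSEQ_le_const2) auto
qed

lemma blaschke_zero:
  assumes "blaschke_sequence a"
  shows "blaschke a (a n) = 0"
proof -
  have "a n \<in> ball 0 1" using assms by (simp add: blaschke_sequence_def)
  from cmod_blaschke_le_factors[OF assms this, of "{n}"] show ?thesis by (simp add: pseudo_hyp_def)
qed

lemma blaschke_multiplier_limit:
  assumes "blaschke_sequence a" "f \<in> H2" "\<And>z. z \<in> ball 0 1 \<Longrightarrow> cmod (f z) \<le> K"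
  shows "(\<lambda>N. h2_norm (\<lambda>z. (\<Prod>n<N. blaschke_factor (a n) z) * f z - blaschke a z * f z)) \<longlonglongrightarrow> 0"
proof (rule tendsto_norm_zero_cancel, rule Lim_null_comparison)
  have a: "a n \<in> ball 0 1" for n using assms(1) by (simp add: blaschke_sequence_def)
  let ?P = "\<lambda>N z. \<Prod>n<N. blaschke_factor (a n) z"
  have D: "(\<lambda>z. ?P N z - blaschke a z) \<in> H2" for N
    by (intro H2_diff blaschke_limit(1) assms inner_function_in_H2(1) inner_function_partial_product a)
  show "(\<lambda>N. K * h2_norm (\<lambda>z. ?P N z - blaschke a z)) \<longlonglongrightarrow> 0"
    using tendsto_mult[OF tendsto_const blaschke_limit(2)[OF assms(1)], of K] by simp
  have "h2_norm (\<lambda>z. f z * (?P N z - blaschke a z)) \<le> K * h2_norm (\<lambda>z. ?P N z - blaschke a z)"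
    and H: "(\<lambda>z. f z * (?P N z - blaschke a z)) \<in> H2" for N
    using bounded_multiplier[OF D H2_holomorphic[OF assms(2)] assms(3)] by auto
  moreover have "(\<lambda>z. f z * (?P N z - blaschke a z)) = (\<lambda>z. ?P N z * f z - blaschke a z * f z)" for N
    by (simp add: algebra_simps)
  ultimately show "eventually (\<lambda>N. norm (norm (h2_norm (\<lambda>z. ?P N z * f z - blaschke a z * f z)))
      \<le> K * h2_norm (\<lambda>z. ?P N z - blaschke a z)) sequentially"
    using h2_norm_nonneg[OF H] by (intro always_eventually allI) (simp del: of_nat_Suc)
qed

text \<open>The upper bound only needs |B| <= 1. The lower bound passes to the limit from the
  partial products, but their norm convergence can be multiplied only by bounded functions; it is
  proved for these first and extended to H^2 by Taylor polynomials.\<close>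

lemma inner_function_blaschke:
  assumes "blaschke_sequence a"
  shows "inner_function (blaschke a)"
  unfolding inner_function_def
proof (intro conjI ballI)
  have a: "a n \<in> ball 0 1" for n using assms(1) by (simp add: blaschke_sequence_def)
  let ?P = "\<lambda>N z. \<Prod>n<N. blaschke_factor (a n) z"
  note I = inner_function_partial_product[of a, OF a]
  show hol: "blaschke a holomorphic_on ball 0 1"
    by (rule H2_holomorphic[OF blaschke_limit(1)[OF assms]])
  show le1: "cmod (blaschke a z) \<le> 1" if "z \<in> ball 0 1" for z
    using cmod_blaschke_le_factors[OF assms that, of "{}"] by simp
  have H: "(\<lambda>z. blaschke a z * f z) \<in> H2" "h2_norm (\<lambda>z. blaschke a z * f z) \<le> 1 * h2_norm f"
    if "f \<in> H2" for f
  proof -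
    show "(\<lambda>z. blaschke a z * f z) \<in> H2" by (rule bounded_multiplier(1)[OF that hol le1])
    show "h2_norm (\<lambda>z. blaschke a z * f z) \<le> 1 * h2_norm f"
      by (rule bounded_multiplier(2)[OF that hol le1])
  qed
  have bdd: "h2_norm f \<le> h2_norm (\<lambda>z. blaschke a z * f z)"
    if f: "f \<in> H2" "\<And>z. z \<in> ball 0 1 \<Longrightarrow> cmod (f z) \<le> K" for f K
  proof (rule LIMSEQ_le_const)
    show "(\<lambda>N. h2_norm (\<lambda>z. blaschke a z * f z) + h2_norm (\<lambda>z. ?P N z * f z - blaschke a z * f z))
      \<longlonglongrightarrow> h2_norm (\<lambda>z. blaschke a z * f z)"
      by (rule tendsto_eq_rhs[OF tendsto_add[OF tendsto_const blaschke_multiplier_limit[OF assms f]] add_0_right])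
    show "\<exists>N. \<forall>n\<ge>N. h2_norm f \<le> h2_norm (\<lambda>z. blaschke a z * f z) + h2_norm (\<lambda>z. ?P n z * f z - blaschke a z * f z)"
      using h2_norm_le_diff[OF inner_function_H2[OF I f(1)] H(1)[OF f(1)]]
      unfolding inner_function_norm[OF I f(1)] by (intro exI[of _ 0] allI impI)
  qed
  fix f assume f: "f \<in> H2"
  have "h2_norm f \<le> h2_norm (\<lambda>z. blaschke a z * f z)"
  proof (rule field_le_epsilon)
    fix e :: real assume e: "e > 0"
    let ?p = "\<lambda>K z. \<Sum>k<K. taylor_coeff f k * z ^ k"
    obtain K where K: "h2_norm (\<lambda>z. f z - ?p K z) < e / 2" "?p K \<in> H2"
      by (rule polynomial_approx[OF f half_gt_zero[OF e]])
    have "cmod (?p K z) \<le> (\<Sum>k<K. cmod (taylor_coeff f k))" if "z \<in> ball 0 1" for z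
      using that by (intro order.trans[OF norm_sum] sum_mono)
        (auto simp: norm_mult norm_power intro!: mult_left_le power_le_one)
    from bdd[OF K(2) this] have 1: "h2_norm (?p K) \<le> h2_norm (\<lambda>z. blaschke a z * ?p K z)" .
    have 2: "h2_norm f \<le> h2_norm (?p K) + h2_norm (\<lambda>z. f z - ?p K z)"
      by (rule h2_norm_le_diff[OF f K(2)])
    have 3: "h2_norm (\<lambda>z. blaschke a z * ?p K z) \<le> h2_norm (\<lambda>z. blaschke a z * f z)
      + h2_norm (\<lambda>z. blaschke a z * ?p K z - blaschke a z * f z)"
      by (rule h2_norm_le_diff[OF H(1)[OF K(2)] H(1)[OF f]])
    have "h2_norm (\<lambda>z. blaschke a z * (?p K z - f z)) \<le> 1 * h2_norm (\<lambda>z. ?p K z - f z)"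
      by (rule H(2)[OF H2_diff[OF K(2) f]])
    then have 4: "h2_norm (\<lambda>z. blaschke a z * ?p K z - blaschke a z * f z) \<le> h2_norm (\<lambda>z. f z - ?p K z)"
      unfolding right_diff_distrib mult_1 h2_norm_diff_commute[OF f K(2)] .
    show "h2_norm f \<le> h2_norm (\<lambda>z. blaschke a z * f z) + e"
      using 1 2 3 4 K(1) by linarith
  qed
  with H(2)[OF f] show "h2_norm (\<lambda>z. blaschke a z * f z) = h2_norm f" by linarith
qed

text \<open>The quotient by the factors in Q is obtained without division: choose N beyond Q and
  multiply the remaining factors below N by the Blaschke product of the tail.\<close>

lemma blaschke_split:
  assumes "blaschke_sequence a" "finite Q"
  obtains \<theta> where "inner_function \<theta>"
    "\<And>z. z \<in> ball 0 1 \<Longrightarrow> blaschke a z = (\<Prod>n\<in>Q. blaschke_factor (a n) z) * \<theta> z"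
proof -
  have a: "a n \<in> ball 0 1" for n using assms(1) by (simp add: blaschke_sequence_def)
  obtain N where N: "Q \<subseteq> {..<N}" using finite_nat_bounded[OF assms(2)] by blast
  let ?b = "\<lambda>n. a (n + N)"
  have b: "blaschke_sequence ?b"
    using assms(1) summable_ignore_initial_segment[of "\<lambda>n. 1 - cmod (a n)" N]
    by (auto simp: blaschke_sequence_def)
  let ?\<theta> = "\<lambda>z. (\<Prod>n\<in>{..<N}-Q. blaschke_factor (a n) z) * blaschke ?b z"
  show ?thesis
  proof (rule that[of ?\<theta>])
    show "inner_function ?\<theta>"
      by (intro inner_function_mult inner_function_partial_product a inner_function_blaschke b)
    fix z :: complex assume z: "z \<in> ball 0 1"
    have "(\<lambda>M. \<Prod>n<M + N. blaschke_factor (a n) z) \<longlonglongrightarrow> blaschke a z"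
      by (rule LIMSEQ_ignore_initial_segment[OF blaschke_limit(3)[OF assms(1) z]])
    moreover have "(\<lambda>M. \<Prod>n<M + N. blaschke_factor (a n) z)
      = (\<lambda>M. (\<Prod>n<N. blaschke_factor (a n) z) * (\<Prod>n<M. blaschke_factor (?b n) z))"
    proof
      fix M
      have eq: "{..<M + N} = {..<N} \<union> {N..<M + N}" by auto
      have "(\<Prod>n<M + N. blaschke_factor (a n) z)
        = (\<Prod>n<N. blaschke_factor (a n) z) * (\<Prod>n\<in>{N..<M + N}. blaschke_factor (a n) z)"
        unfolding eq by (rule prod.union_disjoint) auto
      also have "(\<Prod>n\<in>{N..<M + N}. blaschke_factor (a n) z) = (\<Prod>n<M. blaschke_factor (?b n) z)"
        using prod.shift_bounds_nat_ivl[of "\<lambda>n. blaschke_factor (a n) z" 0 N M] by (simp add: atLeast0LessThan)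
      finally show "(\<Prod>n<M + N. blaschke_factor (a n) z)
        = (\<Prod>n<N. blaschke_factor (a n) z) * (\<Prod>n<M. blaschke_factor (?b n) z)" .
    qed
    moreover have "(\<lambda>M. (\<Prod>n<N. blaschke_factor (a n) z) * (\<Prod>n<M. blaschke_factor (?b n) z))
      \<longlonglongrightarrow> (\<Prod>n<N. blaschke_factor (a n) z) * blaschke ?b z"
      by (intro tendsto_mult tendsto_const blaschke_limit(3) b z)
    ultimately have "blaschke a z = (\<Prod>n<N. blaschke_factor (a n) z) * blaschke ?b z"
      using LIMSEQ_unique by simp
    also have "(\<Prod>n<N. blaschke_factor (a n) z)
      = (\<Prod>n\<in>Q. blaschke_factor (a n) z) * (\<Prod>n\<in>{..<N}-Q. blaschke_factor (a n) z)"
      using N by (subst prod.subset_diff[of Q]) (auto simp: mult.commute)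
    finally show "blaschke a z = (\<Prod>n\<in>Q. blaschke_factor (a n) z) * ?\<theta> z" by (simp add: mult.assoc)
  qed
qed

section \<open>Model spaces\<close>

lemma model_space_H2: "f \<in> model_space \<theta> \<Longrightarrow> f \<in> H2"
  by (simp add: model_space_def)

lemma model_space_orthogonal:
  "f \<in> model_space \<theta> \<Longrightarrow> g \<in> H2 \<Longrightarrow> h2_inner f (\<lambda>z. \<theta> z * g z) = 0"
  by (simp add: model_space_def)

lemma model_space_zero: "inner_function \<theta> \<Longrightarrow> (\<lambda>z. 0) \<in> model_space \<theta>"
  by (simp add: model_space_def H2_zero h2_inner_zero_left)

lemma model_space_add_cmult:
  assumes "inner_function \<theta>" "f \<in> model_space \<theta>" "g \<in> model_space \<theta>"
  shows "(\<lambda>z. f z + c * g z) \<in> model_space \<theta>"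
proof -
  have f: "f \<in> H2" and g: "g \<in> H2" using assms by (auto simp: model_space_H2)
  have "h2_inner (\<lambda>z. f z + c * g z) (\<lambda>z. \<theta> z * h z) = 0" if h: "h \<in> H2" for h
    using h2_inner_add_left[OF f H2_cmult[OF g] inner_function_H2[OF assms(1) h], of c]
      h2_inner_cmult_left[OF g inner_function_H2[OF assms(1) h], of c]
      model_space_orthogonal[OF assms(2) h] model_space_orthogonal[OF assms(3) h] by simp
  then show ?thesis unfolding model_space_def using H2_add[OF f H2_cmult[OF g]] by blast
qed

lemma model_space_diff:
  assumes "inner_function \<theta>" "f \<in> model_space \<theta>" "g \<in> model_space \<theta>"
  shows "(\<lambda>z. f z - g z) \<in> model_space \<theta>"
  using model_space_add_cmult[OF assms, of "-1"] by simp

text \<open>Orthogonal projection onto the model space, as a relation certified by G - P being in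
  theta H^2; no existence claim is attached. Equality is demanded on the disc only, since values
  elsewhere carry no information.\<close>

definition model_proj :: "(complex \<Rightarrow> complex) \<Rightarrow> (complex \<Rightarrow> complex) \<Rightarrow> (complex \<Rightarrow> complex) \<Rightarrow> bool" where
  "model_proj \<theta> G P \<longleftrightarrow> P \<in> model_space \<theta> \<and> (\<exists>h\<in>H2. \<forall>z\<in>ball 0 1. G z - P z = \<theta> z * h z)"

lemma model_proj_H2:
  assumes "inner_function \<theta>" "model_proj \<theta> G P"
  shows "P \<in> model_space \<theta>" "P \<in> H2" "G \<in> H2"
proof -
  obtain h where h: "h \<in> H2" "\<And>z. z \<in> ball 0 1 \<Longrightarrow> G z - P z = \<theta> z * h z"
    using assms(2) by (auto simp: model_proj_def)
  show P: "P \<in> model_space \<theta>" using assms(2) by (simp add: model_proj_def)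
  then show P2: "P \<in> H2" by (rule model_space_H2)
  show "G \<in> H2"
    by (rule H2_cong[OF H2_add[OF P2 inner_function_H2[OF assms(1) h(1)]]]) (simp add: h(2)[symmetric])
qed

lemma model_proj_orthogonal:
  assumes "inner_function \<theta>" "model_proj \<theta> G P" "k \<in> model_space \<theta>"
  shows "h2_inner k (\<lambda>z. G z - P z) = 0"
proof -
  obtain h where h: "h \<in> H2" "\<And>z. z \<in> ball 0 1 \<Longrightarrow> G z - P z = \<theta> z * h z"
    using assms(2) by (auto simp: model_proj_def)
  have "h2_inner k (\<lambda>z. G z - P z) = h2_inner k (\<lambda>z. \<theta> z * h z)"
    by (rule h2_inner_cong) (auto simp: h(2))
  then show ?thesis using model_space_orthogonal[OF assms(3) h(1)] by simp
qed

lemma model_proj_inner: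
  assumes "inner_function \<theta>" "model_proj \<theta> G P" "k \<in> model_space \<theta>"
  shows "h2_inner k G = h2_inner k P"
  using model_proj_orthogonal[OF assms]
    h2_inner_diff_right[OF model_proj_H2(3,2)[OF assms(1,2)] model_space_H2[OF assms(3)]] by simp

lemma model_proj_Pythagoras:
  assumes "inner_function \<theta>" "model_proj \<theta> G P" "k \<in> model_space \<theta>"
  shows "(h2_norm (\<lambda>z. k z - G z))\<^sup>2 = (h2_norm (\<lambda>z. k z - P z))\<^sup>2 + (h2_norm (\<lambda>z. G z - P z))\<^sup>2"
proof -
  note P = model_proj_H2[OF assms(1,2)]
  have kP: "(\<lambda>z. k z - P z) \<in> model_space \<theta>" by (rule model_space_diff[OF assms(1,3) P(1)])
  have "(\<lambda>z. k z - G z) = (\<lambda>z. (k z - P z) - (G z - P z))" by auto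
  then show ?thesis
    using h2_norm_diff_power2[OF model_space_H2[OF kP] H2_diff[OF P(3,2)]]
      model_proj_orthogonal[OF assms(1,2) kP] by simp
qed

lemma model_proj_dist:
  assumes "inner_function \<theta>" "model_proj \<theta> G P" "k \<in> model_space \<theta>"
  shows "h2_norm (\<lambda>z. k z - P z) \<le> h2_norm (\<lambda>z. k z - G z)"
proof (rule power2_le_imp_le)
  show "(h2_norm (\<lambda>z. k z - P z))\<^sup>2 \<le> (h2_norm (\<lambda>z. k z - G z))\<^sup>2"
    using model_proj_Pythagoras[OF assms] by simp
  show "0 \<le> h2_norm (\<lambda>z. k z - G z)"
    by (intro h2_norm_nonneg H2_diff model_space_H2[OF assms(3)] model_proj_H2(3)[OF assms(1,2)])
qed

lemma model_proj_norm_power2: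
  assumes "inner_function \<theta>" "model_proj \<theta> G P"
  shows "(h2_norm G)\<^sup>2 = (h2_norm P)\<^sup>2 + (h2_norm (\<lambda>z. G z - P z))\<^sup>2"
proof -
  note P = model_proj_H2[OF assms(1,2)]
  show ?thesis
    using model_proj_Pythagoras[OF assms model_space_zero[OF assms(1)]]
      h2_norm_diff_commute[OF H2_zero P(2)] h2_norm_diff_commute[OF H2_zero P(3)] by simp
qed

lemma model_proj_norm_le:
  assumes "inner_function \<theta>" "model_proj \<theta> G P"
  shows "h2_norm P \<le> h2_norm G"
  by (rule power2_le_imp_le)
     (use model_proj_norm_power2[OF assms] h2_norm_nonneg[OF model_proj_H2(3)[OF assms]] in auto)

lemma model_proj_zero: "inner_function \<theta> \<Longrightarrow> model_proj \<theta> (\<lambda>z. 0) (\<lambda>z. 0)"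
  unfolding model_proj_def using model_space_zero H2_zero by (auto intro!: bexI[of _ "\<lambda>z. 0"])

lemma model_proj_add_cmult:
  assumes "inner_function \<theta>" "model_proj \<theta> G P" "model_proj \<theta> G' P'"
  shows "model_proj \<theta> (\<lambda>z. G z + c * G' z) (\<lambda>z. P z + c * P' z)"
proof -
  obtain h where h: "h \<in> H2" "\<And>z. z \<in> ball 0 1 \<Longrightarrow> G z - P z = \<theta> z * h z"
    using assms(2) by (auto simp: model_proj_def)
  obtain h' where h': "h' \<in> H2" "\<And>z. z \<in> ball 0 1 \<Longrightarrow> G' z - P' z = \<theta> z * h' z"
    using assms(3) by (auto simp: model_proj_def)
  show ?thesis unfolding model_proj_def
  proof (intro conjI bexI ballI)
    show "(\<lambda>z. P z + c * P' z) \<in> model_space \<theta>"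
      using assms by (intro model_space_add_cmult) (auto simp: model_proj_def)
    show "(\<lambda>z. h z + c * h' z) \<in> H2" by (intro H2_add H2_cmult h h')
    fix z :: complex assume z: "z \<in> ball 0 1"
    have "G z + c * G' z - (P z + c * P' z) = (G z - P z) + c * (G' z - P' z)"
      by (simp add: algebra_simps)
    also have "\<dots> = \<theta> z * (h z + c * h' z)"
      unfolding h(2)[OF z] h'(2)[OF z] by (simp add: algebra_simps)
    finally show "G z + c * G' z - (P z + c * P' z) = \<theta> z * (h z + c * h' z)" .
  qed
qed

lemma model_proj_sum:
  assumes "inner_function \<theta>" "\<And>i. i \<in> I \<Longrightarrow> model_proj \<theta> (G i) (P i)"
  shows "model_proj \<theta> (\<lambda>z. \<Sum>i\<in>I. c i * G i z) (\<lambda>z. \<Sum>i\<in>I. c i * P i z)"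
  using assms(2)
proof (induction I rule: infinite_finite_induct)
  case (insert i I)
  then have "model_proj \<theta> (\<lambda>z. (\<Sum>i\<in>I. c i * G i z) + c i * G i z) (\<lambda>z. (\<Sum>i\<in>I. c i * P i z) + c i * P i z)"
    by (intro model_proj_add_cmult[OF assms(1)]) auto
  then show ?case using insert.hyps by (simp add: add.commute)
qed (auto simp: model_proj_zero[OF assms(1)])

section \<open>Kernels of model spaces\<close>

lemma model_kernel_eq: "model_kernel \<theta> w z = szego w z - cnj (\<theta> w) * (\<theta> z * szego w z)"
  by (simp add: model_kernel_def szego_def diff_divide_distrib)

text \<open>Paired with theta g, both terms of the kernel give the conjugate of theta(w) g(w): the
  first by the reproducing property, the second because multiplication by theta preserves inner
  products. They cancel.\<close>

lemma model_kernel_in_model_space: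
  assumes "inner_function \<theta>" "w \<in> ball 0 1"
  shows "model_kernel \<theta> w \<in> model_space \<theta>"
proof -
  note s = H2_szego[OF assms(2)]
  note ts = inner_function_H2[OF assms(1) s]
  have eq: "model_kernel \<theta> w = (\<lambda>z. szego w z - cnj (\<theta> w) * (\<theta> z * szego w z))"
    by (rule ext) (rule model_kernel_eq)
  have "h2_inner (model_kernel \<theta> w) (\<lambda>z. \<theta> z * g z) = 0" if g: "g \<in> H2" for g
  proof -
    note tg = inner_function_H2[OF assms(1) g]
    have "h2_inner (szego w) (\<lambda>z. \<theta> z * g z) = cnj (\<theta> w * g w)"
      using h2_inner_commute[OF tg s] h2_inner_szego[OF tg assms(2)] by simp
    moreover have "h2_inner (\<lambda>z. \<theta> z * szego w z) (\<lambda>z. \<theta> z * g z) = cnj (g w)"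
      using inner_function_inner[OF assms(1) s g] h2_inner_commute[OF g s] h2_inner_szego[OF g assms(2)]
      by simp
    ultimately show ?thesis
      unfolding eq h2_inner_diff_left[OF s H2_cmult[OF ts] tg] h2_inner_cmult_left[OF ts tg] by simp
  qed
  moreover have "model_kernel \<theta> w \<in> H2" unfolding eq by (intro H2_diff s H2_cmult ts)
  ultimately show ?thesis by (simp add: model_space_def)
qed

lemma model_proj_szego:
  assumes "inner_function \<theta>" "w \<in> ball 0 1"
  shows "model_proj \<theta> (szego w) (model_kernel \<theta> w)"
  unfolding model_proj_def
proof (intro conjI bexI ballI)
  show "model_kernel \<theta> w \<in> model_space \<theta>" by (rule model_kernel_in_model_space[OF assms])
  show "(\<lambda>z. cnj (\<theta> w) * szego w z) \<in> H2" by (intro H2_cmult H2_szego assms)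
qed (simp add: model_kernel_eq)

lemma model_kernel_norm:
  assumes "inner_function \<theta>" "w \<in> ball 0 1"
  shows "(h2_norm (model_kernel \<theta> w))\<^sup>2 = (1 - (cmod (\<theta> w))\<^sup>2) / (1 - (cmod w)\<^sup>2)"
proof -
  have "h2_norm (\<lambda>z. szego w z - model_kernel \<theta> w z) = h2_norm (\<lambda>z. cnj (\<theta> w) * (\<theta> z * szego w z))"
    by (simp add: model_kernel_eq)
  also have "\<dots> = cmod (\<theta> w) * h2_norm (szego w)"
    using h2_norm_cmult[OF inner_function_H2[OF assms(1) H2_szego[OF assms(2)]]]
      inner_function_norm[OF assms(1) H2_szego[OF assms(2)]] by simp
  finally have "(h2_norm (szego w))\<^sup>2 = (h2_norm (model_kernel \<theta> w))\<^sup>2 + (cmod (\<theta> w) * h2_norm (szego w))\<^sup>2"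
    using model_proj_norm_power2[OF assms(1) model_proj_szego[OF assms]] by simp
  then have "(h2_norm (model_kernel \<theta> w))\<^sup>2 = (1 - (cmod (\<theta> w))\<^sup>2) * (h2_norm (szego w))\<^sup>2"
    by (simp add: algebra_simps power_mult_distrib)
  then show ?thesis by (simp add: h2_norm_szego[OF assms(2)])
qed

lemma model_kernel_at_zero: "\<theta> w = 0 \<Longrightarrow> model_kernel \<theta> w = szego w"
  by (rule ext) (simp add: model_kernel_eq)

section \<open>Linear spans and their closures in H^2\<close>

inductive_set hspan :: "(complex \<Rightarrow> complex) set \<Rightarrow> (complex \<Rightarrow> complex) set" for X where
  zero: "(\<lambda>z. 0) \<in> hspan X"
| step: "f \<in> hspan X \<Longrightarrow> x \<in> X \<Longrightarrow> (\<lambda>z. f z + c * x z) \<in> hspan X"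

lemma hspan_add_cmult:
  assumes "f \<in> hspan X" "g \<in> hspan X"
  shows "(\<lambda>z. f z + c * g z) \<in> hspan X"
  using assms(2)
proof induction
  case zero
  then show ?case using assms(1) by simp
next
  case (step g x d)
  from hspan.step[OF step.IH step.hyps(2), of "c * d"] show ?case by (simp add: algebra_simps)
qed

lemma hspan_base: "x \<in> X \<Longrightarrow> x \<in> hspan X"
  using hspan.step[OF hspan.zero, of x X 1] by simp

lemma hspan_sum:
  assumes "\<And>i. i \<in> I \<Longrightarrow> x i \<in> X"
  shows "(\<lambda>z. \<Sum>i\<in>I. c i * x i z) \<in> hspan X"
  using assms
proof (induction I rule: infinite_finite_induct)
  case (insert i I)
  then have "(\<lambda>z. (\<Sum>i\<in>I. c i * x i z) + c i * x i z) \<in> hspan X" by (intro hspan.step) auto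
  then show ?case using insert.hyps by (simp add: add.commute)
qed (auto intro: hspan.zero)

lemma hspan_mono:
  assumes "X \<subseteq> Y"
  shows "hspan X \<subseteq> hspan Y"
proof
  fix f assume "f \<in> hspan X"
  then show "f \<in> hspan Y" by induction (use assms in \<open>auto intro: hspan.intros\<close>)
qed

lemma hspan_H2:
  assumes "X \<subseteq> H2" "f \<in> hspan X"
  shows "f \<in> H2"
  using assms(2) by induction (use assms(1) in \<open>auto intro!: H2_zero H2_add H2_cmult\<close>)

lemma hspan_model_space:
  assumes "inner_function \<theta>" "X \<subseteq> model_space \<theta>" "f \<in> hspan X"
  shows "f \<in> model_space \<theta>"
  using assms(3)
  by induction (use assms(1,2) in \<open>auto intro!: model_space_zero model_space_add_cmult\<close>)

lemma hspan_rangeE: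
  fixes x :: "nat \<Rightarrow> complex \<Rightarrow> complex"
  assumes "f \<in> hspan (range x)"
  obtains N a where "f = (\<lambda>z. \<Sum>n<N. a n * x n z)"
proof -
  have "\<exists>N a. f = (\<lambda>z. \<Sum>n<N. a n * x n z)" using assms
  proof induction
    case zero
    show ?case by (rule exI[of _ 0]) simp
  next
    case (step f y c)
    then obtain N a m where f: "f = (\<lambda>z. \<Sum>n<N. a n * x n z)" and m: "y = x m" by auto
    let ?M = "max N (Suc m)"
    let ?b = "\<lambda>n. (if n < N then a n else 0) + (if n = m then c else 0)"
    have "(\<lambda>z. f z + c * y z) = (\<lambda>z. \<Sum>n<?M. ?b n * x n z)"
    proof
      fix z
      have "(\<Sum>n<?M. ?b n * x n z) = (\<Sum>n<?M. if n < N then a n * x n z else 0) + (\<Sum>n<?M. if n = m then c * x n z else 0)"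
        unfolding sum.distrib[symmetric] by (intro sum.cong) (auto simp: algebra_simps)
      also have "(\<Sum>n<?M. if n < N then a n * x n z else 0) = (\<Sum>n<N. a n * x n z)"
        by (rule sum.mono_neutral_cong_right) auto
      also have "(\<Sum>n<?M. if n = m then c * x n z else 0) = c * x m z" by simp
      finally show "f z + c * y z = (\<Sum>n<?M. ?b n * x n z)" by (simp add: f m)
    qed
    then show ?case by (intro exI)
  qed
  then show ?thesis using that by blast
qed

definition hclspan :: "(complex \<Rightarrow> complex) set \<Rightarrow> (complex \<Rightarrow> complex) set" where
  "hclspan X = {f \<in> H2. \<forall>e>0. \<exists>g\<in>hspan X. h2_norm (\<lambda>z. f z - g z) < e}"

lemma hclspan_H2: "f \<in> hclspan X \<Longrightarrow> f \<in> H2"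
  by (simp add: hclspan_def)

text \<open>Reconciles two notions of equality: \<open>hspan\<close> compares functions on the whole
  plane, while \<open>h2_norm\<close> only sees the germ at 0.\<close>

lemma hclspan_if_eq_on_ball:
  assumes "X \<subseteq> H2" "g \<in> hspan X" "\<And>z. z \<in> ball 0 1 \<Longrightarrow> f z = g z"
  shows "f \<in> hclspan X"
proof -
  have f: "f \<in> H2" by (rule H2_cong[OF hspan_H2[OF assms(1,2)]]) (simp add: assms(3))
  have "h2_norm (\<lambda>z. f z - g z) = h2_norm (\<lambda>z. 0)" by (rule h2_norm_cong) (simp add: assms(3))
  then have "h2_norm (\<lambda>z. f z - g z) < e" if "e > 0" for e using that by (simp add: h2_norm_zero)
  then show ?thesis using f assms(2) by (auto simp: hclspan_def)
qed

lemma hclspan_closed: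
  assumes X: "X \<subseteq> H2" and f: "f \<in> H2"
    and lim: "\<And>e. e > 0 \<Longrightarrow> \<exists>g\<in>hclspan X. h2_norm (\<lambda>z. f z - g z) < e"
  shows "f \<in> hclspan X"
  unfolding hclspan_def mem_Collect_eq
proof (intro conjI f allI impI)
  fix e :: real assume "e > 0"
  then have e: "e / 2 > 0" by simp
  from lim[OF e] obtain g where g: "g \<in> hclspan X" "h2_norm (\<lambda>z. f z - g z) < e / 2" by blast
  from g(1) e obtain h where h: "h \<in> hspan X" "h2_norm (\<lambda>z. g z - h z) < e / 2"
    unfolding hclspan_def by blast
  have "h2_norm (\<lambda>z. f z - h z) < e"
    using h2_norm_diff_triangle[OF f hclspan_H2[OF g(1)] hspan_H2[OF X h(1)]] g(2) h(2) by linarith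
  then show "\<exists>h\<in>hspan X. h2_norm (\<lambda>z. f z - h z) < e" using h(1) by blast
qed

lemma hclspan_add_cmult:
  assumes X: "X \<subseteq> H2" and f: "f \<in> hclspan X" and g: "g \<in> hclspan X"
  shows "(\<lambda>z. f z + c * g z) \<in> hclspan X"
  unfolding hclspan_def mem_Collect_eq
proof (intro conjI allI impI)
  note fg = hclspan_H2[OF f] hclspan_H2[OF g]
  show "(\<lambda>z. f z + c * g z) \<in> H2" by (intro H2_add H2_cmult fg)
  fix e :: real assume e: "e > 0"
  define d where "d = e / (2 * (1 + cmod c))"
  have d: "d > 0" unfolding d_def using e by (intro divide_pos_pos mult_pos_pos add_pos_nonneg) auto
  obtain f' where f': "f' \<in> hspan X" "h2_norm (\<lambda>z. f z - f' z) < d" using f d unfolding hclspan_def by blast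
  obtain g' where g': "g' \<in> hspan X" "h2_norm (\<lambda>z. g z - g' z) < d" using g d unfolding hclspan_def by blast
  note fg' = hspan_H2[OF X f'(1)] hspan_H2[OF X g'(1)]
  have "h2_norm (\<lambda>z. (f z - f' z) + c * (g z - g' z)) \<le> h2_norm (\<lambda>z. f z - f' z) + h2_norm (\<lambda>z. c * (g z - g' z))"
    by (intro h2_norm_triangle H2_diff H2_cmult fg fg')
  also have "h2_norm (\<lambda>z. c * (g z - g' z)) = cmod c * h2_norm (\<lambda>z. g z - g' z)"
    by (intro h2_norm_cmult H2_diff fg fg')
  also have "\<dots> \<le> cmod c * d" using g'(2) by (intro mult_left_mono) auto
  also have "h2_norm (\<lambda>z. f z - f' z) + cmod c * d < d + cmod c * d" using f'(2) by simp
  also have "d + cmod c * d = d * (1 + cmod c)" by (simp add: algebra_simps)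
  also have "\<dots> = e / 2" unfolding d_def
    using add_pos_nonneg[of 1 "cmod c"] by (simp add: field_simps)
  also have "\<dots> < e" using e by simp
  finally have lt: "h2_norm (\<lambda>z. (f z - f' z) + c * (g z - g' z)) < e" by simp
  have "(\<lambda>z. (f z - f' z) + c * (g z - g' z)) = (\<lambda>z. f z + c * g z - (f' z + c * g' z))"
    by (simp add: algebra_simps)
  with lt have "h2_norm (\<lambda>z. f z + c * g z - (f' z + c * g' z)) < e" by metis
  then show "\<exists>h\<in>hspan X. h2_norm (\<lambda>z. f z + c * g z - h z) < e"
    using hspan_add_cmult[OF f'(1) g'(1), of c] by (intro bexI[of _ "\<lambda>z. f' z + c * g' z"])
qed

lemma hspan_hclspan:
  assumes X: "X \<subseteq> H2" and Y: "Y \<subseteq> hclspan X" and f: "f \<in> hspan Y"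
  shows "f \<in> hclspan X"
  using f
proof induction
  case zero
  show ?case by (rule hclspan_if_eq_on_ball[OF X hspan.zero]) simp
next
  case (step f x c)
  then show ?case using Y by (intro hclspan_add_cmult[OF X]) auto
qed

section \<open>Completeness of the Szego kernels at the zeros\<close>

lemma szego_subset_H2: "S \<subseteq> ball 0 1 \<Longrightarrow> szego ` S \<subseteq> H2"
  using H2_szego by auto

lemma monomial_H2: "(\<lambda>z. z ^ n) \<in> H2" and taylor_coeff_monomial:
  "taylor_coeff (\<lambda>z. z ^ n) k = (if k = n then 1 else 0)"
proof -
  have s: "(\<lambda>k. (if k = n then 1 else 0) * z ^ k) sums z ^ n" for z :: complex
    using sums_single[of n "\<lambda>k. z ^ k"] by (simp add: if_distrib[of "\<lambda>x. x * _"] cong: if_cong)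
  show "(\<lambda>z. z ^ n) \<in> H2"
  proof (rule H2I_sums[OF s])
    show "summable (\<lambda>k. (cmod (if k = n then 1 else 0))\<^sup>2)"
      by (rule summable_finite[of "{n}"]) auto
  qed
  show "taylor_coeff (\<lambda>z. z ^ n) k = (if k = n then 1 else 0)" by (rule taylor_coeff_eqI[OF s])
qed

lemma taylor_coeff_sum:
  assumes "\<And>i. i \<in> I \<Longrightarrow> f i \<in> H2"
  shows "taylor_coeff (\<lambda>z. \<Sum>i\<in>I. c i * f i z) k = (\<Sum>i\<in>I. c i * taylor_coeff (f i) k)"
  using assms
proof (induction I rule: infinite_finite_induct)
  case (insert i I)
  have F: "(\<lambda>z. \<Sum>i\<in>I. c i * f i z) \<in> H2" using insert.prems by (intro H2_sum) auto
  have fi: "f i \<in> H2" using insert.prems by simp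
  have "taylor_coeff (\<lambda>z. c i * f i z + (\<Sum>i\<in>I. c i * f i z)) k
    = c i * taylor_coeff (f i) k + taylor_coeff (\<lambda>z. \<Sum>i\<in>I. c i * f i z) k"
    unfolding taylor_coeff_add[OF H2_holomorphic[OF H2_cmult[OF fi]] H2_holomorphic[OF F]]
      taylor_coeff_cmult[OF H2_holomorphic[OF fi]] ..
  then show ?case using insert by simp
qed (auto simp: taylor_coeff_zero)

text \<open>Averaging the kernels at the points of radius $1/2$ over the $M$-th roots of unity leaves
  only the coefficients in one residue class modulo $M$.\<close>

lemma monomial_approx_szego:
  assumes "n < M"
  obtains g where "g \<in> hspan (szego ` ball 0 1)" "(h2_norm (\<lambda>z. z ^ n - g z))\<^sup>2 \<le> (4 ^ n * 4 / 3) * (1 / 4) ^ M"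
proof -
  have M: "M > 0" using assms by simp
  obtain \<omega> :: complex where \<omega>: "\<omega> ^ M = 1" "cmod \<omega> = 1" "inj_on (\<lambda>k. \<omega> ^ k) {..<M}"
    using primitive_root_of_unity_exists[OF M] .
  define w where "w j = \<omega> ^ j / 2" for j
  \<comment> \<open>The factor 1 / M averages over the roots of unity and 2^n undoes the radius 1/2
    at the coefficient of index n. Coefficients below M then match those of z^n exactly, and the
    later ones are at most 2^n / 2^k; the sum of their squares is the geometric tail with factor
    4/3.\<close>
  define c where "c j = (\<omega> ^ j) ^ n * 2 ^ n / of_nat M" for j
  have wb: "w j \<in> ball 0 1" for j by (simp add: w_def norm_divide norm_power \<omega>(2))
  let ?g = "\<lambda>z. \<Sum>j<M. c j * szego (w j) z"
  have g: "?g \<in> hspan (szego ` ball 0 1)" by (rule hspan_sum) (use wb in blast)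
  have gH: "?g \<in> H2" by (intro H2_sum H2_szego wb)
  have tg: "taylor_coeff ?g k = 2 ^ n / (of_nat M * 2 ^ k) * (\<Sum>j<M. (\<omega> ^ j) ^ n * cnj ((\<omega> ^ j) ^ k))" for k
  proof -
    have "taylor_coeff ?g k = (\<Sum>j<M. c j * cnj (w j) ^ k)"
      using taylor_coeff_sum[of "{..<M}" "\<lambda>j. szego (w j)" c k, OF H2_szego[OF wb]]
      by (simp add: taylor_coeff_szego[OF wb])
    also have "\<dots> = (\<Sum>j<M. 2 ^ n / (of_nat M * 2 ^ k) * ((\<omega> ^ j) ^ n * cnj ((\<omega> ^ j) ^ k)))"
      by (intro sum.cong refl) (simp add: c_def w_def power_divide)
    finally show ?thesis by (simp add: sum_distrib_left)
  qed
  have small: "taylor_coeff ?g k = (if k = n then 1 else 0)" if "k < M" for k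
    unfolding tg root_of_unity_orthogonality[OF M \<omega> assms that] using M by simp
  have large: "cmod (taylor_coeff ?g k) \<le> 2 ^ n / 2 ^ k" for k
  proof -
    have "cmod (\<Sum>j<M. (\<omega> ^ j) ^ n * cnj ((\<omega> ^ j) ^ k)) \<le> (\<Sum>j<M. 1)"
      by (rule order.trans[OF norm_sum], rule sum_mono) (simp add: norm_mult norm_power \<omega>(2))
    then have "cmod (taylor_coeff ?g k) \<le> 2 ^ n / (real M * 2 ^ k) * real M"
      unfolding tg norm_mult norm_divide norm_power by (intro mult_mono) auto
    then show ?thesis using M by simp
  qed
  let ?d = "\<lambda>z. z ^ n - ?g z"
  have td: "taylor_coeff ?d k = (if k = n then 1 else 0) - taylor_coeff ?g k" for k
    by (simp add: taylor_coeff_diff[OF monomial_H2 gH] taylor_coeff_monomial)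
  have dH: "?d \<in> H2" by (rule H2_diff[OF monomial_H2 gH])
  have "(h2_norm ?d)\<^sup>2 = (\<Sum>k. (cmod (taylor_coeff ?d (k + M)))\<^sup>2) + (\<Sum>k<M. (cmod (taylor_coeff ?d k))\<^sup>2)"
    unfolding h2_norm_power2[OF dH] by (rule suminf_split_initial_segment[OF H2_summable[OF dH]])
  also have "(\<Sum>k<M. (cmod (taylor_coeff ?d k))\<^sup>2) = 0"
    by (rule sum.neutral) (use small td in auto)
  also have "(\<Sum>k. (cmod (taylor_coeff ?d (k + M)))\<^sup>2) \<le> (\<Sum>k. (4 ^ n * (1 / 4) ^ M) * (1 / 4) ^ k)"
  proof (rule suminf_le)
    show "summable (\<lambda>k. (cmod (taylor_coeff ?d (k + M)))\<^sup>2)"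
      by (rule summable_ignore_initial_segment[OF H2_summable[OF dH]])
    show "summable (\<lambda>k. (4 ^ n * (1 / 4) ^ M) * (1 / 4 :: real) ^ k)"
      by (intro summable_mult summable_geometric) auto
    fix k
    have four: "(4::real) ^ m = 2 ^ m * 2 ^ m" for m by (simp flip: power_mult_distrib)
    have "taylor_coeff ?d (k + M) = - taylor_coeff ?g (k + M)" unfolding td using assms by simp
    then have "(cmod (taylor_coeff ?d (k + M)))\<^sup>2 \<le> (2 ^ n / 2 ^ (k + M))\<^sup>2"
      using large[of "k + M"] by (intro power_mono) auto
    also have "\<dots> = (4 ^ n * (1 / 4) ^ M) * (1 / 4) ^ k"
      by (simp add: power_divide power_add power2_eq_square four)
    finally show "(cmod (taylor_coeff ?d (k + M)))\<^sup>2 \<le> (4 ^ n * (1 / 4) ^ M) * (1 / 4) ^ k" .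
  qed
  also have "(\<Sum>k. (4 ^ n * (1 / 4) ^ M) * (1 / 4 :: real) ^ k) = (4 ^ n * 4 / 3) * (1 / 4) ^ M"
    by (simp add: suminf_mult summable_geometric suminf_geometric)
  finally have "(h2_norm ?d)\<^sup>2 \<le> (4 ^ n * 4 / 3) * (1 / 4) ^ M" by simp
  with g show ?thesis by (rule that)
qed

lemma szego_dense:
  assumes "f \<in> H2"
  shows "f \<in> hclspan (szego ` ball 0 1)"
proof -
  let ?X = "szego ` ball 0 1"
  have X: "?X \<subseteq> H2" by (rule szego_subset_H2) simp
  have mono: "(\<lambda>z. z ^ n) \<in> hclspan ?X" for n
    unfolding hclspan_def mem_Collect_eq
  proof (intro conjI allI impI)
    show "(\<lambda>z. z ^ n) \<in> H2" by (rule monomial_H2)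
    fix e :: real assume e: "e > 0"
    have "(\<lambda>M. (4 ^ n * 4 / 3) * (1 / 4 :: real) ^ M) \<longlonglongrightarrow> (4 ^ n * 4 / 3) * 0"
      by (intro tendsto_mult tendsto_const LIMSEQ_power_zero) auto
    then have "\<exists>N. \<forall>M\<ge>N. norm ((4 ^ n * 4 / 3) * (1 / 4 :: real) ^ M - (4 ^ n * 4 / 3) * 0) < e\<^sup>2"
      by (rule LIMSEQ_D) (use e in simp)
    then obtain N where N: "\<And>M. M \<ge> N \<Longrightarrow> (4 ^ n * 4 / 3) * (1 / 4 :: real) ^ M < e\<^sup>2" by auto
    obtain g where g: "g \<in> hspan ?X"
      "(h2_norm (\<lambda>z. z ^ n - g z))\<^sup>2 \<le> (4 ^ n * 4 / 3) * (1 / 4) ^ (max N (Suc n))"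
      by (rule monomial_approx_szego[of n "max N (Suc n)"]) auto
    have "(h2_norm (\<lambda>z. z ^ n - g z))\<^sup>2 < e\<^sup>2"
      by (rule order.strict_trans1[OF g(2) N]) simp
    then have "h2_norm (\<lambda>z. z ^ n - g z) < e" by (rule power2_less_imp_less) (use e in simp)
    then show "\<exists>g\<in>hspan ?X. h2_norm (\<lambda>z. z ^ n - g z) < e" using g(1) by (intro bexI)
  qed
  show ?thesis
  proof (rule hclspan_closed[OF X assms])
    fix e :: real assume e: "e > 0"
    let ?p = "\<lambda>K z. \<Sum>k<K. taylor_coeff f k * z ^ k"
    obtain K where K: "h2_norm (\<lambda>z. f z - ?p K z) < e"
      by (rule polynomial_approx[OF assms e])
    have "?p K \<in> hspan (range (\<lambda>n z. z ^ n))" by (rule hspan_sum) auto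
    then have "?p K \<in> hclspan ?X" by (rule hspan_hclspan[OF X, rotated]) (use mono in auto)
    then show "\<exists>g\<in>hclspan ?X. h2_norm (\<lambda>z. f z - g z) < e" using K by (intro bexI)
  qed
qed

text \<open>Partial fractions: for distinct l and w the two denominators are not proportional, so
  the product splits into simple fractions.\<close>

lemma blaschke_factor_mult_szego:
  assumes "l \<in> ball 0 1" "w \<in> ball 0 1" "w \<noteq> l"
  obtains \<alpha> \<beta> where "\<And>z. z \<in> ball 0 1 \<Longrightarrow> blaschke_factor l z * szego w z = \<alpha> * szego l z + \<beta> * szego w z"
proof -
  obtain u where u: "\<And>z. blaschke_factor l z = u * ((l - z) / (1 - cnj l * z))"
    using blaschke_factor_unimodular[of l] by blast
  \<comment> \<open>Comparing constant terms and coefficients of z in the numerator gives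
    \<open>\<alpha> + \<beta> = l\<close> and \<open>\<alpha> * cnj w + \<beta> * cnj l = 1\<close>;
    these are the solutions.\<close>
  define \<alpha> where "\<alpha> = (1 - cnj l * l) / (cnj w - cnj l)"
  define \<beta> where "\<beta> = l - \<alpha>"
  have nz: "cnj w - cnj l \<noteq> 0" using assms(3) by simp
  have 2: "\<alpha> * (cnj w - cnj l) = 1 - cnj l * l" unfolding \<alpha>_def using nz by simp
  show ?thesis
  proof (rule that[of "u * \<alpha>" "u * \<beta>"])
    fix z :: complex assume z: "z \<in> ball 0 1"
    note d = one_minus_cnj_mult_nonzero[OF assms(1) z] one_minus_cnj_mult_nonzero[OF assms(2) z]
    have "\<alpha> * (1 - cnj w * z) + \<beta> * (1 - cnj l * z) = l - cnj l * l * z - (\<alpha> * (cnj w - cnj l)) * z"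
      unfolding \<beta>_def by (simp add: algebra_simps)
    also have "\<dots> = l - z" unfolding 2 by (simp add: algebra_simps)
    finally have key: "\<alpha> * (1 - cnj w * z) + \<beta> * (1 - cnj l * z) = l - z" .
    have "blaschke_factor l z * szego w z
      = u * ((\<alpha> * (1 - cnj w * z) + \<beta> * (1 - cnj l * z)) / (1 - cnj l * z)) * (1 / (1 - cnj w * z))"
      unfolding key by (simp add: u szego_def)
    also have "\<dots> = u * \<alpha> * szego l z + u * \<beta> * szego w z"
      using d by (simp add: szego_def field_simps)
    finally show "blaschke_factor l z * szego w z = u * \<alpha> * szego l z + u * \<beta> * szego w z" .
  qed
qed

text \<open>The point l must be new: multiplying \<open>szego l\<close> by its own Blaschke factor
  squares the denominator, which takes the product out of reach of the partial fractions.\<close>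

lemma blaschke_factor_mult_hspan:
  assumes "l \<in> ball 0 1" "S \<subseteq> ball 0 1" "l \<notin> S" "g \<in> hspan (szego ` S)"
  shows "\<exists>h\<in>hspan (szego ` insert l S). \<forall>z\<in>ball 0 1. blaschke_factor l z * g z = h z"
  using assms(4)
proof induction
  case zero
  show ?case by (intro bexI[OF _ hspan.zero]) simp
next
  case (step f x c)
  then obtain w where w: "w \<in> S" "x = szego w" by auto
  obtain h where h: "h \<in> hspan (szego ` insert l S)" "\<And>z. z \<in> ball 0 1 \<Longrightarrow> blaschke_factor l z * f z = h z"
    using step.IH by blast
  obtain \<alpha> \<beta> where ab: "\<And>z. z \<in> ball 0 1 \<Longrightarrow> blaschke_factor l z * szego w z = \<alpha> * szego l z + \<beta> * szego w z"
    using blaschke_factor_mult_szego[OF assms(1), of w] w assms(2,3) by blast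
  have "(\<lambda>z. (h z + (c * \<alpha>) * szego l z) + (c * \<beta>) * szego w z) \<in> hspan (szego ` insert l S)"
    using h(1) w(1) by (intro hspan.step) auto
  moreover have "blaschke_factor l z * (f z + c * x z) = (h z + (c * \<alpha>) * szego l z) + (c * \<beta>) * szego w z"
    if z: "z \<in> ball 0 1" for z
  proof -
    have "blaschke_factor l z * (f z + c * x z) = blaschke_factor l z * f z + c * (blaschke_factor l z * szego w z)"
      unfolding w(2) by (simp add: algebra_simps)
    then show ?thesis unfolding h(2)[OF z] ab[OF z] by (simp add: algebra_simps)
  qed
  ultimately show ?case by (intro bexI[of _ "\<lambda>z. (h z + (c * \<alpha>) * szego l z) + (c * \<beta>) * szego w z"] ballI)
qed

lemma partial_product_mult_szego:
  fixes a :: "nat \<Rightarrow> complex"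
  assumes "\<And>n. a n \<in> ball 0 1" "inj a" "finite F" "n \<notin> F"
  shows "\<exists>h\<in>hspan (szego ` range a). \<forall>z\<in>ball 0 1. (\<Prod>k\<in>F. blaschke_factor (a k) z) * szego (a n) z = h z"
proof -
  have "\<exists>h\<in>hspan (szego ` insert (a n) (a ` F)). \<forall>z\<in>ball 0 1. (\<Prod>k\<in>F. blaschke_factor (a k) z) * szego (a n) z = h z"
    using assms(3,4)
  proof (induction F rule: finite_induct)
    case empty
    show ?case by (intro bexI[of _ "szego (a n)"] hspan_base) auto
  next
    case (insert m F)
    then obtain h where h: "h \<in> hspan (szego ` insert (a n) (a ` F))"
      "\<And>z. z \<in> ball 0 1 \<Longrightarrow> (\<Prod>k\<in>F. blaschke_factor (a k) z) * szego (a n) z = h z" by blast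
    have "a m \<notin> insert (a n) (a ` F)" using insert.prems insert.hyps injD[OF assms(2)] by auto
    from blaschke_factor_mult_hspan[OF assms(1) _ this h(1)] assms(1)
    obtain h' where h': "h' \<in> hspan (szego ` insert (a m) (insert (a n) (a ` F)))"
      "\<And>z. z \<in> ball 0 1 \<Longrightarrow> blaschke_factor (a m) z * h z = h' z" by blast
    have "(\<Prod>k\<in>insert m F. blaschke_factor (a k) z) * szego (a n) z = h' z" if z: "z \<in> ball 0 1" for z
      using insert.hyps by (simp add: h(2)[OF z, symmetric] h'(2)[OF z, symmetric] mult.assoc)
    moreover have "insert (a m) (insert (a n) (a ` F)) = insert (a n) (a ` insert m F)" by auto
    ultimately show ?case using h'(1) by metis
  qed
  moreover have "hspan (szego ` insert (a n) (a ` F)) \<subseteq> hspan (szego ` range a)"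
    by (intro hspan_mono image_mono) auto
  ultimately show ?thesis by blast
qed

text \<open>The model space of a single Blaschke factor is one-dimensional, spanned by the Szego
  kernel at its zero.\<close>

lemma blaschke_factor_kernel:
  assumes "l \<in> ball 0 1" "w \<in> ball 0 1" "z \<in> ball 0 1"
  shows "model_kernel (blaschke_factor l) w z = (1 - cnj l * l) / (1 - l * cnj w) * szego l z"
proof -
  obtain u where u: "cmod u = 1" "\<And>z. blaschke_factor l z = u * ((l - z) / (1 - cnj l * z))"
    using blaschke_factor_unimodular[of l] by blast
  have uu: "cnj u * u = 1" using u(1) complex_norm_square[of u] by (simp add: mult.commute)
  have nz: "1 - cnj l * z \<noteq> 0" "1 - cnj w * z \<noteq> 0" "1 - l * cnj w \<noteq> 0"
    using one_minus_cnj_mult_nonzero[OF assms(1,3)] one_minus_cnj_mult_nonzero[OF assms(2,3)]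
      one_minus_cnj_mult_nonzero[OF assms(2,1)] by (auto simp: mult.commute)
  have "cnj (blaschke_factor l w) * blaschke_factor l z
    = (cnj u * u) * ((cnj l - cnj w) * (l - z) / ((1 - l * cnj w) * (1 - cnj l * z)))"
    unfolding u(2) by (simp add: mult_ac)
  also have "\<dots> = (cnj l - cnj w) * (l - z) / ((1 - l * cnj w) * (1 - cnj l * z))" unfolding uu by simp
  finally have e: "cnj (blaschke_factor l w) * blaschke_factor l z
    = (cnj l - cnj w) * (l - z) / ((1 - l * cnj w) * (1 - cnj l * z))" .
  have "1 - (cnj l - cnj w) * (l - z) / ((1 - l * cnj w) * (1 - cnj l * z))
    = (1 - cnj l * l) * (1 - cnj w * z) / ((1 - l * cnj w) * (1 - cnj l * z))"
    using nz by (simp add: divide_simps) (simp add: algebra_simps)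
  then show ?thesis unfolding model_kernel_def e szego_def using nz by simp
qed

text \<open>Adding a factor b to P changes the kernel by conj(P(w)) P(z) times the kernel of b, the
  kernel form of the decomposition of K_{Pb} into K_P and P K_b. The new term is P times a Szego
  kernel, which partial fractions reduce to the kernels at the zeros.\<close>

lemma partial_product_kernel:
  fixes a :: "nat \<Rightarrow> complex"
  assumes "\<And>n. a n \<in> ball 0 1" "inj a" "w \<in> ball 0 1"
  shows "\<exists>h\<in>hspan (szego ` range a). \<forall>z\<in>ball 0 1. model_kernel (\<lambda>z. \<Prod>k<N. blaschke_factor (a k) z) w z = h z"
proof (induction N)
  case 0
  show ?case by (intro bexI[OF _ hspan.zero]) (simp add: model_kernel_def)
next
  case (Suc N)
  let ?P = "\<lambda>N z. \<Prod>k<N. blaschke_factor (a k) z"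
  obtain h where h: "h \<in> hspan (szego ` range a)" "\<And>z. z \<in> ball 0 1 \<Longrightarrow> model_kernel (?P N) w z = h z"
    using Suc by blast
  obtain g where g: "g \<in> hspan (szego ` range a)" "\<And>z. z \<in> ball 0 1 \<Longrightarrow> ?P N z * szego (a N) z = g z"
    using partial_product_mult_szego[OF assms(1,2), of "{..<N}" N] by auto
  define c where "c = cnj (?P N w) * ((1 - cnj (a N) * a N) / (1 - a N * cnj w))"
  have "model_kernel (?P (Suc N)) w z = h z + c * g z" if z: "z \<in> ball 0 1" for z
  proof -
    have "model_kernel (?P (Suc N)) w z
      = model_kernel (?P N) w z + cnj (?P N w) * (?P N z * model_kernel (blaschke_factor (a N)) w z)"
      by (simp add: model_kernel_eq algebra_simps del: cnj_prod)
    then show ?thesis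
      unfolding h(2)[OF z] blaschke_factor_kernel[OF assms(1) assms(3) z] g(2)[OF z, symmetric] c_def
      by (simp add: algebra_simps del: cnj_prod)
  qed
  with hspan_add_cmult[OF h(1) g(1), of c] show ?case
    by (intro bexI[of _ "\<lambda>z. h z + c * g z"] ballI)
qed

lemma model_kernel_blaschke_hclspan:
  assumes a: "blaschke_sequence a" "inj a" and w: "w \<in> ball 0 1"
  shows "model_kernel (blaschke a) w \<in> hclspan (szego ` range a)"
proof -
  have ab: "a n \<in> ball 0 1" for n using a(1) by (simp add: blaschke_sequence_def)
  have X: "szego ` range a \<subseteq> H2" using ab by (intro szego_subset_H2) auto
  let ?A = "blaschke a" and ?P = "\<lambda>N z. \<Prod>k<N. blaschke_factor (a k) z"
  let ?s = "szego w"
  note s = H2_szego[OF w]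
  note IA = inner_function_blaschke[OF a(1)]
  note IP = inner_function_partial_product[of a, OF ab]
  note kA = model_space_H2[OF model_kernel_in_model_space[OF IA w]]
  define d where "d N = h2_norm (\<lambda>z. ?P N z * ?s z - ?A z * ?s z)" for N
  have d0: "d \<longlonglongrightarrow> 0" unfolding d_def
    by (rule blaschke_multiplier_limit[OF a(1) s szego_bound[OF w]])
  define d' where "d' N = d N + cmod (?P N w - ?A w) * h2_norm ?s" for N
  have "d' \<longlonglongrightarrow> 0 + cmod (?A w - ?A w) * h2_norm ?s" unfolding d'_def
    by (intro tendsto_intros d0 blaschke_limit(3) a w)
  then have d'0: "d' \<longlonglongrightarrow> 0" by simp
  have bound: "h2_norm (\<lambda>z. model_kernel ?A w z - model_kernel (?P N) w z) \<le> d' N" for N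
  proof -
    \<comment> \<open>Separates the error of the product as a multiplier from the error of its value
      at w; both vanish in the limit.\<close>
    have "(\<lambda>z. model_kernel ?A w z - model_kernel (?P N) w z)
      = (\<lambda>z. cnj (?P N w) * (?P N z * ?s z - ?A z * ?s z) + cnj (?P N w - ?A w) * (?A z * ?s z))"
      by (rule ext) (simp add: model_kernel_eq algebra_simps del: cnj_prod)
    then have "h2_norm (\<lambda>z. model_kernel ?A w z - model_kernel (?P N) w z)
      = h2_norm (\<lambda>z. cnj (?P N w) * (?P N z * ?s z - ?A z * ?s z) + cnj (?P N w - ?A w) * (?A z * ?s z))"
      by (rule arg_cong)
    also have "\<dots> \<le> h2_norm (\<lambda>z. cnj (?P N w) * (?P N z * ?s z - ?A z * ?s z))
      + h2_norm (\<lambda>z. cnj (?P N w - ?A w) * (?A z * ?s z))"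
      by (intro h2_norm_triangle H2_cmult H2_diff inner_function_H2[OF IA s] inner_function_H2[OF IP s])
    also have "h2_norm (\<lambda>z. cnj (?P N w) * (?P N z * ?s z - ?A z * ?s z)) = cmod (?P N w) * d N"
      unfolding d_def h2_norm_cmult[OF H2_diff[OF inner_function_H2[OF IP s] inner_function_H2[OF IA s]]]
        complex_mod_cnj ..
    also have "h2_norm (\<lambda>z. cnj (?P N w - ?A w) * (?A z * ?s z)) = cmod (?P N w - ?A w) * h2_norm ?s"
      unfolding h2_norm_cmult[OF inner_function_H2[OF IA s]] inner_function_norm[OF IA s]
        complex_mod_cnj ..
    also have "cmod (?P N w) * d N \<le> d N"
    proof (rule mult_left_le_one_le)
      show "0 \<le> d N" unfolding d_def
        by (intro h2_norm_nonneg H2_diff inner_function_H2[OF IA s] inner_function_H2[OF IP s])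
      show "cmod (?P N w) \<le> 1" using IP w unfolding inner_function_def by blast
    qed simp
    finally show ?thesis unfolding d'_def by simp
  qed
  show ?thesis
  proof (rule hclspan_closed[OF X kA])
    fix e :: real assume e: "e > 0"
    from LIMSEQ_D[OF d'0 e] obtain N where N: "norm (d' N - 0) < e" by blast
    obtain h where h: "h \<in> hspan (szego ` range a)"
      "\<And>z. z \<in> ball 0 1 \<Longrightarrow> model_kernel (?P N) w z = h z"
      using partial_product_kernel[OF ab a(2) w, of N] by blast
    have "model_kernel (?P N) w \<in> hclspan (szego ` range a)"
      by (rule hclspan_if_eq_on_ball[OF X h])
    moreover have "h2_norm (\<lambda>z. model_kernel ?A w z - model_kernel (?P N) w z) < e"
      using bound[of N] N by simp
    ultimately show "\<exists>g\<in>hclspan (szego ` range a). h2_norm (\<lambda>z. model_kernel ?A w z - g z) < e" by blast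
  qed
qed

text \<open>Supplies projections where they are needed: replacing each Szego kernel of a combination
  by the model kernel at the same point projects the combination.\<close>

lemma szego_hspan_proj:
  assumes "inner_function \<theta>" "S \<subseteq> ball 0 1" "G \<in> hspan (szego ` S)"
  shows "\<exists>P\<in>hspan (model_kernel \<theta> ` S). model_proj \<theta> G P"
  using assms(3)
proof induction
  case zero
  show ?case by (intro bexI[OF _ hspan.zero] model_proj_zero assms)
next
  case (step G x c)
  then obtain P w where P: "P \<in> hspan (model_kernel \<theta> ` S)" "model_proj \<theta> G P" and w: "w \<in> S" "x = szego w"
    by blast
  have wb: "w \<in> ball 0 1" using w(1) assms(2) by blast
  have "model_proj \<theta> (\<lambda>z. G z + c * x z) (\<lambda>z. P z + c * model_kernel \<theta> w z)"
    unfolding w(2) by (rule model_proj_add_cmult[OF assms(1) P(2) model_proj_szego[OF assms(1) wb]])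
  moreover have "(\<lambda>z. P z + c * model_kernel \<theta> w z) \<in> hspan (model_kernel \<theta> ` S)"
    using w(1) by (intro hspan.step[OF P(1)]) auto
  ultimately show ?case by blast
qed

text \<open>Approximate f by Szego kernels at arbitrary points of the disc and project. Since f
  already lies in the model space the projection does not increase the error, and it yields model
  kernels, which are limits of combinations of kernels at the zeros.\<close>

theorem szego_complete_in_model_space:
  assumes a: "blaschke_sequence a" "inj a" and f: "f \<in> model_space (blaschke a)"
  shows "f \<in> hclspan (szego ` range a)"
proof -
  have ab: "a n \<in> ball 0 1" for n using a(1) by (simp add: blaschke_sequence_def)
  have X: "szego ` range a \<subseteq> H2" using ab by (intro szego_subset_H2) auto
  note IA = inner_function_blaschke[OF a(1)]
  show ?thesis
  proof (rule hclspan_closed[OF X model_space_H2[OF f]])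
    fix e :: real assume e: "e > 0"
    obtain G where G: "G \<in> hspan (szego ` ball 0 1)" "h2_norm (\<lambda>z. f z - G z) < e"
      using szego_dense[OF model_space_H2[OF f]] e unfolding hclspan_def by blast
    obtain P where P: "P \<in> hspan (model_kernel (blaschke a) ` ball 0 1)" "model_proj (blaschke a) G P"
      using szego_hspan_proj[OF IA order.refl G(1)] by blast
    have "P \<in> hclspan (szego ` range a)"
      by (rule hspan_hclspan[OF X _ P(1)]) (use model_kernel_blaschke_hclspan[OF a] in blast)
    moreover have "h2_norm (\<lambda>z. f z - P z) < e"
      by (rule order.strict_trans1[OF model_proj_dist[OF IA P(2) f] G(2)])
    ultimately show "\<exists>g\<in>hclspan (szego ` range a). h2_norm (\<lambda>z. f z - g z) < e" by blast
  qed
qed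

section \<open>Carleson sequences\<close>

lemma pseudo_hyp_commute: "pseudo_hyp a z = pseudo_hyp z a"
proof -
  have "cmod (1 - cnj a * z) = cmod (1 - cnj z * a)"
    using complex_mod_cnj[of "1 - cnj a * z"] by (simp add: mult.commute del: complex_mod_cnj)
  then show ?thesis by (simp add: pseudo_hyp_def norm_divide norm_minus_commute)
qed

locale carleson_sequence =
  fixes a :: "nat \<Rightarrow> complex" and \<delta> :: real
  assumes in_disc: "\<And>n. a n \<in> ball 0 1" and \<delta>_pos: "\<delta> > 0"
    and product_ge: "\<And>n N. (\<Prod>m\<in>{..<N} - {n}. pseudo_hyp (a m) (a n)) \<ge> \<delta>"
begin

lemma pseudo_hyp_pos: "m \<noteq> n \<Longrightarrow> pseudo_hyp (a m) (a n) > 0"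
proof (rule ccontr)
  assume mn: "m \<noteq> n" and "\<not> pseudo_hyp (a m) (a n) > 0"
  then have "pseudo_hyp (a m) (a n) = 0" using pseudo_hyp_nonneg[of "a m" "a n"] by linarith
  then have "(\<Prod>k\<in>{..<Suc m} - {n}. pseudo_hyp (a k) (a n)) = 0"
    using mn by (intro prod_zero) auto
  then show False using product_ge[where n = n and N = "Suc m"] \<delta>_pos by linarith
qed

lemma inj: "inj a"
proof (rule injI, rule ccontr)
  fix m n assume "a m = a n" "m \<noteq> n"
  then show False using pseudo_hyp_pos[of m n] by (simp add: pseudo_hyp_def)
qed

text \<open>Taking logarithms in the Carleson product with 1 - x <= -ln x for x = rho^2 bounds the
  off-diagonal sum by \<open>- 2 * ln \<delta>\<close>; the additional 1 pays for the diagonal term,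
  where rho = 0.\<close>

definition C0 :: real where "C0 = 1 - 2 * ln \<delta>"

lemma sum_one_minus_pseudo_hyp: "(\<Sum>m<N. 1 - (pseudo_hyp (a m) (a n))\<^sup>2) \<le> C0"
proof -
  let ?\<rho> = "\<lambda>m. pseudo_hyp (a m) (a n)"
  have "(\<Sum>m\<in>{..<N} - {n}. 1 - (?\<rho> m)\<^sup>2) \<le> (\<Sum>m\<in>{..<N} - {n}. - 2 * ln (?\<rho> m))"
  proof (rule sum_mono)
    fix m assume "m \<in> {..<N} - {n}"
    then have p: "?\<rho> m > 0" by (intro pseudo_hyp_pos) auto
    then have "ln ((?\<rho> m)\<^sup>2) \<le> (?\<rho> m)\<^sup>2 - 1" by (intro ln_le_minus_one) simp
    moreover have "ln ((?\<rho> m)\<^sup>2) = 2 * ln (?\<rho> m)" using p by (simp add: ln_realpow)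
    ultimately show "1 - (?\<rho> m)\<^sup>2 \<le> - 2 * ln (?\<rho> m)" by linarith
  qed
  also have "\<dots> = - 2 * ln (\<Prod>m\<in>{..<N} - {n}. ?\<rho> m)"
    by (subst ln_prod) (auto simp: sum_distrib_left dest: pseudo_hyp_pos)
  also have "\<dots> \<le> - 2 * ln \<delta>"
    using ln_mono[OF product_ge[where n = n and N = N] \<delta>_pos] by simp
  finally have 1: "(\<Sum>m\<in>{..<N} - {n}. 1 - (?\<rho> m)\<^sup>2) \<le> - 2 * ln \<delta>" .
  have "(\<Sum>m<N. 1 - (?\<rho> m)\<^sup>2) \<le> 1 + (\<Sum>m\<in>{..<N} - {n}. 1 - (?\<rho> m)\<^sup>2)"
  proof (cases "n < N")
    case True
    then have "(\<Sum>m<N. 1 - (?\<rho> m)\<^sup>2) = (1 - (?\<rho> n)\<^sup>2) + (\<Sum>m\<in>{..<N} - {n}. 1 - (?\<rho> m)\<^sup>2)"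
      by (intro sum.remove) auto
    then show ?thesis by simp
  qed simp
  then show ?thesis using 1 by (simp add: C0_def)
qed

text \<open>Use the sum bound at the single point \<open>a 0\<close>: in the Schwarz-Pick identity
  the denominator is at most 4, so each term dominates 1 - |a_m| times (1 - |a_0|^2) / 4.\<close>

lemma blaschke_sequence: "blaschke_sequence a"
  unfolding blaschke_sequence_def
proof (intro conjI allI in_disc summableI_nonneg_bounded)
  show "0 \<le> 1 - cmod (a n)" for n using in_disc[of n] by simp
  fix N
  let ?t = "1 - (cmod (a 0))\<^sup>2"
  have t: "?t > 0" by (rule one_minus_cmod_power2_pos[OF in_disc])
  have "(\<Sum>m<N. (1 - cmod (a m)) * (?t / 4)) \<le> (\<Sum>m<N. 1 - (pseudo_hyp (a m) (a 0))\<^sup>2)"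
  proof (rule sum_mono)
    fix m
    have "1 - cmod (a m) \<le> 1 - (cmod (a m))\<^sup>2"
      using in_disc[of m] by (simp add: power2_eq_square mult_left_le)
    moreover have "?t / 4 \<le> ?t / (cmod (1 - cnj (a m) * a 0))\<^sup>2"
    proof (rule divide_left_mono)
      have "cmod (1 - cnj (a m) * a 0) \<le> 2"
        using norm_triangle_ineq4[of 1 "cnj (a m) * a 0"] cmod_cnj_mult_less_1[OF in_disc[of m] in_disc[of 0]]
        by simp
      then have "(cmod (1 - cnj (a m) * a 0))\<^sup>2 \<le> 2\<^sup>2" by (intro power_mono) auto
      then show "(cmod (1 - cnj (a m) * a 0))\<^sup>2 \<le> 4" by simp
      show "0 < 4 * (cmod (1 - cnj (a m) * a 0))\<^sup>2"
        using one_minus_cnj_mult_nonzero[OF in_disc[of m] in_disc[of 0]] by simp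
    qed (use t in simp)
    ultimately have "(1 - cmod (a m)) * (?t / 4) \<le> (1 - (cmod (a m))\<^sup>2) * (?t / (cmod (1 - cnj (a m) * a 0))\<^sup>2)"
      using t one_minus_cmod_power2_pos[OF in_disc[of m]] by (intro mult_mono) auto
    then show "(1 - cmod (a m)) * (?t / 4) \<le> 1 - (pseudo_hyp (a m) (a 0))\<^sup>2"
      unfolding one_minus_pseudo_hyp_power2[OF in_disc in_disc] by simp
  qed
  also have "\<dots> \<le> C0" by (rule sum_one_minus_pseudo_hyp)
  finally have "(\<Sum>m<N. 1 - cmod (a m)) * (?t / 4) \<le> C0" unfolding sum_distrib_right .
  then show "(\<Sum>m<N. 1 - cmod (a m)) \<le> C0 / (?t / 4)"
    using t by (subst pos_le_divide_eq) auto
qed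

end

text \<open>With S listed by decreasing r, the left-hand side is a lower Riemann sum of e^(-t) on
  the interval from 0 to the sum of all x. Ties in r only enlarge the exponents and so lower the
  sum.\<close>

lemma sum_mult_exp_tail_le:
  fixes x r :: "'a \<Rightarrow> real"
  assumes "finite S" "\<And>n. n \<in> S \<Longrightarrow> 0 \<le> x n"
  shows "(\<Sum>n\<in>S. x n * exp (- (\<Sum>m\<in>{m\<in>S. r m \<ge> r n}. x m))) \<le> 1 - exp (- (\<Sum>n\<in>S. x n))"
  using assms
proof (induction "card S" arbitrary: S)
  case 0
  then show ?case by simp
next
  case (Suc k)
  then have "S \<noteq> {}" by auto
  \<comment> \<open>For a minimal r the tail is all of S, so this term carries the full exponent,
    and removing it cannot enlarge any other tail. The induction step then reduces to x e^(-x) <= 1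
    - e^(-x).\<close>
  define n0 where "n0 = arg_min_on r S"
  have n0: "n0 \<in> S" "\<And>m. m \<in> S \<Longrightarrow> r n0 \<le> r m"
    unfolding n0_def using arg_min_if_finite(1)[OF Suc.prems(1) \<open>S \<noteq> {}\<close>, of r]
      arg_min_least[OF Suc.prems(1) \<open>S \<noteq> {}\<close>, of _ r] by auto
  let ?S = "S - {n0}"
  let ?X = "\<Sum>n\<in>?S. x n"
  have fin: "finite ?S" using Suc.prems(1) by simp
  have card: "k = card ?S" using Suc.hyps(2) n0(1) Suc.prems(1) by simp
  have split: "(\<Sum>n\<in>S. f n) = f n0 + (\<Sum>n\<in>?S. f n)" for f :: "'a \<Rightarrow> real"
    by (rule sum.remove[OF Suc.prems(1) n0(1)])
  have S0: "{m \<in> S. r m \<ge> r n0} = S" using n0(2) by auto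
  have "(\<Sum>n\<in>?S. x n * exp (- (\<Sum>m\<in>{m\<in>S. r m \<ge> r n}. x m)))
    \<le> (\<Sum>n\<in>?S. x n * exp (- (\<Sum>m\<in>{m\<in>?S. r m \<ge> r n}. x m)))"
  proof (rule sum_mono)
    fix n assume n: "n \<in> ?S"
    have "(\<Sum>m\<in>{m\<in>?S. r m \<ge> r n}. x m) \<le> (\<Sum>m\<in>{m\<in>S. r m \<ge> r n}. x m)"
      using Suc.prems by (intro sum_mono2) auto
    then show "x n * exp (- (\<Sum>m\<in>{m\<in>S. r m \<ge> r n}. x m))
      \<le> x n * exp (- (\<Sum>m\<in>{m\<in>?S. r m \<ge> r n}. x m))"
      using n Suc.prems by (intro mult_left_mono) auto
  qed
  also have "\<dots> \<le> 1 - exp (- ?X)"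
    using Suc.hyps(1)[OF card fin] Suc.prems(2) by simp
  finally have 1: "(\<Sum>n\<in>?S. x n * exp (- (\<Sum>m\<in>{m\<in>S. r m \<ge> r n}. x m))) \<le> 1 - exp (- ?X)" .
  have "1 + x n0 \<le> exp (x n0)" by (rule exp_ge_add_one_self)
  then have "(1 + x n0) * exp (- x n0) \<le> exp (x n0) * exp (- x n0)"
    by (intro mult_right_mono) auto
  then have "x n0 * exp (- x n0) \<le> 1 - exp (- x n0)"
    by (simp add: algebra_simps flip: exp_add)
  then have "x n0 * exp (- x n0) * exp (- ?X) \<le> (1 - exp (- x n0)) * exp (- ?X)"
    by (intro mult_right_mono) auto
  moreover have "exp (- (x n0 + ?X)) = exp (- x n0) * exp (- ?X)" by (simp flip: exp_add)
  ultimately have 2: "x n0 * exp (- (x n0 + ?X)) \<le> exp (- ?X) - exp (- (x n0 + ?X))"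
    by (simp add: algebra_simps)
  show ?case
    unfolding split[of "\<lambda>n. x n * exp (- (\<Sum>m\<in>{m\<in>S. r m \<ge> r n}. x m))"] S0 split[of x]
    using 1 2 by linarith
qed

text \<open>With u = conj(a) z this is a Poisson-type kernel; it makes the exponents of the
  interpolating functions have positive real part of known size.\<close>

lemma Re_cayley:
  assumes "u \<noteq> 1"
  shows "Re ((1 + u) / (1 - u)) = (1 - (cmod u)\<^sup>2) / (cmod (1 - u))\<^sup>2"
proof -
  have "(1 + u) / (1 - u) = ((1 + u) * cnj (1 - u)) / of_real ((cmod (1 - u))\<^sup>2)"
    using assms unfolding complex_norm_square by simp
  also have "Re \<dots> = Re ((1 + u) * cnj (1 - u)) / (cmod (1 - u))\<^sup>2"
    by (rule Re_divide_of_real)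
  also have "Re ((1 + u) * cnj (1 - u)) = 1 - (cmod u)\<^sup>2"
    by (simp add: algebra_simps cmod_def power2_eq_square)
  finally show ?thesis .
qed


context carleson_sequence
begin

text \<open>P. Jones' interpolating functions: the exponential factor makes the sum of their moduli
  bounded, by the telescoping estimate above.\<close>

lemma interpolating_functions:
  obtains F where "\<And>n. n < N \<Longrightarrow> F n holomorphic_on ball 0 1"
    "\<And>m n. m < N \<Longrightarrow> n < N \<Longrightarrow> F n (a m) = (if m = n then 1 else 0)"
    "\<And>z. z \<in> ball 0 1 \<Longrightarrow> (\<Sum>n<N. cmod (F n z)) \<le> exp (2 * C0) / \<delta>"
proof -
  define t where "t n = 1 - (cmod (a n))\<^sup>2" for n
  have t: "t n > 0" for n unfolding t_def by (rule one_minus_cmod_power2_pos[OF in_disc])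
  \<comment> \<open>The exponent for index n collects only points at least as far out as
    \<open>a n\<close>. This keeps its real part bounded at \<open>a n\<close> and gives the tail
    sums the ordering that the telescoping estimate expects.\<close>
  define J where "J n = {m \<in> {..<N}. cmod (a m) \<ge> cmod (a n)}" for n
  define q where "q m z = of_real (t m) * ((1 + cnj (a m) * z) / (1 - cnj (a m) * z))" for m z
  define Q where "Q n z = (\<Sum>m\<in>J n. q m z)" for n z
  define B where "B n z = (\<Prod>m\<in>{..<N} - {n}. blaschke_factor (a m) z)" for n z
  define x where "x n z = (t n)\<^sup>2 / (cmod (1 - cnj (a n) * z))\<^sup>2" for n z
  \<comment> \<open>Each of the three factors equals 1 at \<open>a n\<close>. The Blaschke quotient
    produces the zeros at the other nodes, the squared kernel has modulus \<open>x n z\<close>, and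
    the exponential supplies the decay that makes the moduli summable.\<close>
  define F where "F n z = B n z / B n (a n) * (of_real (t n) * szego (a n) z)\<^sup>2 * exp (Q n (a n) - Q n z)" for n z
  have cB: "cmod (B n z) = (\<Prod>m\<in>{..<N} - {n}. pseudo_hyp (a m) z)" for n z
    unfolding B_def by (simp add: prod_norm[symmetric] cmod_blaschke_factor)
  have Bn: "cmod (B n (a n)) \<ge> \<delta>" for n unfolding cB by (rule product_ge)
  have Bnz: "B n (a n) \<noteq> 0" for n using Bn[of n] \<delta>_pos by auto
  have B1: "cmod (B n z) \<le> 1" if "z \<in> ball 0 1" for n z unfolding cB
    by (intro prod_le_1 conjI pseudo_hyp_nonneg less_imp_le[OF pseudo_hyp_less_1] in_disc that)
  have Bhol: "B n holomorphic_on ball 0 1" for n unfolding B_def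
    by (intro holomorphic_on_prod blaschke_factor_holomorphic in_disc)
  have qhol: "q m holomorphic_on ball 0 1" for m unfolding q_def
    using one_minus_cnj_mult_nonzero[OF in_disc] by (auto intro!: holomorphic_intros)
  have Qhol: "Q n holomorphic_on ball 0 1" for n unfolding Q_def
    by (intro holomorphic_on_sum qhol)
  have Req: "Re (q m z) = t m * (1 - (cmod (a m))\<^sup>2 * (cmod z)\<^sup>2) / (cmod (1 - cnj (a m) * z))\<^sup>2"
    if "z \<in> ball 0 1" for m z
  proof -
    have "cnj (a m) * z \<noteq> 1" using one_minus_cnj_mult_nonzero[OF in_disc that, of m] by auto
    note C = Re_cayley[OF this]
    have R: "Re (of_real r * w) = r * Re w" for r w by simp
    show ?thesis
      unfolding q_def R C by (simp add: norm_mult power_mult_distrib)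
  qed
  have lower: "x m z \<le> Re (q m z)" if z: "z \<in> ball 0 1" for m z
  proof -
    have "(cmod (a m))\<^sup>2 * (cmod z)\<^sup>2 \<le> (cmod (a m))\<^sup>2 * 1"
      using z by (intro mult_left_mono) (auto intro!: power_le_one)
    then have "t m * t m \<le> t m * (1 - (cmod (a m))\<^sup>2 * (cmod z)\<^sup>2)"
      using t[of m] by (intro mult_left_mono) (auto simp: t_def)
    then show ?thesis unfolding Req[OF z] x_def power2_eq_square[of "t m"]
      by (intro divide_right_mono) auto
  qed
  \<comment> \<open>From |a_m| >= |a_n| one gets 1 - |a_m|^2 |a_n|^2 <= 1 - |a_n|^4 <= 2 t_n, so Re
    q at the node is controlled by the quantity whose sum the Carleson condition bounds by
    \<open>C0\<close>.\<close>
  have upper: "Re (q m (a n)) \<le> 2 * (1 - (pseudo_hyp (a m) (a n))\<^sup>2)" if "m \<in> J n" for m n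
  proof -
    have le: "(cmod (a n))\<^sup>2 \<le> (cmod (a m))\<^sup>2" using that by (auto simp: J_def intro!: power_mono)
    have "(cmod (a n))\<^sup>2 * (cmod (a n))\<^sup>2 \<le> (cmod (a m))\<^sup>2 * (cmod (a n))\<^sup>2"
      using le by (intro mult_right_mono) auto
    then have "1 - (cmod (a m))\<^sup>2 * (cmod (a n))\<^sup>2 \<le> 1 - (cmod (a n))\<^sup>2 * (cmod (a n))\<^sup>2" by simp
    also have "\<dots> = t n * (1 + (cmod (a n))\<^sup>2)" by (simp add: t_def algebra_simps)
    also have "\<dots> \<le> t n * 2" using t[of n] by (intro mult_left_mono) (auto simp: t_def)
    finally have "t m * (1 - (cmod (a m))\<^sup>2 * (cmod (a n))\<^sup>2) \<le> t m * (t n * 2)"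
      using t[of m] by (intro mult_left_mono) auto
    then have "Re (q m (a n)) \<le> t m * (t n * 2) / (cmod (1 - cnj (a m) * a n))\<^sup>2"
      unfolding Req[OF in_disc] by (intro divide_right_mono) auto
    also have "\<dots> = 2 * (t m * t n / (cmod (1 - cnj (a m) * a n))\<^sup>2)" by simp
    finally show ?thesis unfolding one_minus_pseudo_hyp_power2[OF in_disc in_disc] t_def .
  qed
  have ReQn: "Re (Q n (a n)) \<le> 2 * C0" for n
  proof -
    have "Re (Q n (a n)) \<le> (\<Sum>m\<in>J n. 2 * (1 - (pseudo_hyp (a m) (a n))\<^sup>2))"
      unfolding Q_def Re_sum by (intro sum_mono upper)
    also have "\<dots> \<le> (\<Sum>m<N. 2 * (1 - (pseudo_hyp (a m) (a n))\<^sup>2))"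
    proof (rule sum_mono2)
      show "J n \<subseteq> {..<N}" by (auto simp: J_def)
      fix m
      have "(pseudo_hyp (a m) (a n))\<^sup>2 \<le> 1"
        using pseudo_hyp_less_1[OF in_disc in_disc, of m n] pseudo_hyp_nonneg[of "a m" "a n"]
        by (intro power_le_one) auto
      then show "0 \<le> 2 * (1 - (pseudo_hyp (a m) (a n))\<^sup>2)" by simp
    qed simp
    also have "\<dots> \<le> 2 * C0"
      unfolding sum_distrib_left[symmetric] by (intro mult_left_mono sum_one_minus_pseudo_hyp) simp
    finally show ?thesis .
  qed
  have Fbound: "cmod (F n z) \<le> (exp (2 * C0) / \<delta>) * (x n z * exp (- (\<Sum>m\<in>J n. x m z)))"
    if z: "z \<in> ball 0 1" for n z
  proof -
    have sz: "cmod ((of_real (t n) * szego (a n) z)\<^sup>2) = x n z"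
      unfolding x_def szego_def using t[of n] by (simp add: norm_mult norm_divide norm_power power_divide)
    have "cmod (B n z / B n (a n)) \<le> 1 / \<delta>"
      unfolding norm_divide using B1[OF z] Bn \<delta>_pos by (intro frac_le) auto
    moreover have "cmod (exp (Q n (a n) - Q n z)) \<le> exp (2 * C0) * exp (- (\<Sum>m\<in>J n. x m z))"
    proof -
      have "(\<Sum>m\<in>J n. x m z) \<le> Re (Q n z)" unfolding Q_def Re_sum by (intro sum_mono lower z)
      then show ?thesis using ReQn[of n] by (simp flip: exp_add)
    qed
    ultimately have "cmod (B n z / B n (a n)) * x n z * cmod (exp (Q n (a n) - Q n z))
      \<le> 1 / \<delta> * x n z * (exp (2 * C0) * exp (- (\<Sum>m\<in>J n. x m z)))"
      using \<delta>_pos by (intro mult_mono) (auto simp: x_def)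
    then show ?thesis unfolding F_def norm_mult sz by (simp add: mult_ac)
  qed
  show ?thesis
  proof (rule that[of F])
    show "F n holomorphic_on ball 0 1" for n unfolding F_def using Bnz[of n]
      by (intro holomorphic_intros Bhol Qhol szego_holomorphic[OF in_disc]) auto
    show "F n (a m) = (if m = n then 1 else 0)" if "m < N" "n < N" for m n
    proof (cases "m = n")
      case True
      have "cnj (a n) * a n = of_real ((cmod (a n))\<^sup>2)" unfolding complex_norm_square by simp
      then have "of_real (t n) * szego (a n) (a n) = 1"
        using one_minus_cnj_mult_nonzero[OF in_disc in_disc, of n n] unfolding t_def szego_def by simp
      then show ?thesis using True Bnz[of n] by (simp add: F_def)
    next
      case False
      then have "B n (a m) = 0" unfolding B_def using that
        by (intro prod_zero) (auto simp: blaschke_factor_self intro!: bexI[of _ m])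
      then show ?thesis using False by (simp add: F_def)
    qed
    fix z :: complex assume z: "z \<in> ball 0 1"
    have "(\<Sum>n<N. cmod (F n z)) \<le> (\<Sum>n<N. (exp (2 * C0) / \<delta>) * (x n z * exp (- (\<Sum>m\<in>J n. x m z))))"
      by (intro sum_mono Fbound z)
    also have "\<dots> = (exp (2 * C0) / \<delta>) * (\<Sum>n<N. x n z * exp (- (\<Sum>m\<in>J n. x m z)))"
      by (rule sum_distrib_left[symmetric])
    also have "\<dots> \<le> (exp (2 * C0) / \<delta>) * 1"
    proof (rule mult_left_mono)
      have "(\<Sum>n<N. x n z * exp (- (\<Sum>m\<in>J n. x m z))) \<le> 1 - exp (- (\<Sum>n<N. x n z))"
        unfolding J_def by (rule sum_mult_exp_tail_le) (auto simp: x_def)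
      then show "(\<Sum>n<N. x n z * exp (- (\<Sum>m\<in>J n. x m z))) \<le> 1"
        using exp_gt_zero[of "- (\<Sum>n<N. x n z)"] by linarith
    qed (use \<delta>_pos in simp)
    finally show "(\<Sum>n<N. cmod (F n z)) \<le> exp (2 * C0) / \<delta>" by simp
  qed
qed

lemma interpolating_multiplier:
  fixes \<epsilon> :: "nat \<Rightarrow> complex"
  assumes "\<And>n. cmod (\<epsilon> n) \<le> 1"
  obtains \<phi> where "\<phi> holomorphic_on ball 0 1" "\<And>n. n < N \<Longrightarrow> \<phi> (a n) = \<epsilon> n"
    "\<And>z. z \<in> ball 0 1 \<Longrightarrow> cmod (\<phi> z) \<le> exp (2 * C0) / \<delta>"
proof -
  obtain F where F: "\<And>n. n < N \<Longrightarrow> F n holomorphic_on ball 0 1"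
    "\<And>m n. m < N \<Longrightarrow> n < N \<Longrightarrow> F n (a m) = (if m = n then 1 else 0)"
    "\<And>z. z \<in> ball 0 1 \<Longrightarrow> (\<Sum>n<N. cmod (F n z)) \<le> exp (2 * C0) / \<delta>"
    using interpolating_functions[of N] by blast
  show ?thesis
  proof (rule that[of "\<lambda>z. \<Sum>n<N. \<epsilon> n * F n z"])
    show "(\<lambda>z. \<Sum>n<N. \<epsilon> n * F n z) holomorphic_on ball 0 1"
      by (intro holomorphic_on_sum holomorphic_on_mult holomorphic_on_const F) simp
    show "(\<Sum>k<N. \<epsilon> k * F k (a n)) = \<epsilon> n" if "n < N" for n
      using that by (simp add: F(2) if_distrib[of "\<lambda>x. _ * x"] cong: if_cong)
    fix z :: complex assume z: "z \<in> ball 0 1"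
    have "cmod (\<Sum>n<N. \<epsilon> n * F n z) \<le> (\<Sum>n<N. cmod (F n z))"
      by (rule order.trans[OF norm_sum], rule sum_mono)
         (simp add: norm_mult mult_left_le_one_le assms)
    then show "cmod (\<Sum>n<N. \<epsilon> n * F n z) \<le> exp (2 * C0) / \<delta>" using F(3)[OF z] by linarith
  qed
qed

end


section \<open>From interpolation to Riesz bounds and the Carleson embedding\<close>

definition nszego :: "complex \<Rightarrow> complex \<Rightarrow> complex" where
  "nszego w z = of_real (sqrt (1 - (cmod w)\<^sup>2)) * szego w z"

lemma H2_nszego: "w \<in> ball 0 1 \<Longrightarrow> nszego w \<in> H2"
  unfolding nszego_def by (intro H2_cmult H2_szego)

lemma h2_norm_nszego: "w \<in> ball 0 1 \<Longrightarrow> h2_norm (nszego w) = 1"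
proof -
  assume w: "w \<in> ball 0 1"
  have "(h2_norm (nszego w))\<^sup>2 = (1 - (cmod w)\<^sup>2) * (h2_norm (szego w))\<^sup>2"
    unfolding nszego_def h2_norm_cmult[OF H2_szego[OF w]] power_mult_distrib norm_of_real power2_abs
    using one_minus_cmod_power2_pos[OF w] by simp
  also have "\<dots> = 1" unfolding h2_norm_szego[OF w] using one_minus_cmod_power2_pos[OF w] by simp
  finally show ?thesis using h2_norm_nonneg[OF H2_nszego[OF w]] by (simp add: power2_eq_1_iff)
qed

lemma h2_inner_nszego:
  assumes "f \<in> H2" "w \<in> ball 0 1"
  shows "h2_inner f (nszego w) = of_real (sqrt (1 - (cmod w)\<^sup>2)) * f w"
  unfolding nszego_def h2_inner_cmult_right[OF H2_szego[OF assms(2)] assms(1)] h2_inner_szego[OF assms]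
  by simp

lemma h2_parallelogram:
  assumes "f \<in> H2" "g \<in> H2"
  shows "(h2_norm (\<lambda>z. f z + g z))\<^sup>2 + (h2_norm (\<lambda>z. f z - g z))\<^sup>2 = 2 * ((h2_norm f)\<^sup>2 + (h2_norm g)\<^sup>2)"
  using h2_norm_add_power2[OF assms] h2_norm_diff_power2[OF assms] by simp

text \<open>By the parallelogram law the squared norms for the two choices of the last sign average
  to the sum of squares. One choice is therefore at most and one at least this value, which serves
  both inductions.\<close>

lemma signs_exist:
  fixes v :: "nat \<Rightarrow> complex \<Rightarrow> complex"
  assumes v: "\<And>n. v n \<in> H2"
  shows "\<exists>\<epsilon>. (\<forall>n. \<epsilon> n \<in> {1, -1}) \<and> (h2_norm (\<lambda>z. \<Sum>n<N. \<epsilon> n * v n z))\<^sup>2 \<le> (\<Sum>n<N. (h2_norm (v n))\<^sup>2)"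
    and "\<exists>\<epsilon>. (\<forall>n. \<epsilon> n \<in> {1, -1}) \<and> (\<Sum>n<N. (h2_norm (v n))\<^sup>2) \<le> (h2_norm (\<lambda>z. \<Sum>n<N. \<epsilon> n * v n z))\<^sup>2"
proof -
  have ext: "(\<lambda>z. \<Sum>n<Suc N. (\<epsilon>(N := s)) n * v n z) = (\<lambda>z. (\<Sum>n<N. \<epsilon> n * v n z) + s * v N z)" for \<epsilon> s N
  proof
    fix z
    have "(\<Sum>n<N. (\<epsilon>(N := s)) n * v n z) = (\<Sum>n<N. \<epsilon> n * v n z)" by (intro sum.cong) auto
    then show "(\<Sum>n<Suc N. (\<epsilon>(N := s)) n * v n z) = (\<Sum>n<N. \<epsilon> n * v n z) + s * v N z" by simp
  qed
  let ?w = "\<lambda>\<epsilon> N z. \<Sum>n<N. \<epsilon> n * v n z"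
  have par: "(h2_norm (?w (\<epsilon>(N := 1)) (Suc N)))\<^sup>2 + (h2_norm (?w (\<epsilon>(N := -1)) (Suc N)))\<^sup>2
    = 2 * ((h2_norm (?w \<epsilon> N))\<^sup>2 + (h2_norm (v N))\<^sup>2)" for \<epsilon> :: "nat \<Rightarrow> complex" and N
    unfolding ext using h2_parallelogram[OF H2_sum[of "{..<N}" v \<epsilon>, OF v] v, of N] by simp
  have aux1: "p + q = 2 * (x + y) \<Longrightarrow> x \<le> r \<Longrightarrow> p \<le> r + y \<or> q \<le> r + y"
    and aux2: "p + q = 2 * (x + y) \<Longrightarrow> r \<le> x \<Longrightarrow> r + y \<le> p \<or> r + y \<le> q" for p q x y r :: real
    by argo+
  show "\<exists>\<epsilon>. (\<forall>n. \<epsilon> n \<in> {1, -1}) \<and> (h2_norm (?w \<epsilon> N))\<^sup>2 \<le> (\<Sum>n<N. (h2_norm (v n))\<^sup>2)"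
  proof (induction N)
    case 0
    show ?case by (rule exI[of _ "\<lambda>_. 1"]) (simp add: h2_norm_zero)
  next
    case (Suc N)
    then obtain \<epsilon> where \<epsilon>: "\<And>n. \<epsilon> n \<in> {1, -1}" "(h2_norm (?w \<epsilon> N))\<^sup>2 \<le> (\<Sum>n<N. (h2_norm (v n))\<^sup>2)" by blast
    let ?R = "\<Sum>n<Suc N. (h2_norm (v n))\<^sup>2"
    have "(h2_norm (?w (\<epsilon>(N := 1)) (Suc N)))\<^sup>2 \<le> ?R \<or> (h2_norm (?w (\<epsilon>(N := -1)) (Suc N)))\<^sup>2 \<le> ?R"
      unfolding sum.lessThan_Suc[of "\<lambda>n. (h2_norm (v n))\<^sup>2"] by (rule aux1[OF par \<epsilon>(2)])
    then obtain s where s: "s = 1 \<or> s = -1" "(h2_norm (?w (\<epsilon>(N := s)) (Suc N)))\<^sup>2 \<le> ?R" by blast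
    have "\<forall>n. (\<epsilon>(N := s)) n \<in> {1, -1}" using \<epsilon>(1) s(1) by auto
    then show ?case using s(2) by blast
  qed
  show "\<exists>\<epsilon>. (\<forall>n. \<epsilon> n \<in> {1, -1}) \<and> (\<Sum>n<N. (h2_norm (v n))\<^sup>2) \<le> (h2_norm (?w \<epsilon> N))\<^sup>2"
  proof (induction N)
    case 0
    show ?case by (rule exI[of _ "\<lambda>_. 1"]) (simp add: h2_norm_zero)
  next
    case (Suc N)
    then obtain \<epsilon> where \<epsilon>: "\<And>n. \<epsilon> n \<in> {1, -1}" "(\<Sum>n<N. (h2_norm (v n))\<^sup>2) \<le> (h2_norm (?w \<epsilon> N))\<^sup>2" by blast
    let ?R = "\<Sum>n<Suc N. (h2_norm (v n))\<^sup>2"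
    have "?R \<le> (h2_norm (?w (\<epsilon>(N := 1)) (Suc N)))\<^sup>2 \<or> ?R \<le> (h2_norm (?w (\<epsilon>(N := -1)) (Suc N)))\<^sup>2"
      unfolding sum.lessThan_Suc[of "\<lambda>n. (h2_norm (v n))\<^sup>2"] by (rule aux2[OF par \<epsilon>(2)])
    then obtain s where s: "s = 1 \<or> s = -1" "?R \<le> (h2_norm (?w (\<epsilon>(N := s)) (Suc N)))\<^sup>2" by blast
    have "\<forall>n. (\<epsilon>(N := s)) n \<in> {1, -1}" using \<epsilon>(1) s(1) by auto
    then show ?case using s(2) by blast
  qed
qed

lemma le_if_square_le_mult:
  fixes x y :: real
  assumes "x * x \<le> x * y" "0 \<le> y"
  shows "x \<le> y"
  using assms by (cases "x \<le> 0") (auto simp: mult_le_cancel_left)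

context carleson_sequence
begin

text \<open>Square of the sup bound for the interpolating multipliers, hence the cost in squared
  norm of a change of signs.\<close>

definition CR :: real where "CR = (exp (2 * C0) / \<delta>)\<^sup>2"

lemma CR_pos: "CR > 0"
  using \<delta>_pos by (simp add: CR_def)

lemma nszego_sum_H2: "(\<lambda>z. \<Sum>n<N. c n * nszego (a n) z) \<in> H2"
  by (intro H2_sum H2_nszego in_disc)

text \<open>The adjoint of multiplication by phi has the kernel at \<open>a n\<close> as eigenvector
  with eigenvalue conj(phi(a n)). Interpolating the signs therefore realises the sign change as an
  adjoint multiplier; in the proof this appears as <phi h, S> = ||h||^2, with h the signed
  sum.\<close>

lemma sign_change_bound:
  assumes \<epsilon>: "\<And>n. \<epsilon> n \<in> {1, -1 :: complex}"
  shows "(h2_norm (\<lambda>z. \<Sum>n<N. \<epsilon> n * c n * nszego (a n) z))\<^sup>2 \<le> CR * (h2_norm (\<lambda>z. \<Sum>n<N. c n * nszego (a n) z))\<^sup>2"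
proof -
  let ?S = "\<lambda>z. \<Sum>n<N. c n * nszego (a n) z"
  let ?h = "\<lambda>z. \<Sum>n<N. \<epsilon> n * c n * nszego (a n) z"
  note S = nszego_sum_H2[of c N] and h = nszego_sum_H2[of "\<lambda>n. \<epsilon> n * c n" N]
  have \<epsilon>1: "cmod (\<epsilon> n) \<le> 1" and \<epsilon>c: "cnj (\<epsilon> n) = \<epsilon> n" for n using \<epsilon>[of n] by auto
  obtain \<phi> where \<phi>: "\<phi> holomorphic_on ball 0 1" "\<And>n. n < N \<Longrightarrow> \<phi> (a n) = \<epsilon> n"
    "\<And>z. z \<in> ball 0 1 \<Longrightarrow> cmod (\<phi> z) \<le> exp (2 * C0) / \<delta>"
    using interpolating_multiplier[of \<epsilon> N, OF \<epsilon>1] by blast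
  note M = bounded_multiplier[OF h \<phi>(1,3)]
  have "h2_inner (\<lambda>z. \<phi> z * ?h z) ?S = (\<Sum>n<N. cnj (c n) * h2_inner (\<lambda>z. \<phi> z * ?h z) (nszego (a n)))"
    by (rule h2_inner_sum_right[OF H2_nszego[OF in_disc] M(1)])
  also have "\<dots> = (\<Sum>n<N. cnj (\<epsilon> n * c n) * h2_inner ?h (nszego (a n)))"
  proof (rule sum.cong[OF refl])
    fix n assume "n \<in> {..<N}"
    then have n: "n < N" by simp
    let ?r = "of_real (sqrt (1 - (cmod (a n))\<^sup>2))"
    have "h2_inner (\<lambda>z. \<phi> z * ?h z) (nszego (a n)) = ?r * (\<phi> (a n) * ?h (a n))"
      by (rule h2_inner_nszego[OF M(1) in_disc])
    also have "\<dots> = \<epsilon> n * (?r * ?h (a n))" unfolding \<phi>(2)[OF n] by (rule mult.left_commute)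
    also have "?r * ?h (a n) = h2_inner ?h (nszego (a n))" by (rule h2_inner_nszego[OF h in_disc, symmetric])
    finally have i: "h2_inner (\<lambda>z. \<phi> z * ?h z) (nszego (a n)) = \<epsilon> n * h2_inner ?h (nszego (a n))" .
    show "cnj (c n) * h2_inner (\<lambda>z. \<phi> z * ?h z) (nszego (a n)) = cnj (\<epsilon> n * c n) * h2_inner ?h (nszego (a n))"
      unfolding i complex_cnj_mult \<epsilon>c by (simp only: mult.left_commute mult.assoc)
  qed
  also have "\<dots> = h2_inner ?h ?h"
    by (rule h2_inner_sum_right[OF H2_nszego[OF in_disc] h, symmetric])
  also have "\<dots> = of_real ((h2_norm ?h)\<^sup>2)" by (rule h2_inner_self[OF h])
  finally have eq: "h2_inner (\<lambda>z. \<phi> z * ?h z) ?S = of_real ((h2_norm ?h)\<^sup>2)" .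
  have "(h2_norm ?h)\<^sup>2 = cmod (h2_inner (\<lambda>z. \<phi> z * ?h z) ?S)" unfolding eq norm_of_real by simp
  also have "\<dots> \<le> h2_norm (\<lambda>z. \<phi> z * ?h z) * h2_norm ?S" by (rule h2_Cauchy_Schwarz[OF M(1) S])
  also have "\<dots> \<le> (exp (2 * C0) / \<delta> * h2_norm ?h) * h2_norm ?S"
    by (rule mult_right_mono[OF M(2) h2_norm_nonneg[OF S]])
  finally have "h2_norm ?h * h2_norm ?h \<le> h2_norm ?h * (exp (2 * C0) / \<delta> * h2_norm ?S)"
    by (simp add: power2_eq_square mult_ac)
  then have "h2_norm ?h \<le> exp (2 * C0) / \<delta> * h2_norm ?S"
    by (rule le_if_square_le_mult) (use \<delta>_pos h2_norm_nonneg[OF S] in auto)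
  then have "(h2_norm ?h)\<^sup>2 \<le> (exp (2 * C0) / \<delta> * h2_norm ?S)\<^sup>2"
    using h2_norm_nonneg[OF h] by (intro power_mono)
  then show ?thesis unfolding CR_def power_mult_distrib .
qed

theorem nszego_riesz:
  shows "(h2_norm (\<lambda>z. \<Sum>n<N. c n * nszego (a n) z))\<^sup>2 \<le> CR * (\<Sum>n<N. (cmod (c n))\<^sup>2)"
    and "(\<Sum>n<N. (cmod (c n))\<^sup>2) \<le> CR * (h2_norm (\<lambda>z. \<Sum>n<N. c n * nszego (a n) z))\<^sup>2"
proof -
  let ?v = "\<lambda>n z. c n * nszego (a n) z"
  have v: "?v n \<in> H2" for n by (intro H2_cmult H2_nszego in_disc)
  have nv: "(h2_norm (?v n))\<^sup>2 = (cmod (c n))\<^sup>2" for n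
    unfolding h2_norm_cmult[OF H2_nszego[OF in_disc]] h2_norm_nszego[OF in_disc] by simp
  obtain \<epsilon> :: "nat \<Rightarrow> complex" where e1: "\<And>n. \<epsilon> n \<in> {1, -1}"
    "(h2_norm (\<lambda>z. \<Sum>n<N. \<epsilon> n * ?v n z))\<^sup>2 \<le> (\<Sum>n<N. (cmod (c n))\<^sup>2)"
    using signs_exist(1)[of ?v N, OF v] unfolding nv by blast
  \<comment> \<open>Signs are their own inverses: applied to the signed coefficients, the same
    one-sided estimate bounds the unsigned sum.\<close>
  have ee: "\<epsilon> n * (\<epsilon> n * c n) = c n" for n using e1(1)[of n] by auto
  have "(h2_norm (\<lambda>z. \<Sum>n<N. c n * nszego (a n) z))\<^sup>2
    \<le> CR * (h2_norm (\<lambda>z. \<Sum>n<N. (\<epsilon> n * c n) * nszego (a n) z))\<^sup>2"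
    using sign_change_bound[of \<epsilon> "\<lambda>n. \<epsilon> n * c n" N, OF e1(1)] unfolding ee .
  also have "\<dots> \<le> CR * (\<Sum>n<N. (cmod (c n))\<^sup>2)"
    using e1(2) CR_pos unfolding mult.assoc by (intro mult_left_mono) auto
  finally show "(h2_norm (\<lambda>z. \<Sum>n<N. c n * nszego (a n) z))\<^sup>2 \<le> CR * (\<Sum>n<N. (cmod (c n))\<^sup>2)" .
  obtain \<epsilon>' :: "nat \<Rightarrow> complex" where e2: "\<And>n. \<epsilon>' n \<in> {1, -1}"
    "(\<Sum>n<N. (cmod (c n))\<^sup>2) \<le> (h2_norm (\<lambda>z. \<Sum>n<N. \<epsilon>' n * ?v n z))\<^sup>2"
    using signs_exist(2)[of ?v N, OF v] unfolding nv by blast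
  show "(\<Sum>n<N. (cmod (c n))\<^sup>2) \<le> CR * (h2_norm (\<lambda>z. \<Sum>n<N. c n * nszego (a n) z))\<^sup>2"
    using e2(2) sign_change_bound[of \<epsilon>' c N, OF e2(1)] unfolding mult.assoc by linarith
qed

text \<open>Dual form of the upper Riesz bound: f is tested against the kernel sum S whose
  coefficients are its own weighted samples. With T the sum of their squares, T = <f, S> and ||S||^2
  <= CR T, and one factor T cancels.\<close>

lemma Carleson_embedding:
  assumes f: "f \<in> H2"
  shows "(\<Sum>n<N. (1 - (cmod (a n))\<^sup>2) * (cmod (f (a n)))\<^sup>2) \<le> CR * (h2_norm f)\<^sup>2"
proof -
  define c where "c n = of_real (sqrt (1 - (cmod (a n))\<^sup>2)) * f (a n)" for n
  let ?S = "\<lambda>z. \<Sum>n<N. c n * nszego (a n) z"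
  note S = nszego_sum_H2[of c N]
  define T where "T = (\<Sum>n<N. (cmod (c n))\<^sup>2)"
  have T0: "T \<ge> 0" unfolding T_def by (intro sum_nonneg) auto
  have cc: "(cmod (c n))\<^sup>2 = (1 - (cmod (a n))\<^sup>2) * (cmod (f (a n)))\<^sup>2" for n
    unfolding c_def norm_mult power_mult_distrib norm_of_real power2_abs
    using one_minus_cmod_power2_pos[OF in_disc[of n]] by simp
  have "h2_inner f ?S = (\<Sum>n<N. cnj (c n) * c n)"
    unfolding h2_inner_sum_right[OF H2_nszego[OF in_disc] f] h2_inner_nszego[OF f in_disc] c_def ..
  also have "\<dots> = of_real T" unfolding T_def of_real_sum complex_norm_square by (simp add: mult.commute)
  finally have "T = cmod (h2_inner f ?S)" using T0 by simp
  also have "\<dots> \<le> h2_norm f * h2_norm ?S" by (rule h2_Cauchy_Schwarz[OF f S])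
  finally have "T\<^sup>2 \<le> (h2_norm f * h2_norm ?S)\<^sup>2" using T0 by (intro power_mono)
  also have "\<dots> = (h2_norm f)\<^sup>2 * (h2_norm ?S)\<^sup>2" by (rule power_mult_distrib)
  also have "\<dots> \<le> (h2_norm f)\<^sup>2 * (CR * T)"
    unfolding T_def by (intro mult_left_mono nszego_riesz(1)) auto
  finally have "T * T \<le> T * (CR * (h2_norm f)\<^sup>2)" by (simp add: power2_eq_square mult_ac)
  then have "T \<le> CR * (h2_norm f)\<^sup>2" by (rule le_if_square_le_mult) (use CR_pos in auto)
  then show ?thesis unfolding T_def cc .
qed

end

section \<open>Duality between the two sequences\<close>

text \<open>Projection of the unit Szego kernel, not renormalised: its squared norm is 1 -
  |theta(w)|^2. It is linear in the kernel it projects, so a sum of these projects the corresponding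
  sum of \<open>nszego\<close>.\<close>

definition proj_nszego :: "(complex \<Rightarrow> complex) \<Rightarrow> complex \<Rightarrow> complex \<Rightarrow> complex" where
  "proj_nszego \<theta> w z = of_real (sqrt (1 - (cmod w)\<^sup>2)) * model_kernel \<theta> w z"

lemma model_proj_cmult:
  assumes "inner_function \<theta>" "model_proj \<theta> G P"
  shows "model_proj \<theta> (\<lambda>z. c * G z) (\<lambda>z. c * P z)"
  using model_proj_add_cmult[OF assms(1) model_proj_zero[OF assms(1)] assms(2), of c] by simp

lemma model_proj_nszego:
  assumes "inner_function \<theta>" "w \<in> ball 0 1"
  shows "model_proj \<theta> (nszego w) (proj_nszego \<theta> w)"
  unfolding nszego_def proj_nszego_def by (intro model_proj_cmult model_proj_szego assms)

lemma proj_nszego_norm: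
  assumes "inner_function \<theta>" "w \<in> ball 0 1"
  shows "(h2_norm (proj_nszego \<theta> w))\<^sup>2 = 1 - (cmod (\<theta> w))\<^sup>2"
proof -
  have k: "model_kernel \<theta> w \<in> H2" by (rule model_space_H2[OF model_kernel_in_model_space[OF assms]])
  have t: "1 - (cmod w)\<^sup>2 > 0" by (rule one_minus_cmod_power2_pos[OF assms(2)])
  have "(h2_norm (proj_nszego \<theta> w))\<^sup>2 = (1 - (cmod w)\<^sup>2) * (h2_norm (model_kernel \<theta> w))\<^sup>2"
    unfolding proj_nszego_def h2_norm_cmult[OF k] power_mult_distrib norm_of_real power2_abs
    using t by simp
  then show ?thesis unfolding model_kernel_norm[OF assms] using t by simp
qed

lemma proj_nszego_eq_normalized_kernel:
  assumes "inner_function \<theta>" "w \<in> ball 0 1" "cmod (\<theta> w) < 1"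
  shows "proj_nszego \<theta> w z = of_real (sqrt (1 - (cmod (\<theta> w))\<^sup>2)) * normalized_kernel \<theta> w z"
proof -
  have k: "model_kernel \<theta> w \<in> H2" by (rule model_space_H2[OF model_kernel_in_model_space[OF assms(1,2)]])
  have t: "1 - (cmod w)\<^sup>2 > 0" by (rule one_minus_cmod_power2_pos[OF assms(2)])
  have s: "1 - (cmod (\<theta> w))\<^sup>2 > 0" using assms(3) by (simp add: abs_square_less_1)
  have "h2_norm (model_kernel \<theta> w) = sqrt ((1 - (cmod (\<theta> w))\<^sup>2) / (1 - (cmod w)\<^sup>2))"
    using model_kernel_norm[OF assms(1,2)] h2_norm_nonneg[OF k] by (metis real_sqrt_unique)
  then have n: "h2_norm (model_kernel \<theta> w) = sqrt (1 - (cmod (\<theta> w))\<^sup>2) / sqrt (1 - (cmod w)\<^sup>2)"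
    by (simp add: real_sqrt_divide)
  show ?thesis unfolding proj_nszego_def normalized_kernel_def n using t s by simp
qed

lemma nszego_sum_hspan:
  "(\<lambda>z. \<Sum>n<N. c n * nszego (a n) z) \<in> hspan (szego ` range a)"
proof -
  have "(\<lambda>z. \<Sum>n<N. (c n * of_real (sqrt (1 - (cmod (a n))\<^sup>2))) * szego (a n) z) \<in> hspan (szego ` range a)"
    by (rule hspan_sum) auto
  then show ?thesis by (simp add: nszego_def mult.assoc)
qed

lemma hspan_szego_nszego:
  fixes a :: "nat \<Rightarrow> complex"
  assumes "\<And>n. a n \<in> ball 0 1" "S \<in> hspan (szego ` range a)"
  obtains N c where "S = (\<lambda>z. \<Sum>n<N. c n * nszego (a n) z)"
proof -
  have "S \<in> hspan (range (\<lambda>n. szego (a n)))" using assms(2) by (simp add: image_image)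
  then obtain N c where S: "S = (\<lambda>z. \<Sum>n<N. c n * szego (a n) z)" by (rule hspan_rangeE)
  have eq: "c n * szego (a n) z = (c n / of_real (sqrt (1 - (cmod (a n))\<^sup>2))) * nszego (a n) z" for n z
    unfolding nszego_def using one_minus_cmod_power2_pos[OF assms(1)[of n]] by simp
  from S[unfolded eq] show ?thesis by (rule that)
qed

text \<open>Two projections of the same function agree on the disc but may differ elsewhere, so
  uniqueness is recorded for norms.\<close>

lemma model_proj_norm_unique:
  assumes "inner_function \<theta>" "model_proj \<theta> G P" "model_proj \<theta> G P'"
  shows "(h2_norm P)\<^sup>2 = (h2_norm P')\<^sup>2"
proof -
  note P = model_proj_H2[OF assms(1,2)] and P' = model_proj_H2[OF assms(1,3)]
  have "h2_inner P P = h2_inner P P'"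
    using model_proj_inner[OF assms(1,2) P(1)] model_proj_inner[OF assms(1,3) P(1)] by simp
  moreover have "h2_inner P' P = h2_inner P' P'"
    using model_proj_inner[OF assms(1,2) P'(1)] model_proj_inner[OF assms(1,3) P'(1)] by simp
  ultimately have "h2_inner P P = cnj (h2_inner P' P')"
    using h2_inner_commute[OF P'(2) P(2)] by simp
  then have "complex_of_real ((h2_norm P)\<^sup>2) = complex_of_real ((h2_norm P')\<^sup>2)"
    unfolding h2_inner_self[OF P(2)] h2_inner_self[OF P'(2)] complex_cnj_complex_of_real .
  then show ?thesis by (simp only: of_real_eq_iff)
qed

text \<open>The compressions $P_B|K_A$ and $P_A|K_B$ are adjoint to each other, so a lower bound and
  dense range of the first give the same lower bound for the second.\<close>

lemma model_proj_lower_bound_dual: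
  assumes IA: "inner_function A" and IB: "inner_function B"
    and X: "X \<subseteq> model_space A" and \<kappa>: "\<kappa> > 0"
    and lb: "\<And>S P. S \<in> hspan X \<Longrightarrow> model_proj B S P \<Longrightarrow> \<kappa> * (h2_norm S)\<^sup>2 \<le> (h2_norm P)\<^sup>2"
    and dense: "\<And>f e. f \<in> model_space B \<Longrightarrow> e > 0 \<Longrightarrow>
      \<exists>S\<in>hspan X. \<exists>P. model_proj B S P \<and> h2_norm (\<lambda>z. f z - P z) < e"
    and g: "g \<in> model_space B" and P: "model_proj A g P"
  shows "\<kappa> * (h2_norm g)\<^sup>2 \<le> (h2_norm P)\<^sup>2"
proof -
  note gH = model_space_H2[OF g] and PH = model_proj_H2[OF IA P]
  let ?g = "h2_norm g" and ?P = "h2_norm P"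
  have g0: "?g \<ge> 0" by (rule h2_norm_nonneg[OF gH])
  have P0: "?P \<ge> 0" by (rule h2_norm_nonneg[OF PH(2)])
  have key: "sqrt \<kappa> * (?g\<^sup>2 - e * ?g) \<le> (?g + e) * ?P" if e: "e > 0" for e
  proof -
    obtain S R where S: "S \<in> hspan X" and R: "model_proj B S R" and gR: "h2_norm (\<lambda>z. g z - R z) < e"
      using dense[OF g e] by blast
    note RH = model_proj_H2[OF IB R]
    have SA: "S \<in> model_space A" by (rule hspan_model_space[OF IA X S])
    \<comment> \<open>The adjoint relation: R may be replaced by S because g is in K_B, and then g
      by its projection P because S is in K_A.\<close>
    have "h2_inner g R = h2_inner g S" by (rule model_proj_inner[OF IB R g, symmetric])
    also have "\<dots> = cnj (h2_inner S P)"
      unfolding h2_inner_commute[OF RH(3) gH] model_proj_inner[OF IA P SA] ..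
    finally have "cmod (h2_inner g R) \<le> h2_norm S * ?P"
      using h2_Cauchy_Schwarz[OF RH(3) PH(2)] by simp
    moreover have "?g\<^sup>2 - e * ?g \<le> cmod (h2_inner g R)"
    proof -
      have "h2_inner g R = of_real (?g\<^sup>2) - h2_inner g (\<lambda>z. g z - R z)"
        unfolding h2_inner_diff_right[OF gH RH(2) gH] h2_inner_self[OF gH] by simp
      then have "cmod (h2_inner g R) \<ge> ?g\<^sup>2 - cmod (h2_inner g (\<lambda>z. g z - R z))"
        using norm_triangle_ineq2[of "complex_of_real (?g\<^sup>2)" "h2_inner g (\<lambda>z. g z - R z)"]
        by (simp add: norm_power g0 del: of_real_power)
      moreover have "cmod (h2_inner g (\<lambda>z. g z - R z)) \<le> ?g * e"
        by (rule order.trans[OF h2_Cauchy_Schwarz[OF gH H2_diff[OF gH RH(2)]]])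
           (intro mult_left_mono less_imp_le[OF gR] g0)
      ultimately show ?thesis by (simp add: mult.commute)
    qed
    ultimately have 1: "?g\<^sup>2 - e * ?g \<le> h2_norm S * ?P" by linarith
    have "h2_norm R \<le> ?g + e"
      using h2_norm_le_diff[OF RH(2) gH] gR unfolding h2_norm_diff_commute[OF RH(2) gH] by linarith
    have "(sqrt \<kappa> * h2_norm S)\<^sup>2 \<le> (h2_norm R)\<^sup>2"
      using lb[OF S R] \<kappa> by (simp add: power_mult_distrib)
    then have "sqrt \<kappa> * h2_norm S \<le> h2_norm R"
      by (rule power2_le_imp_le) (rule h2_norm_nonneg[OF RH(2)])
    then have 2: "sqrt \<kappa> * h2_norm S \<le> ?g + e" using \<open>h2_norm R \<le> ?g + e\<close> by linarith
    have "sqrt \<kappa> * (?g\<^sup>2 - e * ?g) \<le> sqrt \<kappa> * (h2_norm S * ?P)"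
      using 1 \<kappa> by (intro mult_left_mono) auto
    also have "\<dots> = (sqrt \<kappa> * h2_norm S) * ?P" by simp
    also have "\<dots> \<le> (?g + e) * ?P" by (rule mult_right_mono[OF 2 P0])
    finally show ?thesis .
  qed
  have "sqrt \<kappa> * (?g\<^sup>2 - 0 * ?g) \<le> (?g + 0) * ?P"
  proof (rule LIMSEQ_le)
    show "(\<lambda>n. sqrt \<kappa> * (?g\<^sup>2 - inverse (real (Suc n)) * ?g)) \<longlonglongrightarrow> sqrt \<kappa> * (?g\<^sup>2 - 0 * ?g)"
      by (intro tendsto_intros LIMSEQ_inverse_real_of_nat)
    show "(\<lambda>n. (?g + inverse (real (Suc n))) * ?P) \<longlonglongrightarrow> (?g + 0) * ?P"
      by (intro tendsto_intros LIMSEQ_inverse_real_of_nat)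
    show "\<exists>N. \<forall>n\<ge>N. sqrt \<kappa> * (?g\<^sup>2 - inverse (real (Suc n)) * ?g) \<le> (?g + inverse (real (Suc n))) * ?P"
      using key by simp
  qed
  then have le: "?g * (sqrt \<kappa> * ?g) \<le> ?g * ?P" by (simp add: power2_eq_square mult_ac)
  have "sqrt \<kappa> * ?g \<le> ?P"
  proof (cases "?g = 0")
    case False
    then have "?g > 0" using g0 by simp
    with le show ?thesis by (simp add: mult_le_cancel_left_pos)
  qed (use P0 in simp)
  then have "(sqrt \<kappa> * ?g)\<^sup>2 \<le> ?P\<^sup>2" using \<kappa> g0 by (intro power_mono) auto
  then show ?thesis using \<kappa> by (simp add: power_mult_distrib)
qed

text \<open>Neumann iteration: the remainder after one step is again in the model space, so the step
  can be repeated. Each round spends half of the remaining tolerance, and earlier errors are only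
  multiplied by powers of q.\<close>

lemma contraction_dense:
  assumes IA: "inner_function A" and V: "V \<subseteq> model_space A" and q: "0 \<le> q" "q < 1"
    and step: "\<And>f e. f \<in> model_space A \<Longrightarrow> e > 0 \<Longrightarrow> \<exists>P\<in>hspan V. h2_norm (\<lambda>z. f z - P z) \<le> q * h2_norm f + e"
    and f: "f \<in> model_space A" and e: "e > 0"
  shows "\<exists>P\<in>hspan V. h2_norm (\<lambda>z. f z - P z) < e"
proof -
  have iter: "\<exists>P\<in>hspan V. h2_norm (\<lambda>z. f z - P z) \<le> q ^ k * h2_norm f + e"
    if "f \<in> model_space A" "e > 0" for k f e
    using that
  proof (induction k arbitrary: f e)
    case 0
    have "h2_norm (\<lambda>z. f z - 0) \<le> q ^ 0 * h2_norm f + e" using 0 by simp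
    then show ?case by (intro bexI[OF _ hspan.zero])
  next
    case (Suc k)
    have e2: "e / 2 > 0" using Suc.prems by simp
    obtain P1 where P1: "P1 \<in> hspan V" "h2_norm (\<lambda>z. f z - P1 z) \<le> q * h2_norm f + e / 2"
      using step[OF Suc.prems(1) e2] by blast
    have "(\<lambda>z. f z - P1 z) \<in> model_space A"
      by (rule model_space_diff[OF IA Suc.prems(1) hspan_model_space[OF IA V P1(1)]])
    from Suc.IH[OF this e2] obtain P2 where P2: "P2 \<in> hspan V"
      "h2_norm (\<lambda>z. f z - P1 z - P2 z) \<le> q ^ k * h2_norm (\<lambda>z. f z - P1 z) + e / 2" by blast
    have "q ^ k * h2_norm (\<lambda>z. f z - P1 z) \<le> q ^ k * (q * h2_norm f + e / 2)"
      using P1(2) q by (intro mult_left_mono) auto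
    also have "\<dots> = q ^ Suc k * h2_norm f + q ^ k * (e / 2)" by (simp add: algebra_simps)
    also have "q ^ k * (e / 2) \<le> e / 2" using q e2 by (intro mult_left_le_one_le) (auto simp: power_le_one)
    finally have "h2_norm (\<lambda>z. f z - P1 z - P2 z) \<le> q ^ Suc k * h2_norm f + e" using P2(2) by linarith
    moreover have "(\<lambda>z. f z - P1 z - P2 z) = (\<lambda>z. f z - (P1 z + 1 * P2 z))" by auto
    ultimately have "h2_norm (\<lambda>z. f z - (P1 z + 1 * P2 z)) \<le> q ^ Suc k * h2_norm f + e" by metis
    then show ?case by (intro bexI[OF _ hspan_add_cmult[OF P1(1) P2(1), of 1]])
  qed
  have "(\<lambda>k. q ^ k * h2_norm f) \<longlonglongrightarrow> 0 * h2_norm f"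
    using q by (intro tendsto_mult tendsto_const LIMSEQ_power_zero) auto
  then have "\<exists>no. \<forall>k\<ge>no. norm (q ^ k * h2_norm f - 0 * h2_norm f) < e / 2"
    by (rule LIMSEQ_D) (use e in simp)
  then obtain k where "norm (q ^ k * h2_norm f - 0 * h2_norm f) < e / 2" by blast
  then have k: "q ^ k * h2_norm f < e / 2" by simp
  obtain P where P: "P \<in> hspan V" "h2_norm (\<lambda>z. f z - P z) \<le> q ^ k * h2_norm f + e / 2"
    using iter[OF f half_gt_zero[OF e]] by blast
  then have "h2_norm (\<lambda>z. f z - P z) < e" using k by linarith
  then show ?thesis using P(1) by blast
qed

text \<open>Gaussian elimination: each equation either vanishes identically or removes one unknown,
  so at least one unknown remains free.\<close>

lemma underdetermined_system:
  fixes v :: "nat \<Rightarrow> 'a \<Rightarrow> complex"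
  assumes "finite Q" "card Q > n"
  shows "\<exists>c. (\<exists>j\<in>Q. c j \<noteq> 0) \<and> (\<forall>i<n. (\<Sum>j\<in>Q. c j * v i j) = 0)"
  using assms
proof (induction n arbitrary: Q v)
  case 0
  then obtain j where "j \<in> Q" by fastforce
  then show ?case by (intro exI[of _ "\<lambda>_. 1"]) auto
next
  case (Suc n)
  show ?case
  proof (cases "\<forall>j\<in>Q. v n j = 0")
    case True
    obtain c where c: "\<exists>j\<in>Q. c j \<noteq> 0" "\<forall>i<n. (\<Sum>j\<in>Q. c j * v i j) = 0"
      using Suc.IH[OF Suc.prems(1), of v] Suc.prems(2) by auto
    have "(\<Sum>j\<in>Q. c j * v n j) = 0" using True by (intro sum.neutral) auto
    then have "\<forall>i<Suc n. (\<Sum>j\<in>Q. c j * v i j) = 0" using c(2) by (auto simp: less_Suc_eq)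
    then show ?thesis using c(1) by blast
  next
    case False
    then obtain p where p: "p \<in> Q" "v n p \<noteq> 0" by blast
    let ?Q = "Q - {p}"
    have "finite ?Q" "card ?Q > n" using Suc.prems p by auto
    from Suc.IH[OF this, of "\<lambda>i j. v i j - v i p * v n j / v n p"]
    obtain c where c: "\<exists>j\<in>?Q. c j \<noteq> 0"
      "\<And>i. i < n \<Longrightarrow> (\<Sum>j\<in>?Q. c j * (v i j - v i p * v n j / v n p)) = 0" by blast
    \<comment> \<open>The pivot coordinate solves equation n; inserting it turns every other
      equation into its reduced form, for which c was chosen.\<close>
    define d where "d = c(p := - (\<Sum>j\<in>?Q. c j * v n j) / v n p)"
    have sum: "(\<Sum>j\<in>Q. d j * v i j) = (\<Sum>j\<in>?Q. c j * (v i j - v i p * v n j / v n p))" for i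
    proof -
      have "(\<Sum>j\<in>Q. d j * v i j) = d p * v i p + (\<Sum>j\<in>?Q. d j * v i j)"
        by (rule sum.remove[OF Suc.prems(1) p(1)])
      also have "(\<Sum>j\<in>?Q. d j * v i j) = (\<Sum>j\<in>?Q. c j * v i j)" by (intro sum.cong) (auto simp: d_def)
      also have "d p * v i p = - (\<Sum>j\<in>?Q. c j * (v i p * v n j / v n p))"
      proof -
        have "(\<Sum>j\<in>?Q. c j * (v i p * v n j / v n p)) = (\<Sum>j\<in>?Q. c j * v n j) * (v i p / v n p)"
          unfolding sum_distrib_right by (intro sum.cong refl) (simp add: mult_ac)
        then show ?thesis by (simp add: d_def)
      qed
      finally show ?thesis by (simp add: right_diff_distrib sum_subtractf)
    qed
    have "(\<Sum>j\<in>Q. d j * v i j) = 0" if "i < Suc n" for i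
    proof (cases "i = n")
      case True
      show ?thesis unfolding sum True using p(2) by simp
    next
      case False
      then show ?thesis unfolding sum using that by (intro c(2)) simp
    qed
    moreover have "\<exists>j\<in>Q. d j \<noteq> 0" using c(1) by (auto simp: d_def)
    ultimately show ?thesis by blast
  qed
qed


text \<open>The Blaschke product vanishes at \<open>a n\<close>, so the model kernel there is the
  Szego kernel itself.\<close>

lemma szego_in_model_space:
  assumes "blaschke_sequence a"
  shows "szego ` range a \<subseteq> model_space (blaschke a)"
proof -
  have "szego (a n) \<in> model_space (blaschke a)" for n
    using model_kernel_in_model_space[OF inner_function_blaschke[OF assms], of "a n"] assms
    unfolding model_kernel_at_zero[of "blaschke a" "a n", OF blaschke_zero[OF assms]]
    by (simp add: blaschke_sequence_def)
  then show ?thesis by blast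
qed

lemma cmod_blaschke_less_1:
  assumes "blaschke_sequence a" "w \<in> ball 0 1"
  shows "cmod (blaschke a w) < 1"
proof -
  have "cmod (blaschke a w) \<le> pseudo_hyp (a 0) w"
    using cmod_blaschke_le_factors[OF assms, of "{0}"] by simp
  also have "\<dots> < 1" using assms by (intro pseudo_hyp_less_1) (auto simp: blaschke_sequence_def)
  finally show ?thesis .
qed

text \<open>Restates the Riesz basis hypothesis for \<open>proj_nszego\<close> in place of
  normalised kernels, so that it speaks about projections of sums of unit Szego kernels. The
  rescaling is carried out where the locale is interpreted.\<close>

locale carleson_pair =
  L: carleson_sequence lam \<delta>L + M: carleson_sequence mu \<delta>M
  for lam mu :: "nat \<Rightarrow> complex" and \<delta>L \<delta>M :: real +
  fixes \<gamma> :: real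
  assumes \<gamma>: "\<gamma> > 0"
    and lower: "\<And>N c. \<gamma> * (\<Sum>n<N. (cmod (c n))\<^sup>2) \<le> (h2_norm (\<lambda>z. \<Sum>n<N. c n * proj_nszego (blaschke mu) (lam n) z))\<^sup>2"
    and complete: "\<And>f e. f \<in> model_space (blaschke mu) \<Longrightarrow> e > 0 \<Longrightarrow>
      \<exists>N c. h2_norm (\<lambda>z. f z - (\<Sum>n<N. c n * proj_nszego (blaschke mu) (lam n) z)) < e"
begin

abbreviation "A \<equiv> blaschke lam"
abbreviation "B \<equiv> blaschke mu"

lemma IA: "inner_function A" by (rule inner_function_blaschke[OF L.blaschke_sequence])
lemma IB: "inner_function B" by (rule inner_function_blaschke[OF M.blaschke_sequence])

lemma proj_sum:
  "model_proj B (\<lambda>z. \<Sum>n<N. c n * nszego (lam n) z) (\<lambda>z. \<Sum>n<N. c n * proj_nszego B (lam n) z)"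
  by (intro model_proj_sum IB model_proj_nszego L.in_disc)

text \<open>The compression to K_B is bounded below with constant \<open>\<gamma> / L.CR\<close>;
  the cap 1/2 keeps \<open>1 - \<kappa>\<close> positive, so that its root is a contraction
  factor.\<close>

definition \<kappa> :: real where "\<kappa> = min (1 / 2) (\<gamma> / L.CR)"

lemma \<kappa>: "\<kappa> > 0" "\<kappa> < 1" using \<gamma> L.CR_pos by (auto simp: \<kappa>_def)

lemma proj_lower_bound:
  assumes "S \<in> hspan (szego ` range lam)" "model_proj B S P"
  shows "\<kappa> * (h2_norm S)\<^sup>2 \<le> (h2_norm P)\<^sup>2"
proof -
  obtain N c where S: "S = (\<lambda>z. \<Sum>n<N. c n * nszego (lam n) z)"
    by (rule hspan_szego_nszego[OF L.in_disc assms(1)])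
  have "\<kappa> * (h2_norm S)\<^sup>2 \<le> \<gamma> / L.CR * (h2_norm S)\<^sup>2" by (intro mult_right_mono) (auto simp: \<kappa>_def)
  also have "\<dots> \<le> \<gamma> / L.CR * (L.CR * (\<Sum>n<N. (cmod (c n))\<^sup>2))"
    unfolding S using \<gamma> L.CR_pos by (intro mult_left_mono L.nszego_riesz(1)) auto
  also have "\<dots> = \<gamma> * (\<Sum>n<N. (cmod (c n))\<^sup>2)" using L.CR_pos by simp
  also have "\<dots> \<le> (h2_norm (\<lambda>z. \<Sum>n<N. c n * proj_nszego B (lam n) z))\<^sup>2" by (rule lower)
  also have "\<dots> = (h2_norm P)\<^sup>2"
    by (rule model_proj_norm_unique[OF IB proj_sum assms(2)[unfolded S]])
  finally show ?thesis .
qed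

lemma proj_dense:
  assumes "f \<in> model_space B" "e > 0"
  shows "\<exists>S\<in>hspan (szego ` range lam). \<exists>P. model_proj B S P \<and> h2_norm (\<lambda>z. f z - P z) < e"
proof -
  obtain N c where c: "h2_norm (\<lambda>z. f z - (\<Sum>n<N. c n * proj_nszego B (lam n) z)) < e"
    using complete[OF assms] by blast
  show ?thesis
    by (intro bexI[OF _ nszego_sum_hspan] exI conjI) (rule proj_sum, rule c)
qed

lemma dual_lower_bound:
  assumes "g \<in> hspan (szego ` range mu)" "model_proj A g P"
  shows "\<kappa> * (h2_norm g)\<^sup>2 \<le> (h2_norm P)\<^sup>2"
proof (rule model_proj_lower_bound_dual[OF IA IB szego_in_model_space[OF L.blaschke_sequence] \<kappa>(1)])
  show "g \<in> model_space B"
    by (rule hspan_model_space[OF IB szego_in_model_space[OF M.blaschke_sequence] assms(1)])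
qed (use proj_lower_bound proj_dense assms(2) in auto)

text \<open>One round trip from K_A to K_B and back. By Pythagoras and the lower bound, ||S - P_B
  S||^2 <= \<open>(1 - \<kappa>)\<close> ||S||^2. The three shares e/3 pay for replacing f by S, for
  the change of norm this causes, and for replacing P_B S by kernels at \<open>mu\<close>.\<close>

lemma dual_step:
  assumes f: "f \<in> model_space A" and e: "e > 0"
  shows "\<exists>P\<in>hspan (model_kernel A ` range mu). h2_norm (\<lambda>z. f z - P z) \<le> sqrt (1 - \<kappa>) * h2_norm f + e"
proof -
  have e3: "e / 3 > 0" using e by simp
  note fH = model_space_H2[OF f]
  have mub: "range mu \<subseteq> ball 0 1" using M.in_disc by blast
  have LX: "szego ` range lam \<subseteq> H2" using L.in_disc by (intro szego_subset_H2) blast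
  have MX: "szego ` range mu \<subseteq> H2" by (rule szego_subset_H2[OF mub])
  obtain S where S: "S \<in> hspan (szego ` range lam)" "h2_norm (\<lambda>z. f z - S z) < e / 3"
    using szego_complete_in_model_space[OF L.blaschke_sequence L.inj f] e3 unfolding hclspan_def by blast
  have SH: "S \<in> H2" by (rule hspan_H2[OF LX S(1)])
  have SA: "S \<in> model_space A"
    by (rule hspan_model_space[OF IA szego_in_model_space[OF L.blaschke_sequence] S(1)])
  obtain R where R: "model_proj B S R"
    using szego_hspan_proj[OF IB _ S(1)] L.in_disc by blast
  note RH = model_proj_H2[OF IB R]
  obtain g where g: "g \<in> hspan (szego ` range mu)" "h2_norm (\<lambda>z. R z - g z) < e / 3"
    using szego_complete_in_model_space[OF M.blaschke_sequence M.inj RH(1)] e3 unfolding hclspan_def by blast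
  have gH: "g \<in> H2" by (rule hspan_H2[OF MX g(1)])
  obtain P where P: "P \<in> hspan (model_kernel A ` range mu)" "model_proj A g P"
    using szego_hspan_proj[OF IA mub g(1)] by blast
  note PH = model_proj_H2[OF IA P(2)]
  have q: "0 \<le> sqrt (1 - \<kappa>)" "sqrt (1 - \<kappa>) \<le> 1" using \<kappa> by auto
  have "(h2_norm (\<lambda>z. S z - R z))\<^sup>2 \<le> (sqrt (1 - \<kappa>) * h2_norm S)\<^sup>2"
    using model_proj_norm_power2[OF IB R] proj_lower_bound[OF S(1) R] \<kappa>
    by (simp add: power_mult_distrib algebra_simps)
  then have 1: "h2_norm (\<lambda>z. S z - R z) \<le> sqrt (1 - \<kappa>) * h2_norm S"
    by (rule power2_le_imp_le) (use q(1) h2_norm_nonneg[OF SH] in auto)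
  have 2: "h2_norm S \<le> h2_norm f + e / 3"
    using h2_norm_le_diff[OF SH fH] S(2) unfolding h2_norm_diff_commute[OF SH fH] by linarith
  have 3: "sqrt (1 - \<kappa>) * h2_norm S \<le> sqrt (1 - \<kappa>) * h2_norm f + e / 3"
  proof -
    have "sqrt (1 - \<kappa>) * h2_norm S \<le> sqrt (1 - \<kappa>) * (h2_norm f + e / 3)" by (rule mult_left_mono[OF 2 q(1)])
    also have "\<dots> = sqrt (1 - \<kappa>) * h2_norm f + sqrt (1 - \<kappa>) * (e / 3)" by (rule distrib_left)
    also have "sqrt (1 - \<kappa>) * (e / 3) \<le> e / 3" using q e3 by (intro mult_left_le_one_le) auto
    finally show ?thesis by simp
  qed
  \<comment> \<open>S is in K_A, so projecting g to K_A does not move it away from S.\<close>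
  have "h2_norm (\<lambda>z. S z - P z) \<le> h2_norm (\<lambda>z. S z - g z)" by (rule model_proj_dist[OF IA P(2) SA])
  also have "\<dots> \<le> h2_norm (\<lambda>z. S z - R z) + h2_norm (\<lambda>z. R z - g z)"
    by (rule h2_norm_diff_triangle[OF SH RH(2) gH])
  finally have "h2_norm (\<lambda>z. f z - P z) \<le> sqrt (1 - \<kappa>) * h2_norm f + e"
    using h2_norm_diff_triangle[OF fH SH PH(2)] S(2) g(2) 1 3 by linarith
  then show ?thesis using P(1) by blast
qed

text \<open>The transferred lower bound is tested on a unit Szego kernel, whose projection has
  squared norm exactly this value. It keeps the normalising factors away from 0.\<close>

lemma one_minus_A_mu: "1 - (cmod (A (mu n)))\<^sup>2 \<ge> \<kappa>"
proof -
  have "nszego (mu n) \<in> hspan (szego ` range mu)"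
    using hspan.step[OF hspan.zero, of "szego (mu n)" "szego ` range mu" "of_real (sqrt (1 - (cmod (mu n))\<^sup>2))"]
    by (simp add: nszego_def[abs_def])
  from dual_lower_bound[OF this model_proj_nszego[OF IA M.in_disc]] show ?thesis
    unfolding h2_norm_nszego[OF M.in_disc] proj_nszego_norm[OF IA M.in_disc] by simp
qed

text \<open>Normalised kernels are the projected unit kernels divided by s n, whose square lies
  between \<open>\<kappa>\<close> and 1. Both the span and the two-sided estimates therefore survive
  the change of normalisation.\<close>

theorem dual_riesz_basis: "riesz_basis (model_space A) (\<lambda>n. normalized_kernel A (mu n))"
proof -
  define s where "s n = sqrt (1 - (cmod (A (mu n)))\<^sup>2)" for n
  have s2: "(s n)\<^sup>2 = 1 - (cmod (A (mu n)))\<^sup>2" for n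
    unfolding s_def using one_minus_A_mu[of n] \<kappa>(1) by simp
  have s0: "s n > 0" for n unfolding s_def using one_minus_A_mu[of n] \<kappa>(1) by simp
  have eq: "proj_nszego A (mu n) z = of_real (s n) * normalized_kernel A (mu n) z" for n z
    unfolding s_def by (rule proj_nszego_eq_normalized_kernel[OF IA M.in_disc
          cmod_blaschke_less_1[OF L.blaschke_sequence M.in_disc]])
  have nk: "normalized_kernel A (mu n) z = of_real (1 / s n) * proj_nszego A (mu n) z" for n z
    unfolding eq using s0[of n] by simp
  have nk_in: "normalized_kernel A (mu n) \<in> model_space A" for n
  proof -
    have "(\<lambda>z. 0 + of_real (1 / s n) * proj_nszego A (mu n) z) \<in> model_space A"
      by (intro model_space_add_cmult IA model_space_zero model_proj_H2(1)[OF IA model_proj_nszego[OF IA M.in_disc]])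
    moreover have "normalized_kernel A (mu n) = (\<lambda>z. 0 + of_real (1 / s n) * proj_nszego A (mu n) z)"
      by (rule ext) (simp only: nk add_0)
    ultimately show ?thesis by metis
  qed
  have mk: "model_kernel A (mu n) z = of_real (s n / sqrt (1 - (cmod (mu n))\<^sup>2)) * normalized_kernel A (mu n) z" for n z
    using eq[of n z] one_minus_cmod_power2_pos[OF M.in_disc[of n]] unfolding proj_nszego_def
    by (simp add: field_simps)
  have span: "P \<in> hspan (range (\<lambda>n. normalized_kernel A (mu n)))" if "P \<in> hspan (model_kernel A ` range mu)" for P
    using that
  proof induction
    case zero
    show ?case by (rule hspan.zero)
  next
    case (step f x c)
    then obtain n where n: "x = model_kernel A (mu n)" by blast
    have "(\<lambda>z. f z + c * of_real (s n / sqrt (1 - (cmod (mu n))\<^sup>2)) * normalized_kernel A (mu n) z)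
      \<in> hspan (range (\<lambda>n. normalized_kernel A (mu n)))"
      by (rule hspan.step[OF step.IH]) blast
    then show ?case unfolding n mk by (simp only: mult.assoc)
  qed
  have dense: "\<exists>N a. h2_norm (\<lambda>z. f z - (\<Sum>n<N. a n * normalized_kernel A (mu n) z)) < e"
    if f: "f \<in> model_space A" and e: "e > 0" for f e
  proof -
    have V: "model_kernel A ` range mu \<subseteq> model_space A"
      using model_kernel_in_model_space[OF IA M.in_disc] by blast
    have "sqrt (1 - \<kappa>) < 1" using \<kappa> by simp
    then obtain P where P: "P \<in> hspan (model_kernel A ` range mu)" "h2_norm (\<lambda>z. f z - P z) < e"
      using contraction_dense[OF IA V _ _ dual_step f e] \<kappa> by auto
    from span[OF P(1)] obtain N a where "P = (\<lambda>z. \<Sum>n<N. a n * normalized_kernel A (mu n) z)"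
      by (rule hspan_rangeE)
    with P(2) show ?thesis by blast
  qed
  have bounds: "\<kappa> / M.CR * (\<Sum>n<N. (cmod (c n))\<^sup>2) \<le> (h2_norm (\<lambda>z. \<Sum>n<N. c n * normalized_kernel A (mu n) z))\<^sup>2 \<and>
    (h2_norm (\<lambda>z. \<Sum>n<N. c n * normalized_kernel A (mu n) z))\<^sup>2 \<le> M.CR / \<kappa> * (\<Sum>n<N. (cmod (c n))\<^sup>2)" for N c
  proof -
    define c' where "c' n = c n * of_real (1 / s n)" for n
    have cc: "(cmod (c' n))\<^sup>2 = (cmod (c n))\<^sup>2 / (s n)\<^sup>2" for n
      unfolding c'_def norm_mult norm_of_real by (simp add: power_mult_distrib power_divide)
    have s1: "(s n)\<^sup>2 \<le> 1" "\<kappa> \<le> (s n)\<^sup>2" for n unfolding s2 using one_minus_A_mu[of n] by auto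
    \<comment> \<open>Dividing by s n <= 1 only enlarges coefficients, so the lower estimate loses
      nothing here; the upper one loses the factor \<open>1 / \<kappa>\<close>.\<close>
    have c1: "(cmod (c n))\<^sup>2 \<le> (cmod (c' n))\<^sup>2" for n
      unfolding cc using s1(1)[of n] s0[of n] by (simp add: pos_le_divide_eq mult_left_le)
    have c2: "(cmod (c' n))\<^sup>2 \<le> (cmod (c n))\<^sup>2 / \<kappa>" for n
      unfolding cc using s1(2)[of n] \<kappa>(1) s0[of n] by (intro divide_left_mono mult_pos_pos) auto
    let ?S = "\<lambda>z. \<Sum>n<N. c' n * nszego (mu n) z" and ?P = "\<lambda>z. \<Sum>n<N. c' n * proj_nszego A (mu n) z"
    have P: "model_proj A ?S ?P" by (intro model_proj_sum IA model_proj_nszego M.in_disc)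
    have Peq: "?P = (\<lambda>z. \<Sum>n<N. c n * normalized_kernel A (mu n) z)"
      unfolding nk c'_def by (simp only: mult.assoc)
    have "\<kappa> / M.CR * (\<Sum>n<N. (cmod (c n))\<^sup>2) \<le> \<kappa> / M.CR * (\<Sum>n<N. (cmod (c' n))\<^sup>2)"
      using \<kappa>(1) M.CR_pos by (intro mult_left_mono sum_mono c1) auto
    also have "\<dots> \<le> \<kappa> / M.CR * (M.CR * (h2_norm ?S)\<^sup>2)"
      using \<kappa>(1) M.CR_pos by (intro mult_left_mono M.nszego_riesz(2)) auto
    also have "\<dots> = \<kappa> * (h2_norm ?S)\<^sup>2" using M.CR_pos by simp
    also have "\<dots> \<le> (h2_norm ?P)\<^sup>2" by (rule dual_lower_bound[OF nszego_sum_hspan P])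
    finally have lo: "\<kappa> / M.CR * (\<Sum>n<N. (cmod (c n))\<^sup>2) \<le> (h2_norm ?P)\<^sup>2" .
    have "(h2_norm ?P)\<^sup>2 \<le> (h2_norm ?S)\<^sup>2"
      by (rule power_mono[OF model_proj_norm_le[OF IA P] h2_norm_nonneg[OF model_proj_H2(2)[OF IA P]]])
    also have "\<dots> \<le> M.CR * (\<Sum>n<N. (cmod (c' n))\<^sup>2)" by (rule M.nszego_riesz(1))
    also have "\<dots> \<le> M.CR * (\<Sum>n<N. (cmod (c n))\<^sup>2 / \<kappa>)"
      using M.CR_pos by (intro mult_left_mono sum_mono c2) auto
    also have "\<dots> = M.CR / \<kappa> * (\<Sum>n<N. (cmod (c n))\<^sup>2)" by (simp add: sum_divide_distrib[symmetric])
    finally show ?thesis using lo unfolding Peq by blast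
  qed
  show ?thesis unfolding riesz_basis_def
  proof (intro conjI allI ballI impI)
    show "normalized_kernel A (mu n) \<in> model_space A" for n by (rule nk_in)
    show "\<exists>N a. h2_norm (\<lambda>z. f z - (\<Sum>n<N. a n * normalized_kernel A (mu n) z)) < e"
      if "f \<in> model_space A" "e > 0" for f e by (rule dense[OF that])
    show "\<exists>c C. c > 0 \<and> C > 0 \<and> (\<forall>N a.
        c * (\<Sum>n<N. (cmod (a n))\<^sup>2) \<le> (h2_norm (\<lambda>z. \<Sum>n<N. a n * normalized_kernel A (mu n) z))\<^sup>2 \<and>
        (h2_norm (\<lambda>z. \<Sum>n<N. a n * normalized_kernel A (mu n) z))\<^sup>2 \<le> C * (\<Sum>n<N. (cmod (a n))\<^sup>2))"
      using bounds \<kappa>(1) M.CR_pos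
      by (intro exI[of _ "\<kappa> / M.CR"] exI[of _ "M.CR / \<kappa>"] conjI allI divide_pos_pos) blast+
  qed
qed


text \<open>Approximate f within half its norm by a kernel sum P. Then |<f, P>| is at least ||f||^2
  / 2, and Cauchy-Schwarz bounds it by the coefficients and the samples of f. Since ||P|| <= 3/2
  ||f||, the coefficients satisfy \<open>\<gamma>\<close> sum |c_n|^2 <= 9/4 ||f||^2; comparing 1/4
  with 9/4 gives the constant 9.\<close>

lemma frame_lower_bound:
  assumes f: "f \<in> model_space B" and f0: "h2_norm f > 0"
  shows "\<exists>N. \<gamma> / 9 * (h2_norm f)\<^sup>2 \<le> (\<Sum>n<N. (1 - (cmod (lam n))\<^sup>2) * (cmod (f (lam n)))\<^sup>2)"
proof -
  note fH = model_space_H2[OF f]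
  let ?f = "h2_norm f"
  obtain N c where c: "h2_norm (\<lambda>z. f z - (\<Sum>n<N. c n * proj_nszego B (lam n) z)) < ?f / 2"
    using complete[OF f half_gt_zero[OF f0]] by blast
  let ?P = "\<lambda>z. \<Sum>n<N. c n * proj_nszego B (lam n) z"
  let ?T = "\<Sum>n<N. (1 - (cmod (lam n))\<^sup>2) * (cmod (f (lam n)))\<^sup>2"
  have PH: "?P \<in> H2" by (rule model_proj_H2(2)[OF IB proj_sum])
  have pH: "proj_nszego B (lam n) \<in> H2" for n
    by (rule model_proj_H2(2)[OF IB model_proj_nszego[OF IB L.in_disc]])
  define d where "d n = sqrt (1 - (cmod (lam n))\<^sup>2) * cmod (f (lam n))" for n
  have d2: "(d n)\<^sup>2 = (1 - (cmod (lam n))\<^sup>2) * (cmod (f (lam n)))\<^sup>2" for n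
    unfolding d_def power_mult_distrib using one_minus_cmod_power2_pos[OF L.in_disc[of n]] by simp
  have ip: "h2_inner f ?P = (\<Sum>n<N. cnj (c n) * (of_real (sqrt (1 - (cmod (lam n))\<^sup>2)) * f (lam n)))"
    unfolding h2_inner_sum_right[OF pH fH]
      model_proj_inner[OF IB model_proj_nszego[OF IB L.in_disc] f, symmetric]
      h2_inner_nszego[OF fH L.in_disc] ..
  have "cmod (h2_inner f ?P) \<le> (\<Sum>n<N. \<bar>cmod (c n)\<bar> * \<bar>d n\<bar>)"
    unfolding ip by (rule order.trans[OF norm_sum], rule sum_mono)
      (simp add: d_def norm_mult abs_mult)
  also have "\<dots> \<le> L2_set (\<lambda>n. cmod (c n)) {..<N} * L2_set d {..<N}" by (rule L2_set_mult_ineq)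
  finally have "(cmod (h2_inner f ?P))\<^sup>2 \<le> (L2_set (\<lambda>n. cmod (c n)) {..<N} * L2_set d {..<N})\<^sup>2"
    by (intro power_mono) auto
  also have "\<dots> = (\<Sum>n<N. (cmod (c n))\<^sup>2) * ?T"
    unfolding power_mult_distrib L2_set_def d2[symmetric] by (simp add: sum_nonneg)
  finally have 1: "(cmod (h2_inner f ?P))\<^sup>2 \<le> (\<Sum>n<N. (cmod (c n))\<^sup>2) * ?T" .
  have T0: "?T \<ge> 0" unfolding d2[symmetric] by (intro sum_nonneg) auto
  have "h2_norm ?P \<le> 3 / 2 * ?f"
    using h2_norm_le_diff[OF PH fH] c unfolding h2_norm_diff_commute[OF PH fH] by linarith
  then have "(h2_norm ?P)\<^sup>2 \<le> (3 / 2 * ?f)\<^sup>2" by (rule power_mono[OF _ h2_norm_nonneg[OF PH]])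
  then have 2: "\<gamma> * (\<Sum>n<N. (cmod (c n))\<^sup>2) \<le> 9 / 4 * ?f\<^sup>2"
    using lower[of c N] by (simp add: power_mult_distrib power_divide)
  have 3: "?f\<^sup>2 / 2 \<le> cmod (h2_inner f ?P)"
  proof -
    have "h2_inner f ?P = of_real (?f\<^sup>2) - h2_inner f (\<lambda>z. f z - ?P z)"
      unfolding h2_inner_diff_right[OF fH PH fH] h2_inner_self[OF fH] by simp
    then have "cmod (h2_inner f ?P) \<ge> ?f\<^sup>2 - cmod (h2_inner f (\<lambda>z. f z - ?P z))"
      using norm_triangle_ineq2[of "complex_of_real (?f\<^sup>2)" "h2_inner f (\<lambda>z. f z - ?P z)"]
      by (simp del: of_real_power)
    moreover have "cmod (h2_inner f (\<lambda>z. f z - ?P z)) \<le> ?f * (?f / 2)"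
      by (rule order.trans[OF h2_Cauchy_Schwarz[OF fH H2_diff[OF fH PH]]])
         (intro mult_left_mono less_imp_le[OF c] h2_norm_nonneg[OF fH])
    ultimately show ?thesis by (simp add: power2_eq_square)
  qed
  then have "(?f\<^sup>2 / 2)\<^sup>2 \<le> (cmod (h2_inner f ?P))\<^sup>2" by (intro power_mono) auto
  from order.trans[OF this 1] have "\<gamma> * (?f\<^sup>2 / 2)\<^sup>2 \<le> \<gamma> * ((\<Sum>n<N. (cmod (c n))\<^sup>2) * ?T)"
    by (rule mult_left_mono) (use \<gamma> in simp)
  also have "\<dots> = (\<gamma> * (\<Sum>n<N. (cmod (c n))\<^sup>2)) * ?T" by (rule mult.assoc[symmetric])
  also have "\<dots> \<le> (9 / 4 * ?f\<^sup>2) * ?T" by (rule mult_right_mono[OF 2 T0])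
  finally have "\<gamma> * (?f\<^sup>2 / 2)\<^sup>2 \<le> (9 / 4 * ?f\<^sup>2) * ?T" .
  moreover have "F * (\<gamma> / 4 * F) \<le> F * (9 / 4 * T)" if "\<gamma> * (F / 2)\<^sup>2 \<le> (9 / 4 * F) * T" for F T :: real
    using that by (simp add: power2_eq_square algebra_simps)
  ultimately have "?f\<^sup>2 * (\<gamma> / 4 * ?f\<^sup>2) \<le> ?f\<^sup>2 * (9 / 4 * ?T)" by blast
  then have "\<gamma> / 4 * ?f\<^sup>2 \<le> 9 / 4 * ?T"
    unfolding mult_le_cancel_left_pos[OF zero_less_power[OF f0]] .
  then show ?thesis by (intro exI[of _ N]) simp
qed

text \<open>Every factor is at least d, because it is also one of the factors of A at
  \<open>mu m\<close>. The sum of 1 - rho^2 over Q is at most \<open>M.CR\<close> by the Carleson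
  embedding applied to the Szego kernel at \<open>lam n\<close>, whose norm cancels the weight.
  Neither bound depends on Q or n.\<close>

lemma finite_product_lower_bound:
  assumes d: "d > 0" and Q: "finite Q" "\<And>m. m \<in> Q \<Longrightarrow> cmod (A (mu m)) \<ge> d"
  shows "exp (- M.CR / d\<^sup>2) \<le> (cmod (\<Prod>m\<in>Q. blaschke_factor (mu m) (lam n)))\<^sup>2"
proof -
  let ?l = "lam n"
  let ?\<rho> = "\<lambda>m. pseudo_hyp (mu m) ?l"
  have rho: "?\<rho> m \<ge> d" if "m \<in> Q" for m
    using cmod_blaschke_le_factors[OF L.blaschke_sequence M.in_disc[of m], of "{n}"] Q(2)[OF that]
    by (simp add: pseudo_hyp_commute[of "mu m"])
  obtain N where N: "Q \<subseteq> {..<N}" using finite_nat_bounded[OF Q(1)] by blast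
  have t: "1 - (cmod ?l)\<^sup>2 > 0" by (rule one_minus_cmod_power2_pos[OF L.in_disc])
  have "(\<Sum>m\<in>Q. 1 - (?\<rho> m)\<^sup>2) \<le> (\<Sum>m<N. 1 - (?\<rho> m)\<^sup>2)"
  proof (rule sum_mono2[OF _ N])
    show "0 \<le> 1 - (?\<rho> m)\<^sup>2" for m
      using pseudo_hyp_less_1[OF M.in_disc L.in_disc, of m n] pseudo_hyp_nonneg[of "mu m" ?l]
      by (simp add: power_le_one)
  qed simp
  also have "\<dots> = (1 - (cmod ?l)\<^sup>2) * (\<Sum>m<N. (1 - (cmod (mu m))\<^sup>2) * (cmod (szego ?l (mu m)))\<^sup>2)"
    unfolding sum_distrib_left
  proof (rule sum.cong[OF refl])
    fix m
    have "1 - (?\<rho> m)\<^sup>2 = 1 - (pseudo_hyp ?l (mu m))\<^sup>2" by (simp add: pseudo_hyp_commute)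
    also have "\<dots> = (1 - (cmod ?l)\<^sup>2) * ((1 - (cmod (mu m))\<^sup>2) * (cmod (szego ?l (mu m)))\<^sup>2)"
      unfolding one_minus_pseudo_hyp_power2[OF L.in_disc M.in_disc] szego_def
      by (simp add: norm_divide power_divide)
    finally show "1 - (?\<rho> m)\<^sup>2 = (1 - (cmod ?l)\<^sup>2) * ((1 - (cmod (mu m))\<^sup>2) * (cmod (szego ?l (mu m)))\<^sup>2)" .
  qed
  also have "\<dots> \<le> (1 - (cmod ?l)\<^sup>2) * (M.CR * (h2_norm (szego ?l))\<^sup>2)"
    using t by (intro mult_left_mono M.Carleson_embedding H2_szego L.in_disc) auto
  also have "\<dots> = M.CR" unfolding h2_norm_szego[OF L.in_disc] using t by simp
  finally have S: "(\<Sum>m\<in>Q. 1 - (?\<rho> m)\<^sup>2) \<le> M.CR" .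
  have "- M.CR / d\<^sup>2 \<le> - (\<Sum>m\<in>Q. 1 - (?\<rho> m)\<^sup>2) / d\<^sup>2" using S by (intro divide_right_mono) auto
  also have "\<dots> = (\<Sum>m\<in>Q. - (1 - (?\<rho> m)\<^sup>2) / d\<^sup>2)" unfolding sum_divide_distrib[symmetric] sum_negf ..
  also have "\<dots> \<le> (\<Sum>m\<in>Q. ln ((?\<rho> m)\<^sup>2))"
  proof (rule sum_mono)
    fix m assume m: "m \<in> Q"
    let ?x = "(?\<rho> m)\<^sup>2"
    have x: "d\<^sup>2 \<le> ?x" using rho[OF m] d by (intro power_mono) auto
    have d2: "d\<^sup>2 > 0" using d by simp
    have x1: "?x \<le> 1"
      using pseudo_hyp_less_1[OF M.in_disc L.in_disc, of m n] pseudo_hyp_nonneg[of "mu m" ?l]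
      by (simp add: power_le_one)
    have xp: "?x > 0" using x d2 by linarith
    \<comment> \<open>For x between d^2 and 1, -ln x <= (1 - x) / x <= (1 - x) / d^2; this converts
      the sum bound into a product bound.\<close>
    have "ln (1 / ?x) \<le> 1 / ?x - 1" using xp by (intro ln_le_minus_one) simp
    then have "- ln ?x \<le> (1 - ?x) / ?x" using xp by (simp add: ln_div diff_divide_distrib)
    also have "\<dots> \<le> (1 - ?x) / d\<^sup>2" using x x1 d2 xp by (intro divide_left_mono) auto
    finally show "- (1 - ?x) / d\<^sup>2 \<le> ln ?x" unfolding minus_divide_left[symmetric] by linarith
  qed
  finally have "exp (- M.CR / d\<^sup>2) \<le> exp (\<Sum>m\<in>Q. ln ((?\<rho> m)\<^sup>2))" by simp
  also have "\<dots> = (\<Prod>m\<in>Q. (?\<rho> m)\<^sup>2)"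
    unfolding exp_sum[OF Q(1)] by (rule prod.cong[OF refl]) (use rho d in \<open>force intro!: exp_ln\<close>)
  also have "\<dots> = (cmod (\<Prod>m\<in>Q. blaschke_factor (mu m) ?l))\<^sup>2"
    by (simp add: prod_norm[symmetric] cmod_blaschke_factor prod_power_distrib)
  finally show ?thesis .
qed

theorem dual_limit:
  assumes lim: "(\<lambda>n. B (lam n)) \<longlonglongrightarrow> 0"
  shows "(\<lambda>n. A (mu n)) \<longlonglongrightarrow> 0"
proof (rule ccontr)
  assume "\<not> (\<lambda>n. A (mu n)) \<longlonglongrightarrow> 0"
  then obtain d where d: "d > 0" and unb: "\<And>N. \<exists>m\<ge>N. cmod (A (mu m)) \<ge> d"
    unfolding LIMSEQ_iff by (auto simp: not_less)
  then have inf: "infinite {m. cmod (A (mu m)) \<ge> d}"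
    unfolding infinite_nat_iff_unbounded_le by auto
  define b where "b = exp (- M.CR / d\<^sup>2)"
  have b: "b > 0" by (simp add: b_def)
  \<comment> \<open>After the Carleson embedding of \<open>lam\<close> costs \<open>L.CR\<close>,
    this leaves \<open>\<gamma> / 18\<close>, half of the frame constant
    \<open>\<gamma> / 9\<close>.\<close>
  define \<epsilon> where "\<epsilon> = \<gamma> / (18 * L.CR)"
  have \<epsilon>: "\<epsilon> > 0" unfolding \<epsilon>_def using \<gamma> L.CR_pos by simp
  have "(\<lambda>n. (cmod (B (lam n)))\<^sup>2) \<longlonglongrightarrow> (cmod 0)\<^sup>2" by (intro tendsto_intros lim)
  then have "\<exists>n0. \<forall>n\<ge>n0. norm ((cmod (B (lam n)))\<^sup>2 - (cmod 0)\<^sup>2) < \<epsilon> * b"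
    by (rule LIMSEQ_D) (use \<epsilon> b in simp)
  then obtain n0 where n0: "\<And>n. n \<ge> n0 \<Longrightarrow> (cmod (B (lam n)))\<^sup>2 < \<epsilon> * b" by auto
  \<comment> \<open>One more kernel than there are points \<open>lam i\<close> with i < n0, so some
    nontrivial combination vanishes at all of them. The choice of n0 precedes Q, which is possible
    because b is independent of Q.\<close>
  obtain Q where Q: "Q \<subseteq> {m. cmod (A (mu m)) \<ge> d}" "finite Q" "card Q = Suc n0"
    using infinite_arbitrarily_large[OF inf, of "Suc n0"] by blast
  obtain \<theta> where \<theta>: "inner_function \<theta>"
    "\<And>z. z \<in> ball 0 1 \<Longrightarrow> B z = (\<Prod>m\<in>Q. blaschke_factor (mu m) z) * \<theta> z"
    using blaschke_split[OF M.blaschke_sequence Q(2)] by blast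
  have \<theta>le: "(cmod (\<theta> (lam n)))\<^sup>2 \<le> \<epsilon>" if "n \<ge> n0" for n
  proof -
    have "b * (cmod (\<theta> (lam n)))\<^sup>2
      \<le> (cmod (\<Prod>m\<in>Q. blaschke_factor (mu m) (lam n)))\<^sup>2 * (cmod (\<theta> (lam n)))\<^sup>2"
      unfolding b_def using Q by (intro mult_right_mono finite_product_lower_bound[OF d]) auto
    also have "\<dots> = (cmod (B (lam n)))\<^sup>2"
      unfolding \<theta>(2)[OF L.in_disc] norm_mult power_mult_distrib ..
    also have "\<dots> < b * \<epsilon>" using n0[OF that] by (simp add: mult.commute)
    finally show ?thesis using b by simp
  qed
  obtain c where c: "\<exists>j\<in>Q. c j \<noteq> 0" "\<And>i. i < n0 \<Longrightarrow> (\<Sum>j\<in>Q. c j * nszego (mu j) (lam i)) = 0"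
    using underdetermined_system[OF Q(2), of n0 "\<lambda>i j. nszego (mu j) (lam i)"] Q(3) by auto
  let ?h = "\<lambda>z. \<Sum>j\<in>Q. c j * nszego (mu j) z"
  have h: "?h \<in> H2" by (intro H2_sum H2_nszego M.in_disc)
  \<comment> \<open>Nontrivial coefficients give a nonzero function by the lower Riesz bound for
    \<open>mu\<close>, once they are extended by 0 to an initial segment.\<close>
  have h0: "h2_norm ?h > 0"
  proof -
    obtain N where N: "Q \<subseteq> {..<N}" using finite_nat_bounded[OF Q(2)] by blast
    let ?c = "\<lambda>j. if j \<in> Q then c j else 0"
    have "?h = (\<lambda>z. \<Sum>n<N. ?c n * nszego (mu n) z)"
      by (rule ext, rule sum.mono_neutral_cong_left) (use N in auto)
    then have "(\<Sum>n<N. (cmod (?c n))\<^sup>2) \<le> M.CR * (h2_norm ?h)\<^sup>2"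
      using M.nszego_riesz(2)[of ?c N] by metis
    moreover have "(\<Sum>n<N. (cmod (?c n))\<^sup>2) > 0"
    proof -
      obtain j where j: "j \<in> Q" "c j \<noteq> 0" using c(1) by blast
      then show ?thesis using N by (intro sum_pos2[of _ j]) auto
    qed
    ultimately have "(h2_norm ?h)\<^sup>2 \<noteq> 0" by (intro notI) simp
    then show ?thesis using h2_norm_nonneg[OF h] by (simp add: less_le)
  qed
  let ?f = "\<lambda>z. \<theta> z * ?h z"
  \<comment> \<open>On the disc B is theta times the product over Q. Cancelling theta isometrically
    leaves h against multiples of that product, which vanish at every kernel point of h.\<close>
  have fB: "?f \<in> model_space B"
    unfolding model_space_def mem_Collect_eq
  proof (intro conjI ballI inner_function_H2[OF \<theta>(1) h])
    fix g assume g: "g \<in> H2"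
    let ?p = "\<lambda>z. (\<Prod>m\<in>Q. blaschke_factor (mu m) z) * g z"
    have p: "?p \<in> H2"
      by (intro inner_function_H2 inner_function_partial_product M.in_disc g)
    have "h2_inner ?f (\<lambda>z. B z * g z) = h2_inner ?f (\<lambda>z. \<theta> z * ?p z)"
      by (rule h2_inner_cong) (simp_all add: \<theta>(2) mult_ac)
    also have "\<dots> = h2_inner ?h ?p" by (rule inner_function_inner[OF \<theta>(1) h p])
    also have "\<dots> = (\<Sum>j\<in>Q. c j * h2_inner (nszego (mu j)) ?p)"
      by (rule h2_inner_sum_left[OF H2_nszego[OF M.in_disc] p])
    also have "\<dots> = 0"
    proof (rule sum.neutral, rule ballI)
      fix j assume j: "j \<in> Q"
      have "?p (mu j) = 0" using j Q(2) by (simp add: prod_zero blaschke_factor_self bexI[of _ j])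
      then have "h2_inner ?p (nszego (mu j)) = 0" unfolding h2_inner_nszego[OF p M.in_disc] by simp
      then show "c j * h2_inner (nszego (mu j)) ?p = 0"
        unfolding h2_inner_commute[OF p H2_nszego[OF M.in_disc]] by simp
    qed
    finally show "h2_inner ?f (\<lambda>z. B z * g z) = 0" .
  qed
  have fn: "h2_norm ?f = h2_norm ?h" by (rule inner_function_norm[OF \<theta>(1) h])
  obtain N where N: "\<gamma> / 9 * (h2_norm ?f)\<^sup>2 \<le> (\<Sum>n<N. (1 - (cmod (lam n))\<^sup>2) * (cmod (?f (lam n)))\<^sup>2)"
    using frame_lower_bound[OF fB] h0 unfolding fn by blast
  also have "\<dots> \<le> (\<Sum>n<N. \<epsilon> * ((1 - (cmod (lam n))\<^sup>2) * (cmod (?h (lam n)))\<^sup>2))"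
  proof (rule sum_mono)
    fix n
    have t: "1 - (cmod (lam n))\<^sup>2 > 0" by (rule one_minus_cmod_power2_pos[OF L.in_disc])
    have "(cmod (?f (lam n)))\<^sup>2 \<le> \<epsilon> * (cmod (?h (lam n)))\<^sup>2"
    proof (cases "n < n0")
      case True
      then show ?thesis using c(2)[OF True] by simp
    next
      case False
      then show ?thesis unfolding norm_mult power_mult_distrib by (intro mult_right_mono \<theta>le) auto
    qed
    then have "(1 - (cmod (lam n))\<^sup>2) * (cmod (?f (lam n)))\<^sup>2 \<le> (1 - (cmod (lam n))\<^sup>2) * (\<epsilon> * (cmod (?h (lam n)))\<^sup>2)"
      using t by (intro mult_left_mono) auto
    then show "(1 - (cmod (lam n))\<^sup>2) * (cmod (?f (lam n)))\<^sup>2 \<le> \<epsilon> * ((1 - (cmod (lam n))\<^sup>2) * (cmod (?h (lam n)))\<^sup>2)"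
      unfolding mult.left_commute[of \<epsilon>] .
  qed
  also have "\<dots> = \<epsilon> * (\<Sum>n<N. (1 - (cmod (lam n))\<^sup>2) * (cmod (?h (lam n)))\<^sup>2)" by (rule sum_distrib_left[symmetric])
  also have "\<dots> \<le> \<epsilon> * (L.CR * (h2_norm ?h)\<^sup>2)"
    using \<epsilon> by (intro mult_left_mono L.Carleson_embedding h) auto
  also have "\<dots> = \<gamma> / 18 * (h2_norm ?h)\<^sup>2" unfolding \<epsilon>_def using L.CR_pos by simp
  finally have "\<gamma> / 9 * (h2_norm ?h)\<^sup>2 \<le> \<gamma> / 18 * (h2_norm ?h)\<^sup>2" unfolding fn .
  moreover have "\<gamma> * (h2_norm ?h)\<^sup>2 > 0" using \<gamma> h0 by simp
  ultimately show False by simp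
qed

end


section \<open>Translation of the stated hypotheses into bounds for projected unit kernels\<close>

theorem theorem6:
  fixes lam mu :: "nat \<Rightarrow> complex"
  assumes "\<forall>n. lam n \<in> ball 0 1"
    and "\<forall>n. mu n \<in> ball 0 1"
    and "carleson lam"
    and "carleson mu"
    and "(\<lambda>n. blaschke mu (lam n)) \<longlonglongrightarrow> 0"
    and "riesz_basis (model_space (blaschke mu)) (\<lambda>n. normalized_kernel (blaschke mu) (lam n))"
  shows "(\<lambda>n. blaschke lam (mu n)) \<longlonglongrightarrow> 0 \<and>
         riesz_basis (model_space (blaschke lam)) (\<lambda>n. normalized_kernel (blaschke lam) (mu n))"
proof -
  obtain \<delta>L where L: "carleson_sequence lam \<delta>L"
    using assms(1,3) unfolding carleson_def carleson_sequence_def by auto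
  obtain \<delta>M where M: "carleson_sequence mu \<delta>M"
    using assms(2,4) unfolding carleson_def carleson_sequence_def by auto
  interpret L: carleson_sequence lam \<delta>L by (rule L)
  interpret M: carleson_sequence mu \<delta>M by (rule M)
  let ?B = "blaschke mu"
  note IB = inner_function_blaschke[OF M.blaschke_sequence]
  have lt1: "cmod (?B (lam n)) < 1" for n by (rule cmod_blaschke_less_1[OF M.blaschke_sequence L.in_disc])
  \<comment> \<open>Uniform lower bound for the squared normalising factors: the limit hypothesis
    handles all large n, and |B| < 1 in the disc handles the finitely many others.\<close>
  obtain \<sigma> where \<sigma>: "\<sigma> > 0" "\<And>n. \<sigma> \<le> 1 - (cmod (?B (lam n)))\<^sup>2"
  proof -
    have "(\<lambda>n. (cmod (?B (lam n)))\<^sup>2) \<longlonglongrightarrow> (cmod 0)\<^sup>2" by (intro tendsto_intros assms(5))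
    then have "\<exists>N. \<forall>n\<ge>N. norm ((cmod (?B (lam n)))\<^sup>2 - (cmod 0)\<^sup>2) < 1 / 2"
      by (rule LIMSEQ_D) simp
    then obtain N where N: "\<And>n. n \<ge> N \<Longrightarrow> (cmod (?B (lam n)))\<^sup>2 < 1 / 2" by auto
    \<comment> \<open>The entry 1/2 covers the tail n >= N and also keeps the set nonempty when N =
      0.\<close>
    let ?F = "insert (1 / 2) ((\<lambda>n. 1 - (cmod (?B (lam n)))\<^sup>2) ` {..<N})"
    have pos: "0 < 1 - (cmod (?B (lam n)))\<^sup>2" for n using lt1[of n] by (simp add: abs_square_less_1)
    show ?thesis
    proof (rule that[of "Min ?F"])
      show "0 < Min ?F" using pos by (subst Min_gr_iff) auto
      show "Min ?F \<le> 1 - (cmod (?B (lam n)))\<^sup>2" for n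
      proof (cases "n < N")
        case True
        then show ?thesis by (intro Min_le) auto
      next
        case False
        have "Min ?F \<le> 1 / 2" by (intro Min_le) auto
        with N[of n] False show ?thesis by simp
      qed
    qed
  qed
  define s where "s n = sqrt (1 - (cmod (?B (lam n)))\<^sup>2)" for n
  have s0: "s n > 0" and s2: "(s n)\<^sup>2 \<ge> \<sigma>" for n
    using \<sigma>(2)[of n] \<sigma>(1) by (simp_all add: s_def)
  have eq: "proj_nszego ?B (lam n) z = of_real (s n) * normalized_kernel ?B (lam n) z" for n z
    unfolding s_def by (rule proj_nszego_eq_normalized_kernel[OF IB L.in_disc lt1])
  obtain c where c: "c > 0" "\<And>N a. c * (\<Sum>n<N. (cmod (a n))\<^sup>2)
      \<le> (h2_norm (\<lambda>z. \<Sum>n<N. a n * normalized_kernel ?B (lam n) z))\<^sup>2"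
    using assms(6) unfolding riesz_basis_def by blast
  have complete: "\<exists>N a. h2_norm (\<lambda>z. f z - (\<Sum>n<N. a n * normalized_kernel ?B (lam n) z)) < e"
    if "f \<in> model_space ?B" "e > 0" for f e
    using assms(6) that unfolding riesz_basis_def by blast
  \<comment> \<open>Passing from normalised to projected kernels multiplies coefficient n by s n,
    whose square is at least \<open>\<sigma>\<close>; hence the constant
    \<open>c * \<sigma>\<close>.\<close>
  interpret P: carleson_pair lam mu \<delta>L \<delta>M "c * \<sigma>"
  proof unfold_locales
    show "0 < c * \<sigma>" using c(1) \<sigma>(1) by simp
    show "c * \<sigma> * (\<Sum>n<N. (cmod (a n))\<^sup>2) \<le> (h2_norm (\<lambda>z. \<Sum>n<N. a n * proj_nszego ?B (lam n) z))\<^sup>2" for N a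
    proof -
      have "\<sigma> * (cmod (a n))\<^sup>2 \<le> (cmod (a n * of_real (s n)))\<^sup>2" for n
        unfolding norm_mult norm_of_real power_mult_distrib power2_abs mult.commute[of \<sigma>]
        by (rule mult_left_mono[OF s2]) simp
      then have "c * \<sigma> * (\<Sum>n<N. (cmod (a n))\<^sup>2) \<le> c * (\<Sum>n<N. (cmod (a n * of_real (s n)))\<^sup>2)"
        unfolding mult.assoc sum_distrib_left[of \<sigma>] using c(1) by (intro mult_left_mono sum_mono) auto
      also have "\<dots> \<le> (h2_norm (\<lambda>z. \<Sum>n<N. a n * of_real (s n) * normalized_kernel ?B (lam n) z))\<^sup>2"
        by (rule c(2))
      finally show ?thesis unfolding eq mult.assoc .
    qed
    show "\<exists>N a. h2_norm (\<lambda>z. f z - (\<Sum>n<N. a n * proj_nszego ?B (lam n) z)) < e"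
      if fe: "f \<in> model_space ?B" "e > 0" for f e
    proof -
      obtain N a where a: "h2_norm (\<lambda>z. f z - (\<Sum>n<N. a n * normalized_kernel ?B (lam n) z)) < e"
        using complete[OF fe] by blast
      have "a n * normalized_kernel ?B (lam n) z = (a n / of_real (s n)) * proj_nszego ?B (lam n) z" for n z
        unfolding eq using s0[of n] by simp
      then show ?thesis using a by (intro exI[of _ N] exI[of _ "\<lambda>n. a n / of_real (s n)"]) simp
    qed
  qed
  show ?thesis using P.dual_limit[OF assms(5)] P.dual_riesz_basis by blast
qed

end
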